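(* Let $n,q\ge 1$ and $N\ge 1$ be integers, and let $X$ be a germ at a point $x\in\mathbb P^N$ of a smooth complex analytic submanifold of $\mathbb P^N$ of dimension $n$. Assume that $X$ is $q$-regular at $x$, and that for every tangent direction $v\in\mathbb P(T_xX)$ there exists a rational normal curve of degree $q$ in $\mathbb P^N$ passing through $x$, tangent to $v$ at $x$, whose germ at $x$ is contained in $X$. Then $X$ is the germ at $x$ of a Veronese variety of order $q$ (of dimension $n$).
   Context: Everything is over $\mathbb C$. A subvariety of dimension $n$ of a projective space is a Veronese variety of order $q$ if, in the projective space it spans, it is the image of $\mathbb P^n$ under an embedding associated with the complete linear system $|\mathcal O_{\mathbb P^n}(q)|$ (so it spans a space of dimension $\binom{n+q}{q}-1$). A rational normal curve of degree $q$ is a Veronese variety of dimension $1$ and order $q$ (it spans a projective subspace of dimension $q$). Osculating space and regularity: for a germ of smooth variety $X\subset\mathbb P^N$ of dimension $n$ and $x\in X$, the osculating space $X_x(q)$ of order $q$ is the projective subspace of $\mathbb P^N$ passing through $x$ whose direction is the vector space spanned by the derivatives at $x$ of orders $1,\dots,q$ (computed in an affine chart) of germs of parametrized curves lying on $X$. $X$ is $q$-regular at $x$ if $X_x(q)$ has the maximal possible dimension $\binom{n+q}{q}-1$. *)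

theory Defs
  imports "HOL-Complex_Analysis.Complex_Analysis" "HOL-Library.Function_Algebras"
begin

text \<open>
  \<open>'n cproj\<close> is the complex projective space of dimension \<open>CARD('n)\<close>: its points are the complex
  lines through the origin of the space of vectors with the \<open>CARD('n) + 1\<close> homogeneous
  coordinates indexed by \<open>'n option\<close>. It carries the quotient topology.
\<close>

typedef 'n cproj = "{vec.span {v} |v :: complex ^ ('n::finite option). v \<noteq> 0}"
  morphisms line_of point_of_line
proof -
  have "axis None 1 \<noteq> (0 :: complex ^ ('n option))"
    by (simp add: axis_eq_0_iff)
  then show ?thesis by blast
qed

definition hpt :: "complex ^ ('n::finite option) \<Rightarrow> 'n cproj" where
  "hpt v = point_of_line (vec.span {v})"

lemma line_of_hpt: "v \<noteq> 0 \<Longrightarrow> line_of (hpt v) = vec.span {v}"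
  unfolding hpt_def by (rule point_of_line_inverse) blast

instantiation cproj :: (finite) topological_space
begin

definition open_cproj :: "'a cproj set \<Rightarrow> bool" where
  "open_cproj U \<longleftrightarrow> open {v. v \<noteq> 0 \<and> hpt v \<in> U}"

instance
proof
  have "{v :: complex ^ ('a option). v \<noteq> 0} = - {0}" by auto
  then show "open (UNIV :: 'a cproj set)"
    by (simp add: open_cproj_def open_Compl)
next
  fix S T :: "'a cproj set"
  assume "open S" "open T"
  moreover have "{v. v \<noteq> 0 \<and> hpt v \<in> S \<inter> T} =
      {v. v \<noteq> 0 \<and> hpt v \<in> S} \<inter> {v. v \<noteq> 0 \<and> hpt v \<in> T}" by auto
  ultimately show "open (S \<inter> T)"
    by (simp only: open_cproj_def open_Int)
next
  fix K :: "'a cproj set set"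
  assume "\<forall>S\<in>K. open S"
  moreover have "{v. v \<noteq> 0 \<and> hpt v \<in> \<Union>K} = (\<Union>S\<in>K. {v. v \<noteq> 0 \<and> hpt v \<in> S})" by auto
  ultimately show "open (\<Union>K)"
    by (simp only: open_cproj_def) (rule open_UN)
qed

end

definition lin_span :: "'n::finite cproj set \<Rightarrow> (complex ^ ('n option)) set" where
  "lin_span S = vec.span (\<Union>p\<in>S. line_of p)"

definition proj_subspace :: "(complex ^ ('n::finite option)) set \<Rightarrow> 'n cproj set" where
  "proj_subspace L = {p. line_of p \<subseteq> L}"

definition proj_dim :: "'n::finite cproj set \<Rightarrow> int" where
  "proj_dim S = int (vec.dim (lin_span S)) - 1"

text \<open>
  The complement of the \<open>i\<close>-th coordinate hyperplane. We identify it with the affine space of the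
  vectors \<open>v\<close> with \<open>v $ i = 1\<close>; the directions are then the vectors with \<open>i\<close>-th coordinate zero.
\<close>

definition affine_chart :: "'n::finite option \<Rightarrow> 'n cproj set" where
  "affine_chart i = {p. \<exists>v\<in>line_of p. v $ i \<noteq> 0}"

text \<open>A germ at \<open>x\<close> is represented by any set \<open>X\<close> inducing it.\<close>

definition germ_subset :: "'a::topological_space \<Rightarrow> 'a set \<Rightarrow> 'a set \<Rightarrow> bool" where
  "germ_subset x X Y \<longleftrightarrow> (\<exists>U. open U \<and> x \<in> U \<and> X \<inter> U \<subseteq> Y \<inter> U)"

definition germ_eq :: "'a::topological_space \<Rightarrow> 'a set \<Rightarrow> 'a set \<Rightarrow> bool" where
  "germ_eq x X Y \<longleftrightarrow> (\<exists>U. open U \<and> x \<in> U \<and> X \<inter> U = Y \<inter> U)"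

text \<open>Complex linearity of the differential is expressed by its being given by a complex matrix.\<close>

definition holomorphic_immersion_on ::
    "(complex ^ 'n::finite \<Rightarrow> complex ^ 'm::finite) \<Rightarrow> (complex ^ 'n) set \<Rightarrow> bool" where
  "holomorphic_immersion_on f W \<longleftrightarrow>
     (\<forall>w\<in>W. \<exists>A :: complex ^ 'n ^ 'm. (f has_derivative (\<lambda>h. A *v h)) (at w) \<and> inj ((*v) A))"

text \<open>
  \<open>X\<close> is, near \<open>x \<in> X\<close>, a complex submanifold of dimension \<open>CARD('n)\<close>: it is parametrized, in some
  affine chart, by a holomorphic immersion that is a homeomorphism onto its image.
\<close>

definition submanifold_germ ::
    "'n::finite itself \<Rightarrow> 'm::finite cproj set \<Rightarrow> 'm cproj \<Rightarrow> bool" where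
  "submanifold_germ _ X x \<longleftrightarrow> x \<in> X \<and>
     (\<exists>i U (W :: (complex ^ 'n) set) \<phi> \<psi>. open U \<and> x \<in> U \<and> open W \<and>
        holomorphic_immersion_on \<phi> W \<and> (\<forall>w\<in>W. \<phi> w $ i = 1) \<and>
        homeomorphism W (X \<inter> U) (\<lambda>w. hpt (\<phi> w)) \<psi>)"

text \<open>Germs at \<open>0\<close> of holomorphic parametrized curves on \<open>X\<close> with origin \<open>x\<close>, in the \<open>i\<close>-th chart.\<close>

definition curve_germ ::
    "'m::finite option \<Rightarrow> 'm cproj set \<Rightarrow> 'm cproj \<Rightarrow> (complex \<Rightarrow> complex ^ ('m option)) \<Rightarrow> bool" where
  "curve_germ i X x \<gamma> \<longleftrightarrow>
     (\<forall>j. (\<lambda>t. \<gamma> t $ j) analytic_on {0}) \<and> hpt (\<gamma> 0) = x \<and>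
     (\<forall>\<^sub>F t in nhds 0. \<gamma> t $ i = 1 \<and> hpt (\<gamma> t) \<in> X)"

definition curve_deriv :: "nat \<Rightarrow> (complex \<Rightarrow> complex ^ 'k::finite) \<Rightarrow> complex ^ 'k" where
  "curve_deriv k \<gamma> = (\<chi> j. (deriv ^^ k) (\<lambda>t. \<gamma> t $ j) 0)"

definition tangent_space ::
    "'m::finite option \<Rightarrow> 'm cproj set \<Rightarrow> 'm cproj \<Rightarrow> (complex ^ ('m option)) set" where
  "tangent_space i X x = {curve_deriv 1 \<gamma> |\<gamma>. curve_germ i X x \<gamma>}"

definition osculating_direction ::
    "'m::finite option \<Rightarrow> nat \<Rightarrow> 'm cproj set \<Rightarrow> 'm cproj \<Rightarrow> (complex ^ ('m option)) set" where
  "osculating_direction i q X x =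
     vec.span {curve_deriv k \<gamma> |k \<gamma>. k \<in> {1..q} \<and> curve_germ i X x \<gamma>}"

definition osculating_space ::
    "'m::finite option \<Rightarrow> nat \<Rightarrow> 'm cproj set \<Rightarrow> 'm cproj \<Rightarrow> 'm cproj set" where
  "osculating_space i q X x = proj_subspace (vec.span (line_of x \<union> osculating_direction i q X x))"

definition q_regular ::
    "'m::finite option \<Rightarrow> nat \<Rightarrow> nat \<Rightarrow> 'm cproj set \<Rightarrow> 'm cproj \<Rightarrow> bool" where
  "q_regular i n q X x \<longleftrightarrow> proj_dim (osculating_space i q X x) = int ((n + q) choose q) - 1"

interpretation cfun: vector_space "\<lambda>c (f :: 'a \<Rightarrow> complex) z. c * f z"
  by unfold_locales (auto simp: fun_eq_iff algebra_simps)

text \<open>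
  The global sections of the sheaf \<open>O(q)\<close> on \<open>'n cproj\<close>: homogeneous polynomials of degree \<open>q\<close> in
  the homogeneous coordinates, as polynomial functions.
\<close>

definition forms :: "nat \<Rightarrow> (complex ^ ('n::finite option) \<Rightarrow> complex) set" where
  "forms q = cfun.span {\<lambda>z. \<Prod>i\<in>UNIV. z $ i ^ \<alpha> i |\<alpha>. (\<Sum>i\<in>UNIV. \<alpha> i) = q}"

text \<open>
  A map associated with the complete linear system of \<open>O(q)\<close>, into the projective space spanned by
  its image: its coordinates with respect to a basis \<open>(e s)\<close> of the corresponding
  vector space are the elements \<open>s\<close> of a basis \<open>B\<close> of the space of all forms of degree \<open>q\<close>.
  Finiteness of \<open>B\<close>, and for \<open>q \<ge> 1\<close> that \<open>\<nu>\<close> is an embedding, are automatic.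
\<close>

definition veronese_embedding :: "nat \<Rightarrow> ('n::finite cproj \<Rightarrow> 'm::finite cproj) \<Rightarrow> bool" where
  "veronese_embedding q \<nu> \<longleftrightarrow>
     (\<exists>(B :: (complex ^ ('n option) \<Rightarrow> complex) set) (e :: _ \<Rightarrow> complex ^ ('m option)).
        cfun.independent B \<and> cfun.span B = forms q \<and>
        inj_on e B \<and> vec.independent (e ` B) \<and> vec.span (e ` B) = lin_span (range \<nu>) \<and>
        (\<forall>z. z \<noteq> 0 \<longrightarrow> line_of (\<nu> (hpt z)) = vec.span {\<Sum>s\<in>B. s z *s e s}))"

definition veronese_variety :: "'n::finite itself \<Rightarrow> nat \<Rightarrow> 'm::finite cproj set \<Rightarrow> bool" where
  "veronese_variety _ q V \<longleftrightarrow> (\<exists>\<nu> :: 'n cproj \<Rightarrow> 'm cproj. veronese_embedding q \<nu> \<and> V = range \<nu>)"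

definition rational_normal_curve :: "nat \<Rightarrow> 'm::finite cproj set \<Rightarrow> bool" where
  "rational_normal_curve q C \<longleftrightarrow> veronese_variety TYPE(1) q C"

end

theory Submission
  imports Defs
begin

text \<open>
  Write \<open>X\<close> near \<open>x\<close> as the image of a chart \<open>\<Phi>\<close> with \<open>\<Phi> u = (\<Sum>\<alpha>. u\<^sup>\<alpha> e\<^sub>\<alpha>)\<close>; \<open>q\<close>-regularity means that
  the \<open>e\<^sub>\<alpha>\<close> with \<open>|\<alpha>| \<le> q\<close> are linearly independent. The rational normal curve with tangent \<open>v\<close> lifts
  to a polynomial curve \<open>\<lambda>(t) \<Phi>(y(t))\<close> of degree at most \<open>q\<close>, where \<open>y = t v + O(t\<^sup>2)\<close> and, after moving
  the point at infinity of the parameter line, \<open>\<lambda> = 1 + O(t\<^sup>2)\<close>. The vanishing of the coefficients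
  of order greater than \<open>q\<close>, read off with the functionals dual to the \<open>e\<^sub>\<alpha>\<close> for \<open>|\<alpha>| = q\<close> and
  \<open>|\<alpha>| = q - 1\<close>, determines inductively the Taylor coefficients of \<open>\<lambda>\<close> and \<open>y\<close> as functions of \<open>v\<close>:
  multiplied by powers of any one coordinate of \<open>v\<close> they are polynomials, so they are homogeneous and
  holomorphic outside the origin, hence homogeneous polynomials. Thus all these curves are the
  images of the lines through the origin under one polynomial map of degree \<open>q\<close>, whose
  coefficients are unitriangular in the \<open>e\<^sub>\<alpha>\<close> and therefore independent: a Veronese map. A
  holomorphic function vanishing on a curve in every tangent direction is zero, so \<open>X\<close> lies on the
  Veronese variety, and invariance of domain gives the converse inclusion near \<open>x\<close>.
\<close>

section \<open>Homogeneous polynomial functions\<close>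

text \<open>The curves come from an arbitrary choice in each direction, so nothing is known at the
  outset about their dependence on \<open>v\<close>; all regularity is extracted from the vanishing
  equations. With Z = y / t and d = |\<beta>|, the equation for \<beta> at order m controls, modulo
  forms already known, the combination v_k lam_m + d Z_(k,m), and it is available only if d + m > q.
  For m \<ge> 2 the values d = q and d = q - 1 separate the two unknowns. For m = 1 only d = q
  qualifies, which is why the first-order term of \<lambda> has to be normalized to 0. The equations
  carry extra powers of the coordinates of \<open>v\<close>; dividing them out leaves a homogeneous
  function with a possible singularity only at the origin.

  The comparison with the Veronese variety rests on the completeness of the linear system: linear
  functionals recover z_0^(q-1) z_j from the Veronese point of z. This provides both explicit
  equations to be tested along the curves and a local inverse of the Veronese map.\<close>

text \<open>Any commutative semiring is allowed because monomials are evaluated both at the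
  coordinates of a point and at the power series of a curve.\<close>

definition mon :: "('k::finite \<Rightarrow> nat) \<Rightarrow> ('k \<Rightarrow> 'a::comm_semiring_1) \<Rightarrow> 'a" where
  "mon \<alpha> y = (\<Prod>j\<in>UNIV. y j ^ \<alpha> j)"

definition expos :: "nat \<Rightarrow> ('k::finite \<Rightarrow> nat) set" where
  "expos d = {\<alpha>. (\<Sum>i\<in>UNIV. \<alpha> i) = d}"

text \<open>The forms of degree \<open>d\<close> over an arbitrary index type: they are needed on
  the parameter space \<open>complex ^ 'n\<close> as well as in the homogeneous coordinates.\<close>

definition homf :: "nat \<Rightarrow> (complex ^ 'k::finite \<Rightarrow> complex) set" where
  "homf d = cfun.span {\<lambda>z. \<Prod>i\<in>UNIV. z $ i ^ \<alpha> i |\<alpha>. (\<Sum>i\<in>UNIV. \<alpha> i) = d}"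

lemma forms_eq_homf: "forms q = homf q"
  by (simp add: forms_def homf_def)

lemma homf_eq_span_mon: "homf d = cfun.span ((\<lambda>\<alpha> z. mon \<alpha> (($) z)) ` expos d)"
  unfolding homf_def expos_def mon_def by (rule arg_cong[of _ _ cfun.span]) auto

lemma finite_expos: "finite (expos d :: ('k::finite \<Rightarrow> nat) set)"
proof (rule finite_subset)
  show "expos d \<subseteq> (UNIV :: 'k set) \<rightarrow>\<^sub>E {..d}"
    by (auto simp: expos_def PiE_def extensional_def member_le_sum)
qed (auto intro: finite_PiE)

lemma mon_add: "mon (\<lambda>i. \<alpha> i + \<beta> i) y = mon \<alpha> y * mon \<beta> y"
  by (simp add: mon_def power_add prod.distrib)

lemma mon_zero [simp]: "mon (\<lambda>_. 0) y = 1"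
  by (simp add: mon_def)

lemma mon_single: "mon (\<lambda>i. if i = j then d else 0) y = y j ^ d"
proof -
  have "mon (\<lambda>i. if i = j then d else 0) y = (\<Prod>i\<in>UNIV. if i = j then y i ^ d else 1)"
    unfolding mon_def by (rule prod.cong) auto
  then show ?thesis by simp
qed

lemma mon_scale: "mon \<alpha> (\<lambda>i. c * y i) = c ^ (\<Sum>i\<in>UNIV. \<alpha> i) * mon \<alpha> y"
  by (simp add: mon_def power_mult_distrib prod.distrib power_sum)

lemma mon_vec_scale: "mon \<alpha> (($) (c *s v)) = c ^ (\<Sum>i\<in>UNIV. \<alpha> i) * mon \<alpha> (($) v)"
  using mon_scale[of \<alpha> c "($) v"] by (simp add: mon_def)

lemma mon_in_homf: "\<alpha> \<in> expos d \<Longrightarrow> (\<lambda>z. mon \<alpha> (($) z)) \<in> homf d"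
  unfolding homf_eq_span_mon by (rule cfun.span_base) auto

lemma homf_0 [simp]: "(\<lambda>z. 0) \<in> homf d"
  using cfun.span_zero unfolding homf_def zero_fun_def by blast

lemma homf_add: "f \<in> homf d \<Longrightarrow> g \<in> homf d \<Longrightarrow> (\<lambda>z. f z + g z) \<in> homf d"
  using cfun.span_add unfolding homf_def plus_fun_def by blast

lemma homf_cmult: "f \<in> homf d \<Longrightarrow> (\<lambda>z. c * f z) \<in> homf d"
  using cfun.span_scale unfolding homf_def by blast

lemma homf_diff: "f \<in> homf d \<Longrightarrow> g \<in> homf d \<Longrightarrow> (\<lambda>z. f z - g z) \<in> homf d"
  using homf_add[OF _ homf_cmult[of g d "-1"], of f] by simp

lemma homf_uminus: "f \<in> homf d \<Longrightarrow> (\<lambda>z. - f z) \<in> homf d"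
  using homf_cmult[of f d "-1"] by simp

lemma homf_sum: "(\<And>a. a \<in> A \<Longrightarrow> f a \<in> homf d) \<Longrightarrow> (\<lambda>z. \<Sum>a\<in>A. f a z) \<in> homf d"
  by (induction A rule: infinite_finite_induct) (auto intro: homf_add)

lemma homf_induct [consumes 1, case_names zero add]:
  assumes "f \<in> homf d" "P (\<lambda>z. 0)"
    and "\<And>c \<alpha> g. \<alpha> \<in> expos d \<Longrightarrow> g \<in> homf d \<Longrightarrow> P g \<Longrightarrow> P (\<lambda>z. c * mon \<alpha> (($) z) + g z)"
  shows "P f"
proof -
  have "f \<in> homf d \<and> P f"
    using assms(1)[unfolded homf_eq_span_mon]
  proof (induction rule: cfun.span_induct_alt)
    case base
    then show ?case using assms(2) by (simp add: zero_fun_def)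
  next
    case (step c b y)
    then obtain \<alpha> where \<alpha>: "\<alpha> \<in> expos d" "b = (\<lambda>z. mon \<alpha> (($) z))" by auto
    have "(\<lambda>z. c * b z) + y = (\<lambda>z. c * mon \<alpha> (($) z) + y z)"
      by (auto simp: \<alpha>)
    then show ?case using assms(3)[of \<alpha> y c] \<alpha> step
      by (auto intro!: homf_add homf_cmult mon_in_homf)
  qed
  then show ?thesis ..
qed

lemma homf_coeffs:
  assumes "f \<in> homf d"
  obtains a where "\<And>z. f z = (\<Sum>\<alpha>\<in>expos d. a \<alpha> * mon \<alpha> (($) z))"
proof -
  have "\<exists>a. \<forall>z. f z = (\<Sum>\<alpha>\<in>expos d. a \<alpha> * mon \<alpha> (($) z))"
    using assms
  proof (induction rule: homf_induct)
    case zero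
    show ?case by (rule exI[of _ "\<lambda>_. 0"]) simp
  next
    case (add c \<alpha> g)
    then obtain a where a: "\<And>z. g z = (\<Sum>\<alpha>\<in>expos d. a \<alpha> * mon \<alpha> (($) z))" by blast
    have "c * mon \<alpha> (($) z) + g z = (\<Sum>\<beta>\<in>expos d. (a \<beta> + (if \<beta> = \<alpha> then c else 0)) * mon \<beta> (($) z))" for z
      using add(1) by (simp add: a distrib_right sum.distrib if_distrib[of "\<lambda>x. x * _"] finite_expos cong: if_cong)
    then show ?case by (intro exI[of _ "\<lambda>\<beta>. a \<beta> + (if \<beta> = \<alpha> then c else 0)"]) auto
  qed
  then show ?thesis using that by blast
qed

lemma homf_mult:
  assumes "f \<in> homf d" "g \<in> homf d'"
  shows "(\<lambda>z. f z * g z) \<in> homf (d + d')"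
proof -
  have 1: "(\<lambda>z. mon \<alpha> (($) z) * g z) \<in> homf (d + d')" if "\<alpha> \<in> expos d" for \<alpha>
    using assms(2)
  proof (induction rule: homf_induct)
    case (add c \<beta> g)
    have "(\<lambda>i. \<alpha> i + \<beta> i) \<in> expos (d + d')"
      using add(1) that by (simp add: expos_def sum.distrib)
    note m = mon_in_homf[OF this]
    have "(\<lambda>z. mon \<alpha> (($) z) * (c * mon \<beta> (($) z) + g z)) =
      (\<lambda>z. c * mon (\<lambda>i. \<alpha> i + \<beta> i) (($) z) + mon \<alpha> (($) z) * g z)"
      by (simp add: mon_add algebra_simps)
    then show ?case using m add by (simp only:) (intro homf_add homf_cmult)
  qed simp
  show ?thesis
    using assms(1)
  proof (induction rule: homf_induct)
    case (add c \<alpha> h)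
    have "(\<lambda>z. (c * mon \<alpha> (($) z) + h z) * g z) = (\<lambda>z. c * (mon \<alpha> (($) z) * g z) + h z * g z)"
      by (simp add: algebra_simps)
    then show ?case using add 1 by (simp only:) (intro homf_add homf_cmult)
  qed simp
qed

lemma homf_const: "(\<lambda>z. c) \<in> homf 0"
  using homf_cmult[OF mon_in_homf[of "\<lambda>_. 0" 0], of c] by (simp add: expos_def)

lemma homf_coord_power: "(\<lambda>z. z $ j ^ d) \<in> homf d"
  using mon_in_homf[of "\<lambda>i. if i = j then d else 0" d] by (simp add: mon_single expos_def)

lemma homf_coord: "(\<lambda>z. z $ j) \<in> homf 1"
  using homf_coord_power[of j 1] by simp

lemma homf_power: "f \<in> homf d \<Longrightarrow> (\<lambda>z. f z ^ k) \<in> homf (k * d)"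
  by (induction k) (auto intro: homf_const dest: homf_mult)

lemma homf_prod: "(\<And>a. a \<in> A \<Longrightarrow> f a \<in> homf (d a)) \<Longrightarrow> (\<lambda>z. \<Prod>a\<in>A. f a z) \<in> homf (sum d A)"
  by (induction A rule: infinite_finite_induct) (auto intro: homf_const homf_mult)

lemma homf_subst:
  fixes g :: "complex ^ 'a::finite \<Rightarrow> complex ^ 'b::finite"
  assumes "f \<in> homf d" "\<And>j. (\<lambda>z. g z $ j) \<in> homf 1"
  shows "(\<lambda>z. f (g z)) \<in> homf d"
  using assms(1)
proof (induction rule: homf_induct)
  case (add c \<alpha> h)
  have "(\<lambda>z. mon \<alpha> (($) (g z))) \<in> homf (\<Sum>j\<in>UNIV. \<alpha> j * 1)"
    unfolding mon_def by (intro homf_prod homf_power assms)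
  then show ?case using add by (intro homf_add homf_cmult) (auto simp: expos_def)
qed simp

lemma homf_homogeneous: "f \<in> homf d \<Longrightarrow> f (c *s v) = c ^ d * f v"
  by (induction rule: homf_induct)
     (auto simp: mon_vec_scale expos_def algebra_simps)

lemma homf_line:
  assumes "f \<in> homf d"
  shows "\<exists>p. degree p \<le> d \<and> (\<forall>t. f (a + t *s b) = poly p t)"
  using assms
proof (induction rule: homf_induct)
  case zero
  show ?case by (rule exI[of _ 0]) simp
next
  case (add c \<alpha> g)
  then obtain p where p: "degree p \<le> d" "\<And>t. g (a + t *s b) = poly p t" by blast
  let ?m = "\<Prod>j\<in>UNIV. [:a $ j, b $ j:] ^ \<alpha> j"
  have "degree ?m \<le> (\<Sum>j\<in>UNIV. degree ([:a $ j, b $ j:] ^ \<alpha> j))"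
    by (rule degree_prod_sum_le[unfolded o_def]) simp
  also have "\<dots> \<le> (\<Sum>j\<in>UNIV. \<alpha> j)"
    by (intro sum_mono order_trans[OF degree_power_le]) auto
  also have "\<dots> = d" using add(1) by (simp add: expos_def)
  finally have "degree ?m \<le> d" .
  moreover have "mon \<alpha> (($) (a + t *s b)) = poly ?m t" for t
    by (simp add: mon_def poly_prod)
  ultimately show ?case using p
    by (intro exI[of _ "smult c ?m + p"]) (auto intro: degree_add_le order_trans[OF degree_smult_le])
qed

lemma homf_continuous: "f \<in> homf d \<Longrightarrow> continuous_on S f"
  by (induction rule: homf_induct) (auto simp: mon_def intro!: continuous_intros)

lemma homf_holomorphic_line: "f \<in> homf d \<Longrightarrow> (\<lambda>s. f (a + s *s b)) holomorphic_on S"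
  using homf_line[of f d a b] by (auto intro!: holomorphic_intros)

section \<open>Homogeneous functions holomorphic outside the origin\<close>

text \<open>Encodes a polynomial function by its restrictions to the lines through the origin, the
  coefficient of t^d being its homogeneous part of degree \<open>d\<close>. Sums and products are
  then sums and products of polynomials in t.\<close>

definition polyf :: "(complex ^ 'k::finite \<Rightarrow> complex) \<Rightarrow> bool" where
  "polyf f \<longleftrightarrow> (\<exists>p. (\<forall>v t. f (t *s v) = poly (p v) t) \<and> (\<forall>d. (\<lambda>v. coeff (p v) d) \<in> homf d))"

lemma homf_imp_polyf:
  assumes "f \<in> homf d" shows "polyf f"
  unfolding polyf_def
proof (intro exI[of _ "\<lambda>v. monom (f v) d"] conjI allI)
  show "f (t *s v) = poly (monom (f v) d) t" for v t
    by (simp add: homf_homogeneous[OF assms] poly_monom)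
  show "(\<lambda>v. coeff (monom (f v) d) e) \<in> homf e" for e
    using assms by (cases "d = e") auto
qed

lemma polyf_const: "polyf (\<lambda>v. c)"
  by (rule homf_imp_polyf[OF homf_const])

lemma polyf_add:
  assumes "polyf f" "polyf g" shows "polyf (\<lambda>v. f v + g v)"
proof -
  from assms obtain p p' where
    "\<forall>v t. f (t *s v) = poly (p v) t" "\<forall>d. (\<lambda>v. coeff (p v) d) \<in> homf d"
    "\<forall>v t. g (t *s v) = poly (p' v) t" "\<forall>d. (\<lambda>v. coeff (p' v) d) \<in> homf d"
    unfolding polyf_def by blast
  then show ?thesis unfolding polyf_def
    by (intro exI[of _ "\<lambda>v. p v + p' v"]) (auto intro: homf_add)
qed

lemma polyf_mult:
  assumes "polyf f" "polyf g" shows "polyf (\<lambda>v. f v * g v)"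
proof -
  from assms obtain p p' where
    p: "\<forall>v t. f (t *s v) = poly (p v) t" "\<forall>d. (\<lambda>v. coeff (p v) d) \<in> homf d"
    "\<forall>v t. g (t *s v) = poly (p' v) t" "\<forall>d. (\<lambda>v. coeff (p' v) d) \<in> homf d"
    unfolding polyf_def by blast
  have "(\<lambda>v. coeff (p v * p' v) d) \<in> homf d" for d
  proof -
    have "(\<lambda>v. coeff (p v) i * coeff (p' v) (d - i)) \<in> homf d" if "i \<le> d" for i
      using homf_mult[OF p(2)[rule_format, of i] p(4)[rule_format, of "d - i"]] that by simp
    then show ?thesis unfolding coeff_mult by (intro homf_sum) auto
  qed
  then show ?thesis using p unfolding polyf_def
    by (intro exI[of _ "\<lambda>v. p v * p' v"]) auto
qed

lemma polyf_sum: "(\<And>a. a \<in> A \<Longrightarrow> polyf (f a)) \<Longrightarrow> polyf (\<lambda>z. \<Sum>a\<in>A. f a z)"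
  by (induction A rule: infinite_finite_induct) (auto intro: polyf_add polyf_const)

lemma polyf_poly: "polyf (\<lambda>v. poly p (v $ j))"
proof (induction p)
  case (pCons a p)
  then show ?case
    using polyf_add[OF polyf_const polyf_mult[OF homf_imp_polyf[OF homf_coord]], of _ a j] by simp
qed (simp add: polyf_const)

text \<open>Homogeneity forces the polynomial on the line through \<open>v\<close> to be the single
  monomial f(v) t^d, so \<open>f\<close> is its own part of degree \<open>d\<close>.\<close>

lemma polyf_homogeneous_imp_homf:
  assumes "polyf f" "\<And>c v. f (c *s v) = c ^ d * f v"
  shows "f \<in> homf d"
proof -
  from assms(1) obtain p where p: "\<forall>v t. f (t *s v) = poly (p v) t" "\<forall>d. (\<lambda>v. coeff (p v) d) \<in> homf d"
    unfolding polyf_def by blast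
  have "p v = monom (f v) d" for v
  proof -
    have "poly (p v) = poly (monom (f v) d)"
      using p(1) assms(2) by (auto simp: poly_monom mult.commute)
    then show ?thesis by (simp add: poly_eq_poly_eq_iff)
  qed
  then show ?thesis using p(2)[rule_format, of d] by simp
qed

section \<open>Functions that are polynomial of bounded degree in each variable\<close>

lemma lagrange_interpolation:
  fixes d :: nat
  obtains l :: "nat \<Rightarrow> complex poly"
  where "\<And>p s. degree p \<le> d \<Longrightarrow> poly p s = (\<Sum>k\<le>d. poly p (of_nat k) * poly (l k) s)"
proof -
  define l where "l k = (\<Prod>i\<in>{..d}-{k}. smult (1 / (of_nat k - of_nat i)) [:- of_nat i, 1 :: complex:])" for k
  have deg: "degree (l k) \<le> d" if "k \<le> d" for k
  proof -
    have "degree (l k) \<le> (\<Sum>i\<in>{..d}-{k}. degree (smult (1 / (of_nat k - of_nat i)) [:- of_nat i, 1 :: complex:]))"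
      unfolding l_def by (rule degree_prod_sum_le[unfolded o_def]) simp
    also have "\<dots> \<le> (\<Sum>i\<in>{..d}-{k}. 1)" by (intro sum_mono) simp
    finally show ?thesis using that by simp
  qed
  have val: "poly (l k) (of_nat j) = (if j = k then 1 else 0)" if "k \<le> d" "j \<le> d" for j k
  proof (cases "j = k")
    case True
    have "poly (smult (1 / (of_nat k - of_nat i)) [:- of_nat i, 1 :: complex:]) (of_nat k) = 1"
      if "i \<noteq> k" for i
    proof -
      have "of_nat k - of_nat i \<noteq> (0 :: complex)" using that by simp
      then show ?thesis by (simp add: diff_divide_distrib[symmetric])
    qed
    then have "poly (l k) (of_nat k) = 1"
      unfolding l_def poly_prod by (intro prod.neutral) auto
    then show ?thesis by (simp add: True)
  next
    case False
    then show ?thesis unfolding l_def poly_prod using that by auto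
  qed
  have "poly p s = (\<Sum>k\<le>d. poly p (of_nat k) * poly (l k) s)" if "degree p \<le> d" for p s
  proof -
    define r where "r = p - (\<Sum>k\<le>d. smult (poly p (of_nat k)) (l k))"
    have "degree r \<le> d" unfolding r_def
      by (intro degree_diff_le degree_sum_le that order_trans[OF degree_smult_le deg]) auto
    moreover have "poly r (of_nat j) = 0" if "j \<le> d" for j
      using that by (simp add: r_def poly_sum val if_distrib[of "\<lambda>x. _ * x"] cong: if_cong)
    then have "of_nat ` {..d} \<subseteq> {x. poly r x = 0}" by auto
    moreover have "card (of_nat ` {..d} :: complex set) = Suc d"
      by (subst card_image) auto
    ultimately have "r = 0"
      by (metis card_poly_roots_bound card_mono leD lessI order_le_less_trans poly_roots_finite)
    then have "poly r s = 0" by simp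
    then show ?thesis by (simp add: r_def poly_sum)
  qed
  then show ?thesis using that by blast
qed

text \<open>The degree bound is uniform in the other variables, so interpolation at 0, ..., d in one
  coordinate writes \<open>f\<close> as a combination of functions not involving that coordinate,
  with fixed polynomials as coefficients. Iterating eliminates all coordinates.\<close>

lemma polyf_if_coordinatewise_poly:
  fixes f :: "complex ^ 'k::finite \<Rightarrow> complex"
  assumes "\<And>v j. \<exists>p. degree p \<le> d \<and> (\<forall>s. f (\<chi> i. if i = j then s else v $ i) = poly p s)"
  shows "polyf f"
proof -
  obtain l :: "nat \<Rightarrow> complex poly" where
    l: "\<And>p s. degree p \<le> d \<Longrightarrow> poly p s = (\<Sum>k\<le>d. poly p (of_nat k) * poly (l k) s)"
    by (rule lagrange_interpolation[of d]) blast
  \<comment> \<open>Generalized to functions depending only on the coordinates in \<open>S\<close>,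
    so that freezing a coordinate removes it from \<open>S\<close>.\<close>
  have *: "polyf g" if "finite S"
    "\<And>v j. \<exists>p. degree p \<le> d \<and> (\<forall>s. g (\<chi> i. if i = j then s else v $ i) = poly p s)"
    "\<And>v w. (\<forall>i\<in>S. v $ i = w $ i) \<Longrightarrow> g v = g w" for S and g :: "complex ^ 'k \<Rightarrow> complex"
    using that
  proof (induction S arbitrary: g)
    case empty
    have "(\<lambda>v. g 0) = g" by (intro ext, rule empty.prems(2)) simp
    then show ?case using polyf_const[of "g 0"] by metis
  next
    case (insert x S)
    let ?u = "\<lambda>s v. (\<chi> i. if i = x then s else v $ i) :: complex ^ 'k"
    have g_eq: "g v = (\<Sum>k\<le>d. g (?u (of_nat k) v) * poly (l k) (v $ x))" for v
    proof -
      obtain p where p: "degree p \<le> d" "\<And>s. g (?u s v) = poly p s" using insert.prems(1) by blast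
      have "g v = g (?u (v $ x) v)" by (rule arg_cong[of _ _ g]) (simp add: vec_eq_iff)
      then show ?thesis using l[OF p(1), of "v $ x"] by (simp add: p(2))
    qed
    have "polyf (\<lambda>v. g (?u c v))" for c
    proof (rule insert.IH)
      fix v :: "complex ^ 'k" and j
      show "\<exists>p. degree p \<le> d \<and> (\<forall>s. g (?u c (\<chi> i. if i = j then s else v $ i)) = poly p s)"
      proof (cases "j = x")
        case True
        then have "?u c (\<chi> i. if i = j then s else v $ i) = ?u c v" for s by (simp add: vec_eq_iff)
        then show ?thesis by (intro exI[of _ "[:g (?u c v):]"]) simp
      next
        case False
        then have "?u c (\<chi> i. if i = j then s else v $ i) = (\<chi> i. if i = j then s else ?u c v $ i)" for s
          by (auto simp: vec_eq_iff)
        then show ?thesis using insert.prems(1)[of j "?u c v"] by simp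
      qed
    next
      fix v w :: "complex ^ 'k"
      assume "\<forall>i\<in>S. v $ i = w $ i"
      then show "g (?u c v) = g (?u c w)" by (intro insert.prems(2)) auto
    qed
    then have "polyf (\<lambda>v. \<Sum>k\<le>d. g (?u (of_nat k) v) * poly (l k) (v $ x))"
      by (intro polyf_sum polyf_mult polyf_poly)
    moreover have "(\<lambda>v. \<Sum>k\<le>d. g (?u (of_nat k) v) * poly (l k) (v $ x)) = g"
      by (intro ext g_eq[symmetric])
    ultimately show ?case by (rule back_subst)
  qed
  have eq: "f v = f w" if "\<forall>i\<in>UNIV. v $ i = w $ i" for v w :: "complex ^ 'k"
  proof -
    have "v = w" using that by (simp add: vec_eq_iff)
    then show ?thesis by (rule arg_cong)
  qed
  show ?thesis
    by (rule *[of UNIV f, OF finite assms eq]) assumption+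
qed

lemma norm_vec_smult: "norm (c *s (v :: complex ^ 'k::finite)) = norm c * norm v"
proof -
  have "norm (c *s v) = L2_set (\<lambda>i. norm c * norm (v $ i)) UNIV"
    by (simp add: norm_vec_def norm_mult)
  also have "\<dots> = norm c * norm v"
    unfolding norm_vec_def by (rule L2_set_right_distrib[symmetric]) simp
  finally show ?thesis .
qed

text \<open>Homogeneity controls the growth along each affine line, so that Liouville's theorem applies.\<close>

lemma homf_if_holomorphic_along_lines:
  fixes f :: "complex ^ 'k::finite \<Rightarrow> complex"
  assumes hom: "\<And>c v. f (c *s v) = c ^ d * f v"
    and cont: "continuous_on (-{0}) f"
    and hol: "\<And>a b. (\<lambda>s. f (a + s *s b)) holomorphic_on {s. a + s *s b \<noteq> 0}"
  shows "f \<in> homf d"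
proof -
  have line: "\<exists>p. degree p \<le> d \<and> (\<forall>s. f (a + s *s b) = poly p s)" for a b
  \<comment> \<open>Lines that degenerate or pass through the origin are settled by homogeneity
    alone, because holomorphy is unknown at the origin. On every other line the restriction is
    entire.\<close>
  proof (cases "b = 0 \<or> (\<exists>c. a = c *s b)")
    case True
    then show ?thesis
    proof
      assume "b = 0"
      then show ?thesis by (intro exI[of _ "[:f a:]"]) simp
    next
      assume "\<exists>c. a = c *s b"
      then obtain c where c: "a = c *s b" by blast
      have "f (a + s *s b) = (c + s) ^ d * f b" for s
        using hom[of "c + s" b] by (simp add: c vec.scale_left_distrib)
      moreover have "degree (smult (f b) ([:c, 1:] ^ d)) \<le> d"
        by (rule order_trans[OF degree_smult_le order_trans[OF degree_power_le]]) simp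
      ultimately show ?thesis by (intro exI[of _ "smult (f b) ([:c, 1:] ^ d)"]) simp
    qed
  next
    case False
    have nz: "a + s *s b \<noteq> 0" for s
    proof
      assume "a + s *s b = 0"
      then have "a = (-s) *s b" by (simp add: eq_neg_iff_add_eq_0)
      then show False using False by blast
    qed
    have ent: "(\<lambda>s. f (a + s *s b)) holomorphic_on UNIV"
      using hol[of a b] nz by simp
    have "isCont f b" using cont False by (simp add: continuous_on_eq_continuous_at open_Compl)
    then obtain \<delta> where \<delta>: "\<delta> > 0" "\<And>w. norm (w - b) < \<delta> \<Longrightarrow> norm (f w - f b) < 1"
      unfolding continuous_at_eps_delta dist_norm using zero_less_one by blast
    \<comment> \<open>From this radius on, a / s has norm below \<delta>, so f(a + s b) = s^d f(a /
      s + b) is controlled by the values of \<open>f\<close> near \<open>b\<close>. The summand 1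
      ensures s \<noteq> 0.\<close>
    define A where "A = norm a / \<delta> + 1"
    have "norm (f (a + s *s b)) \<le> (norm (f b) + 1) * norm s ^ d" if "A \<le> norm s" for s
    proof -
      have A: "A \<ge> 1" using \<delta>(1) by (simp add: A_def)
      then have s: "s \<noteq> 0" using that by auto
      have "norm a < \<delta> * norm s"
        using that \<delta>(1) by (simp add: A_def field_simps)
      then have "norm ((1 / s) *s a) < \<delta>"
        using s by (simp add: norm_vec_smult norm_divide field_simps)
      then have "norm (f ((1 / s) *s a + b) - f b) < 1"
        using \<delta>(2)[of "(1 / s) *s a + b"] by simp
      then have "norm (f ((1 / s) *s a + b)) \<le> norm (f b) + 1"
        using norm_triangle_ineq2[of "f ((1 / s) *s a + b)" "f b"] by linarith
      moreover have "a + s *s b = s *s ((1 / s) *s a + b)"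
        using s by (auto simp: vec_eq_iff field_simps)
      then have "norm (f (a + s *s b)) = norm s ^ d * norm (f ((1 / s) *s a + b))"
        by (metis hom norm_mult norm_power)
      ultimately show ?thesis
        by (simp add: mult_left_mono mult.commute)
    qed
    from Liouville_polynomial[OF ent this] have
      eq: "f (a + s *s b) = (\<Sum>k\<le>d. (deriv ^^ k) (\<lambda>s. f (a + s *s b)) 0 / fact k * s ^ k)" for s
      by blast
    let ?p = "\<Sum>k\<le>d. monom ((deriv ^^ k) (\<lambda>s. f (a + s *s b)) 0 / fact k) k"
    have "degree ?p \<le> d"
      by (intro degree_sum_le) (auto intro: order_trans[OF degree_monom_le])
    moreover have "f (a + s *s b) = poly ?p s" for s
      by (subst eq) (simp add: poly_sum poly_monom)
    ultimately show ?thesis by blast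
  qed
  have "polyf f"
  proof (rule polyf_if_coordinatewise_poly)
    fix v :: "complex ^ 'k" and j
    let ?a = "\<chi> i. if i = j then 0 else v $ i"
    obtain p where p: "degree p \<le> d" "\<And>s. f (?a + s *s axis j 1) = poly p s"
      using line[of ?a "axis j 1"] by blast
    have "f (\<chi> i. if i = j then s else v $ i) = poly p s" for s
      unfolding p(2)[symmetric] by (rule arg_cong[of _ _ f]) (simp add: vec_eq_iff axis_def)
    then show "\<exists>p. degree p \<le> d \<and> (\<forall>s. f (\<chi> i. if i = j then s else v $ i) = poly p s)"
      using p(1) by blast
  qed
  then show ?thesis using hom by (rule polyf_homogeneous_imp_homf)
qed

text \<open>Where v_k \<noteq> 0 the function is a form divided by v_k^q, hence continuous and
  holomorphic on lines; these open sets cover everything but the origin. The value at 0 and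
  \<open>d \<ge> 1\<close> settle homogeneity for the scalar 0.\<close>

lemma homf_if_coord_power_mult:
  fixes f :: "complex ^ 'k::finite \<Rightarrow> complex"
  assumes "\<And>k. (\<lambda>v. v $ k ^ q * f v) \<in> homf (d + q)" and "f 0 = 0" "d \<ge> 1"
  shows "f \<in> homf d"
proof (rule homf_if_holomorphic_along_lines)
  have eq: "f v = (v $ k ^ q * f v) / v $ k ^ q" if "v $ k \<noteq> 0" for v :: "complex ^ 'k" and k
    using that by simp
  show "f (c *s v) = c ^ d * f v" for c v
  proof (cases "c = 0 \<or> v = 0")
    case True
    then show ?thesis using assms(2,3) by auto
  next
    case False
    then obtain k where k: "v $ k \<noteq> 0" by (auto simp: vec_eq_iff)
    have "(c *s v) $ k ^ q * f (c *s v) = c ^ (d + q) * (v $ k ^ q * f v)"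
      using homf_homogeneous[OF assms(1)[of k], of c v] .
    then show ?thesis using k False by (simp add: power_mult_distrib power_add)
  qed
  show "continuous_on (-{0}) f"
  proof (rule continuous_at_imp_continuous_on, rule ballI)
    fix v :: "complex ^ 'k" assume "v \<in> -{0}"
    then obtain k where k: "v $ k \<noteq> 0" by (auto simp: vec_eq_iff)
    have op: "open {v :: complex ^ 'k. v $ k \<noteq> 0}"
      by (intro open_Collect_neq continuous_intros)
    have "continuous_on {v. v $ k \<noteq> 0} (\<lambda>v. v $ k ^ q * f v / v $ k ^ q)"
      by (rule continuous_on_divide[OF homf_continuous[OF assms(1)]])
         (auto intro!: continuous_intros)
    then have "continuous_on {v. v $ k \<noteq> 0} f"
      by (rule continuous_on_eq) auto
    then show "isCont f v" using op k by (simp add: continuous_on_eq_continuous_at)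
  qed
  show "(\<lambda>s. f (a + s *s b)) holomorphic_on {s. a + s *s b \<noteq> 0}" for a b
  proof -
    have "\<exists>S. open S \<and> s \<in> S \<and> (\<lambda>s. f (a + s *s b)) holomorphic_on S" if nz: "a + s *s b \<noteq> 0" for s
    proof -
      obtain k where k: "(a + s *s b) $ k \<noteq> 0" using nz by (metis vec_eq_iff zero_index)
      let ?S = "{s. (a + s *s b) $ k \<noteq> 0}"
      have "open ?S" by (auto intro!: open_Collect_neq continuous_intros)
      have "(\<lambda>s. ((a + s *s b) $ k ^ q * f (a + s *s b)) / (a + s *s b) $ k ^ q) holomorphic_on ?S"
        by (rule holomorphic_on_divide[OF homf_holomorphic_line[OF assms(1)]])
           (auto intro!: holomorphic_intros)
      then have "(\<lambda>s. f (a + s *s b)) holomorphic_on ?S"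
        by (rule holomorphic_transform) auto
      with \<open>open ?S\<close> show ?thesis using k by blast
    qed
    then have "(\<lambda>s. f (a + s *s b)) analytic_on {s}" if "a + s *s b \<noteq> 0" for s
      using that unfolding analytic_at by simp
    then have "(\<lambda>s. f (a + s *s b)) analytic_on {s. a + s *s b \<noteq> 0}"
      by (intro iffD2[OF analytic_on_analytic_at]) simp
    then show ?thesis by (rule analytic_imp_holomorphic)
  qed
qed

section \<open>Taylor expansions in several variables\<close>

text \<open>Holomorphy in several variables is replaced by continuity together with holomorphy on
  complex lines. Both properties survive uniform limits and suffice for the expansion into
  homogeneous parts.\<close>

definition line_holomorphic :: "real \<Rightarrow> (complex ^ 'k::finite \<Rightarrow> complex) \<Rightarrow> bool" where
  "line_holomorphic r f \<longleftrightarrow> continuous_on (ball 0 r) f \<and>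
     (\<forall>a b. (\<lambda>s. f (a + s *s b)) holomorphic_on {s. a + s *s b \<in> ball 0 r})"

lemma line_holomorphic_add:
  "line_holomorphic r f \<Longrightarrow> line_holomorphic r g \<Longrightarrow> line_holomorphic r (\<lambda>x. f x + g x)"
  by (auto simp: line_holomorphic_def intro!: continuous_intros holomorphic_intros)

lemma line_holomorphic_diff:
  "line_holomorphic r f \<Longrightarrow> line_holomorphic r g \<Longrightarrow> line_holomorphic r (\<lambda>x. f x - g x)"
  by (auto simp: line_holomorphic_def intro!: continuous_intros holomorphic_intros)

lemma line_holomorphic_mult:
  "line_holomorphic r f \<Longrightarrow> line_holomorphic r g \<Longrightarrow> line_holomorphic r (\<lambda>x. f x * g x)"
  by (auto simp: line_holomorphic_def intro!: continuous_intros holomorphic_intros)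

lemma line_holomorphic_const: "line_holomorphic r (\<lambda>x. c)"
  by (auto simp: line_holomorphic_def)

lemma line_holomorphic_sum:
  "(\<And>a. a \<in> A \<Longrightarrow> line_holomorphic r (f a)) \<Longrightarrow> line_holomorphic r (\<lambda>x. \<Sum>a\<in>A. f a x)"
  by (induction A rule: infinite_finite_induct) (auto intro: line_holomorphic_add line_holomorphic_const)

lemma line_holomorphic_power: "line_holomorphic r f \<Longrightarrow> line_holomorphic r (\<lambda>x. f x ^ n)"
  by (induction n) (auto intro: line_holomorphic_mult line_holomorphic_const)

lemma line_holomorphic_prod:
  "(\<And>a. a \<in> A \<Longrightarrow> line_holomorphic r (f a)) \<Longrightarrow> line_holomorphic r (\<lambda>x. \<Prod>a\<in>A. f a x)"
  by (induction A rule: infinite_finite_induct) (auto intro: line_holomorphic_mult line_holomorphic_const)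

lemma continuous_on_smult [continuous_intros]:
  fixes g :: "'a::topological_space \<Rightarrow> complex ^ 'k::finite"
  shows "continuous_on S f \<Longrightarrow> continuous_on S g \<Longrightarrow> continuous_on S (\<lambda>x. f x *s g x)"
  unfolding vector_scalar_mult_def by (intro continuous_intros)

lemma open_line_ball: "open {s. a + s *s b \<in> ball (0 :: complex ^ 'k::finite) r}"
  unfolding mem_ball dist_0_norm
  by (intro open_Collect_less continuous_intros)

text \<open>The radius is doubled so that for \<open>u\<close> in the closed ball of radius
  \<open>r\<close> the function t \<mapsto> f(t u) is holomorphic for |t| < 2. This leaves room for
  Cauchy estimates on the unit circle.\<close>

locale taylor_setup =
  fixes f :: "complex ^ 'k::finite \<Rightarrow> complex" and r :: real
  assumes r: "r > 0" and f: "line_holomorphic (2 * r) f"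
begin

definition F :: "nat \<Rightarrow> complex ^ 'k \<Rightarrow> complex" where
  "F k u = (deriv ^^ k) (\<lambda>t. f (t *s u)) 0 / fact k"

lemma holomorphic_on_line_through_0: "(\<lambda>t. f (t *s u)) holomorphic_on {t. t *s u \<in> ball 0 (2 * r)}"
  using f unfolding line_holomorphic_def by (metis (no_types, lifting) Collect_cong add_0 holomorphic_cong)

lemma F_homogeneous: "F k (c *s u) = c ^ k * F k u"
proof -
  have "(deriv ^^ k) (\<lambda>t. (\<lambda>t. f (t *s u)) (c * t)) 0 = c ^ k * (deriv ^^ k) (\<lambda>t. f (t *s u)) (c * 0)"
    using holomorphic_on_line_through_0[of u] open_line_ball[of 0 "c *s u" "2 * r"] open_line_ball[of 0 u "2 * r"] r
    by (intro higher_deriv_compose_linear[where S = "{t. t *s (c *s u) \<in> ball 0 (2 * r)}" and T = "{t. t *s u \<in> ball 0 (2 * r)}"])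
       (auto simp: mult.commute)
  then show ?thesis by (simp add: F_def mult.commute)
qed

lemma smult_in_double_ball: "norm (u :: complex ^ 'k) \<le> r \<Longrightarrow> norm t < 2 \<Longrightarrow> t *s u \<in> ball 0 (2 * r)"
proof -
  assume a: "norm u \<le> r" "norm t < 2"
  have "norm t * norm u \<le> norm t * r" using a by (intro mult_left_mono) auto
  also have "\<dots> < 2 * r" using a r by (intro mult_strict_right_mono) auto
  finally show ?thesis by (simp add: norm_vec_smult)
qed

lemma F_sums:
  assumes "norm u \<le> r" "norm t < 2"
  shows "(\<lambda>k. F k u * t ^ k) sums f (t *s u)"
proof -
  have "(\<lambda>t. f (t *s u)) holomorphic_on ball 0 2"
    by (rule holomorphic_on_subset[OF holomorphic_on_line_through_0]) (use smult_in_double_ball[OF assms(1)] in auto)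
  from holomorphic_power_series[OF this, of t] assms(2) show ?thesis
    by (simp add: F_def)
qed

definition M where "M = (SOME M. M > 0 \<and> (\<forall>u. norm u \<le> r \<longrightarrow> norm (f u) \<le> M))"

lemma M: "M > 0" "norm u \<le> r \<Longrightarrow> norm (f u) \<le> M"
proof -
  have "continuous_on (cball 0 r) f"
    using f r unfolding line_holomorphic_def by (auto elim!: continuous_on_subset)
  then have "bounded (f ` cball 0 r)"
    by (intro compact_imp_bounded compact_continuous_image) auto
  then obtain B where "B > 0" "\<forall>u\<in>cball 0 r. norm (f u) \<le> B"
    unfolding bounded_pos by blast
  then have "\<exists>M>0. (\<forall>u. norm u \<le> r \<longrightarrow> norm (f u) \<le> M)" by auto
  from someI_ex[OF this] show "M > 0" "norm u \<le> r \<Longrightarrow> norm (f u) \<le> M"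
    unfolding M_def by blast+
qed

lemma F_bound:
  assumes "norm u \<le> r" shows "norm (F k u) \<le> M"
proof -
  have h: "(\<lambda>t. f (t *s u)) holomorphic_on ball 0 2"
    by (rule holomorphic_on_subset[OF holomorphic_on_line_through_0]) (use smult_in_double_ball[OF assms] in auto)
  have "cmod ((deriv ^^ k) (\<lambda>t. f (t *s u)) 0) \<le> fact k * M / 1 ^ k"
  proof (rule Cauchy_inequality)
    show "(\<lambda>t. f (t *s u)) holomorphic_on ball 0 1"
      by (rule holomorphic_on_subset[OF h]) auto
    show "continuous_on (cball 0 1) (\<lambda>t. f (t *s u))"
      by (rule holomorphic_on_imp_continuous_on[OF holomorphic_on_subset[OF h]]) auto
    fix x :: complex assume "norm (0 - x) = 1"
    then show "norm (f (x *s u)) \<le> M"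
      using assms by (intro M) (simp add: norm_vec_smult)
  qed simp
  then show ?thesis by (simp add: F_def norm_divide field_simps)
qed

text \<open>The Cauchy estimates bound every coefficient by \<open>M\<close>, so the tail is
  dominated by a geometric series of ratio |t| \<le> 1/2; the factor 2 bounds 1 / (1 - |t|).\<close>

lemma remainder:
  assumes "norm u \<le> r" "norm t \<le> 1 / 2"
  shows "norm (f (t *s u) - (\<Sum>k\<le>K. F k u * t ^ k)) \<le> 2 * M * norm t ^ Suc K"
proof -
  have "(\<lambda>k. F (k + Suc K) u * t ^ (k + Suc K)) sums (f (t *s u) - (\<Sum>k<Suc K. F k u * t ^ k))"
    using F_sums[OF assms(1), of t] assms(2) by (intro sums_split_initial_segment) auto
  moreover have "(\<lambda>k. M * norm t ^ Suc K * norm t ^ k) sums (M * norm t ^ Suc K * (1 / (1 - norm t)))"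
    using assms(2) by (intro sums_mult geometric_sums) auto
  moreover have "norm (F (k + Suc K) u * t ^ (k + Suc K)) \<le> M * norm t ^ Suc K * norm t ^ k" for k
  proof -
    have "norm (F (k + Suc K) u) * norm t ^ (k + Suc K) \<le> M * norm t ^ (k + Suc K)"
      using F_bound[OF assms(1)] by (intro mult_right_mono) auto
    then show ?thesis by (simp add: norm_mult norm_power power_add mult_ac)
  qed
  ultimately have "norm (f (t *s u) - (\<Sum>k<Suc K. F k u * t ^ k)) \<le> M * norm t ^ Suc K * (1 / (1 - norm t))"
    by (rule norm_sums_le)
  also have "\<dots> \<le> M * norm t ^ Suc K * 2"
    using assms(2) M(1) by (intro mult_left_mono) (auto simp: field_simps)
  finally show ?thesis by (simp add: lessThan_Suc_atMost mult_ac)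
qed

lemma taylor_remainder:
  assumes "norm w < r / 2"
  shows "norm (f w - (\<Sum>k\<le>K. F k w)) \<le> (2 * M / r ^ Suc K) * norm w ^ Suc K"
proof -
  \<comment> \<open>Putting the whole length of \<open>w\<close> into the scalar \<open>t\<close>
    turns powers of |t| into powers of |w| / r.\<close>
  obtain t u where tu: "norm t = norm w / r" "norm u \<le> r" "w = t *s u"
  proof (cases "w = 0")
    case True
    then show ?thesis using that[of 0 0] r by simp
  next
    case False
    let ?t = "complex_of_real (norm w / r)"
    have t0: "?t \<noteq> 0" using False r by simp
    have n: "norm ?t = norm w / r" using r by (simp add: norm_divide)
    show ?thesis
    proof (rule that[of ?t "(1 / ?t) *s w"])
      show "norm ?t = norm w / r" by (rule n)
      have "norm ((1 / ?t) *s w) = (1 / norm ?t) * norm w"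
        by (simp only: norm_vec_smult norm_divide norm_one)
      then show "norm ((1 / ?t) *s w) \<le> r" using False n by simp
      show "w = ?t *s ((1 / ?t) *s w)" using t0 by (simp only: vec.scale_scale) simp
    qed
  qed
  have "norm t \<le> 1 / 2" using assms r by (simp add: tu(1) field_simps)
  from remainder[OF tu(2) this, of K] have
    "norm (f w - (\<Sum>k\<le>K. F k w)) \<le> 2 * M * norm t ^ Suc K"
    by (simp add: tu(3)[symmetric] F_homogeneous[of _ t u, folded tu(3)] mult.commute)
  then show ?thesis by (simp add: tu(1) power_divide)
qed

text \<open>Nonzero parameters tending to 0, shifted by 2 so that all of them satisfy |t| \<le> 1/2
  as required by \<open>remainder\<close>.\<close>

definition node :: "nat \<Rightarrow> complex" where
  "node m = of_real (1 / (2 + real m))"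

lemma node: "node m \<noteq> 0" "norm (node m) = 1 / (2 + real m)" "norm (node m) \<le> 1 / 2" "norm (node m) < 2"
  by (auto simp: node_def norm_divide field_simps simp flip: of_real_add)

text \<open>\<open>F k\<close> is recovered from \<open>f\<close> by subtracting the lower terms and
  dividing by t^k; by \<open>remainder\<close> the error is of order |t|, uniformly. The
  substitution \<open>h\<close> serves both for points of a ball and for the parameter of a
  line.\<close>

lemma uniform_limit_quotients:
  assumes "\<And>x. x \<in> S \<Longrightarrow> norm (h x) \<le> r"
  shows "uniform_limit S
    (\<lambda>m x. (f (node m *s h x) - (\<Sum>j<k. F j (h x) * node m ^ j)) / node m ^ k)
    (\<lambda>x. F k (h x)) sequentially"
proof (rule uniform_limitI)
  fix e :: real assume "e > 0"
  have "(\<lambda>m. 2 * M * (1 / (2 + real m))) \<longlonglongrightarrow> 0"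
    using tendsto_mult_right_zero[OF LIMSEQ_ignore_initial_segment[OF lim_1_over_n, of 2], of "2 * M"]
    by (simp add: add.commute)
  then have "eventually (\<lambda>m. 2 * M * (1 / (2 + real m)) < e) sequentially"
    using \<open>e > 0\<close> by (rule order_tendstoD)
  then show "eventually (\<lambda>m. \<forall>x\<in>S. dist ((f (node m *s h x) - (\<Sum>j<k. F j (h x) * node m ^ j))
       / node m ^ k) (F k (h x)) < e) sequentially"
  proof eventually_elim
    case (elim m)
    define t where "t = node m"
    note t = node[of m, folded t_def]
    have "dist ((f (t *s h x) - (\<Sum>j<k. F j (h x) * t ^ j)) / t ^ k) (F k (h x)) < e" if "x \<in> S" for x
    proof -
      have "norm (f (t *s h x) - (\<Sum>j\<le>k. F j (h x) * t ^ j)) \<le> 2 * M * norm t ^ Suc k"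
        using remainder[OF assms[OF that] t(3)] by blast
      then have "norm (f (t *s h x) - (\<Sum>j\<le>k. F j (h x) * t ^ j)) / norm t ^ k \<le> 2 * M * norm t ^ Suc k / norm t ^ k"
        by (rule divide_right_mono) simp
      also have "\<dots> = 2 * M * norm t" using t(1) by simp
      also have "\<dots> < e" using elim t(2) by simp
      finally have "norm ((f (t *s h x) - (\<Sum>j\<le>k. F j (h x) * t ^ j)) / t ^ k) < e"
        by (simp only: norm_divide norm_power)
      moreover have "(f (t *s h x) - (\<Sum>j<k. F j (h x) * t ^ j)) / t ^ k - F k (h x) =
         (f (t *s h x) - (\<Sum>j\<le>k. F j (h x) * t ^ j)) / t ^ k"
        using t(1) by (simp add: lessThan_Suc_atMost[symmetric] field_simps)
      ultimately show ?thesis by (simp only: dist_norm)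
    qed
    then show ?case by (simp only: t_def) blast
  qed
qed

text \<open>By induction the lower parts are forms, so the quotients of
  \<open>uniform_limit_quotients\<close> are continuous and holomorphic on lines, and so is their
  uniform limit near 0. Homogeneity spreads this to the whole space, where homogeneous functions
  holomorphic off the origin are forms.\<close>

lemma F_homf: "F k \<in> homf k"
proof (induction k rule: less_induct)
  case (less k)
  have in2: "node m *s u \<in> ball 0 (2 * r)" if "norm u \<le> r" for m and u :: "complex ^ 'k"
    using smult_in_double_ball[OF that node(4)] .
  have contr: "continuous_on (cball 0 r) (F k)"
  proof (rule uniform_limit_theorem[OF _ uniform_limit_quotients[of "cball 0 r" "\<lambda>x. x" k]])
    have "continuous_on (cball 0 r) (\<lambda>x. f (node m *s x))" for m
    proof (rule continuous_on_compose2[of "ball 0 (2 * r)" f])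
      show "continuous_on (ball 0 (2 * r)) f" using f by (simp add: line_holomorphic_def)
      show "continuous_on (cball 0 r) (\<lambda>x. node m *s x)"
        by (intro continuous_intros)
    qed (use in2 in auto)
    then show "\<forall>\<^sub>F m in sequentially. continuous_on (cball 0 r)
      (\<lambda>x. (f (node m *s x) - (\<Sum>j<k. F j x * node m ^ j)) / node m ^ k)"
      using node(1) by (intro always_eventually allI continuous_intros homf_continuous[OF less.IH]) auto
  qed auto
  have hol_small: "(\<lambda>s. F k (a + s *s b)) holomorphic_on {s. a + s *s b \<in> ball 0 r}" for a b
  proof (rule holomorphic_uniform_sequence[OF open_line_ball])
    fix m
    have "(\<lambda>s. f (node m *s a + s *s (node m *s b))) holomorphic_on {s. node m *s a + s *s (node m *s b) \<in> ball 0 (2 * r)}"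
      using f unfolding line_holomorphic_def by blast
    moreover have "node m *s a + s *s (node m *s b) = node m *s (a + s *s b)" for s
      by (simp add: vec_eq_iff algebra_simps)
    ultimately have "(\<lambda>s. f (node m *s (a + s *s b))) holomorphic_on {s. node m *s (a + s *s b) \<in> ball 0 (2 * r)}"
      by (simp only:)
    then have "(\<lambda>s. f (node m *s (a + s *s b))) holomorphic_on {s. a + s *s b \<in> ball 0 r}"
    proof (rule holomorphic_on_subset, intro subsetI)
      fix s assume "s \<in> {s. a + s *s b \<in> ball 0 r}"
      then show "s \<in> {s. node m *s (a + s *s b) \<in> ball 0 (2 * r)}"
        using in2[of "a + s *s b" m] by simp
    qed
    then show "(\<lambda>s. (f (node m *s (a + s *s b)) - (\<Sum>j<k. F j (a + s *s b) * node m ^ j)) / node m ^ k)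
        holomorphic_on {s. a + s *s b \<in> ball 0 r}"
      using node(1) by (intro holomorphic_intros homf_holomorphic_line[OF less.IH]) auto
  next
    fix s assume "s \<in> {s. a + s *s b \<in> ball 0 r}"
    with open_line_ball[of a b r] obtain d where d: "d > 0" "cball s d \<subseteq> {s. a + s *s b \<in> ball 0 r}"
      unfolding open_contains_cball by blast
    have "uniform_limit (cball s d) (\<lambda>m s. (f (node m *s (a + s *s b)) - (\<Sum>j<k. F j (a + s *s b) * node m ^ j)) / node m ^ k)
       (\<lambda>s. F k (a + s *s b)) sequentially"
      by (rule uniform_limit_quotients) (use d(2) in force)
    with d show "\<exists>d>0. cball s d \<subseteq> {s. a + s *s b \<in> ball 0 r} \<and>
      uniform_limit (cball s d) (\<lambda>m s. (f (node m *s (a + s *s b)) - (\<Sum>j<k. F j (a + s *s b) * node m ^ j)) / node m ^ k)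
       (\<lambda>s. F k (a + s *s b)) sequentially" by blast
  qed
  show ?case
  proof (rule homf_if_holomorphic_along_lines)
    show "F k (c *s v) = c ^ k * F k v" for c v by (rule F_homogeneous)
    show "continuous_on (- {0}) (F k)"
    proof -
      \<comment> \<open>Every nonzero vector is pushed radially to the sphere of radius
        \<open>r\<close>, where continuity is known; homogeneity restores the value.\<close>
      have "continuous_on (-{0}) (\<lambda>v. F k (of_real (r / norm v) *s v))"
      proof (rule continuous_on_compose2[OF contr])
        show "continuous_on (-{0}) (\<lambda>v :: complex ^ 'k. of_real (r / norm v) *s v)"
          by (intro continuous_intros) auto
        show "(\<lambda>v :: complex ^ 'k. of_real (r / norm v) *s v) ` (- {0}) \<subseteq> cball 0 r"
          using r by (auto simp: norm_vec_smult norm_divide simp del: of_real_divide split: if_splits)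
      qed
      then have "continuous_on (-{0}) (\<lambda>v. of_real (norm v / r) ^ k * F k (of_real (r / norm v) *s v))"
        using r by (intro continuous_intros) auto
      moreover have "of_real (norm v / r) ^ k * F k (of_real (r / norm v) *s v) = F k v" if "v \<in> -{0}" for v
      proof -
        have "of_real (norm v / r) *s (of_real (r / norm v) *s v) = v"
          using that r by simp
        then show ?thesis by (metis F_homogeneous)
      qed
      ultimately show ?thesis by (rule continuous_on_eq)
    qed
    show "(\<lambda>s. F k (a + s *s b)) holomorphic_on {s. a + s *s b \<noteq> 0}" for a b
    proof -
      have "(\<lambda>s. F k (a + s *s b)) analytic_on {s}" for s
      proof -
        \<comment> \<open>Scaling by this factor moves the given point of the line into the small
          ball, and homogeneity changes the values only by the constant c^k.\<close>
        define c where "c = complex_of_real (r / (norm (a + s *s b) + 1))"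
        have "r / (norm (a + s *s b) + 1) > 0"
          using r by (intro divide_pos_pos add_nonneg_pos) auto
        then        have c: "c \<noteq> 0" "norm c = r / (norm (a + s *s b) + 1)"
          unfolding c_def norm_of_real of_real_eq_0_iff by linarith+
        let ?S = "{z. c *s a + z *s (c *s b) \<in> ball 0 r}"
        have eq: "c *s a + z *s (c *s b) = c *s (a + z *s b)" for z
          by (simp add: vec_eq_iff algebra_simps)
        have "(\<lambda>z. F k (c *s a + z *s (c *s b)) / c ^ k) holomorphic_on ?S"
          using c(1) by (intro holomorphic_intros hol_small) auto
        then have "(\<lambda>z. F k (a + z *s b)) holomorphic_on ?S"
          using c(1) unfolding eq F_homogeneous by simp
        moreover have "s \<in> ?S"
        proof -
          have "r * norm (a + s *s b) < r * (norm (a + s *s b) + 1)"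
            using r by simp
          moreover have "norm (a + s *s b) + 1 > 0" by (simp add: add_nonneg_pos)
          ultimately have "norm (c *s (a + s *s b)) < r"
            unfolding norm_vec_smult c(2) by (simp add: divide_less_eq)
          then show ?thesis
            unfolding eq by (simp only: mem_Collect_eq mem_ball dist_0_norm)
        qed
        moreover have "open ?S" by (rule open_line_ball)
        ultimately show ?thesis unfolding analytic_at by blast
      qed
      then have "(\<lambda>s. F k (a + s *s b)) analytic_on {s. a + s *s b \<noteq> 0}"
        by (intro iffD2[OF analytic_on_analytic_at]) simp
      then show ?thesis by (rule analytic_imp_holomorphic)
    qed
  qed
qed

end

lemma line_holomorphic_taylor:
  fixes f :: "complex ^ 'k::finite \<Rightarrow> complex"
  assumes "line_holomorphic r f" "r > 0"
  obtains F \<rho> where "\<And>k. F k \<in> homf k" "\<rho> > 0" "\<rho> \<le> r"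
    "\<And>K. \<exists>C. \<forall>u. norm u < \<rho> \<longrightarrow> norm (f u - (\<Sum>k\<le>K. F k u)) \<le> C * norm u ^ Suc K"
    "\<And>u. norm u < \<rho> \<Longrightarrow> (\<lambda>k. F k u) sums f u"
proof -
  interpret taylor_setup f "r / 2"
    using assms by unfold_locales auto
  show ?thesis
  proof (rule that[of F "r / 4"])
    show "\<exists>C. \<forall>u. norm u < r / 4 \<longrightarrow> norm (f u - (\<Sum>k\<le>K. F k u)) \<le> C * norm u ^ Suc K" for K
    proof (intro exI allI impI)
      fix u :: "complex ^ 'k" assume "norm u < r / 4"
      then show "norm (f u - (\<Sum>k\<le>K. F k u)) \<le> (2 * M / (r / 2) ^ Suc K) * norm u ^ Suc K"
        by (intro taylor_remainder) simp
    qed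
    show "(\<lambda>k. F k u) sums f u" if "norm u < r / 4" for u
      using F_sums[of u 1] that assms(2) by simp
  qed (use assms F_homf in auto)
qed

section \<open>Power series coefficients along analytic curves\<close>

lemma fps_nth_eq_0_if_bounded:
  fixes f :: "complex \<Rightarrow> complex"
  assumes "f has_fps_expansion G" "eventually (\<lambda>t. norm (f t) \<le> C * norm t ^ n) (nhds 0)" "k < n"
  shows "fps_nth G k = 0"
proof (rule ccontr)
  assume nz: "fps_nth G k \<noteq> 0"
  define d where "d = subdegree G"
  have d: "d \<le> k" unfolding d_def using nz by (rule subdegree_leI)
  have G0: "fps_nth G d \<noteq> 0" unfolding d_def using nz by (metis fps_zero_nth nth_subdegree_nonzero)
  \<comment> \<open>Dividing by the lowest power of x leaves a function with nonzero limit at 0,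
    whereas the assumed bound forces the limit 0.\<close>
  have "(\<lambda>x. if x = 0 then fps_nth G d else f x / x ^ d) has_fps_expansion fps_shift d G"
    using assms(1) by (rule has_fps_expansion_shift) (auto simp: d_def)
  then have "continuous (at 0) (\<lambda>x. if x = 0 then fps_nth G d else f x / x ^ d)"
    by (rule has_fps_expansion_imp_continuous)
  then have "((\<lambda>x. if x = 0 then fps_nth G d else f x / x ^ d) \<longlongrightarrow> fps_nth G d) (at 0)"
    by (simp add: continuous_within)
  moreover have ev: "eventually (\<lambda>x. norm (if x = 0 then fps_nth G d else f x / x ^ d) \<le> C * norm x ^ (n - d)) (at 0)"
    unfolding eventually_at_filter using assms(2)
  proof eventually_elim
    case (elim x)
    have "norm x ^ n = norm x ^ (n - d) * norm x ^ d"
      using d assms(3) by (simp flip: power_add)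
    then show ?case using elim by (simp add: norm_divide norm_power divide_le_eq mult.assoc)
  qed
  moreover have lim: "((\<lambda>x. C * norm x ^ (n - d)) \<longlongrightarrow> 0) (at (0 :: complex))"
    using d assms(3) by (auto intro!: tendsto_eq_intros)
  ultimately have "((\<lambda>x. if x = 0 then fps_nth G d else f x / x ^ d) \<longlongrightarrow> 0) (at 0)"
    by (intro Lim_null_comparison[OF ev lim])
  with \<open>((\<lambda>x. if x = 0 then fps_nth G d else f x / x ^ d) \<longlongrightarrow> fps_nth G d) (at 0)\<close> G0
  show False using tendsto_unique[of "at (0::complex)"] by fastforce
qed

lemma has_fps_expansion_bounded_linear_growth:
  fixes f :: "complex \<Rightarrow> complex"
  assumes "f has_fps_expansion G" "fps_nth G 0 = 0"
  shows "\<exists>C. eventually (\<lambda>t. norm (f t) \<le> C * norm t) (nhds 0)"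
proof -
  have "f analytic_on {0}" using assms(1) by (rule has_fps_expansion_imp_analytic_0)
  then have "f field_differentiable (at 0)" by (rule analytic_on_imp_differentiable_at) simp
  then obtain D where D: "(f has_field_derivative D) (at 0)" by (auto simp: field_differentiable_def)
  have f0: "f 0 = 0" using has_fps_expansion_imp_0_eq_fps_nth_0[OF assms(1)] assms(2) by simp
  from D have "((\<lambda>h. f h / h) \<longlongrightarrow> D) (at 0)" by (simp add: DERIV_def f0)
  then have "eventually (\<lambda>h. dist (f h / h) D < 1) (at 0)" by (rule tendstoD) simp
  then have "eventually (\<lambda>h. norm (f h) \<le> (norm D + 1) * norm h) (nhds 0)"
    unfolding eventually_at_filter
  proof eventually_elim
    case (elim h)
    show ?case
    proof (cases "h = 0")
      case False
      then have "norm (f h / h) \<le> norm D + 1"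
        using elim norm_triangle_ineq2[of "f h / h" D] by (simp add: dist_norm)
      then show ?thesis using False by (simp add: norm_divide divide_le_eq)
    qed (simp add: f0)
  qed
  then show ?thesis by blast
qed

text \<open>Since y(t) = O(t), the Taylor remainder of order \<open>K\<close> is O(t^(K+1)) along
  the curve, so the coefficients up to order \<open>K\<close> can be computed from the Taylor
  polynomial. No multivariate formal series has to be composed.\<close>

lemma fps_expansion_compose_taylor:
  fixes f :: "complex ^ 'k::finite \<Rightarrow> complex" and y :: "complex \<Rightarrow> complex ^ 'k"
    and a :: "('k \<Rightarrow> nat) \<Rightarrow> complex"
  assumes rho: "\<rho> > 0" and bnd: "\<forall>u. norm u < \<rho> \<longrightarrow>
      norm (f u - (\<Sum>k\<le>K. \<Sum>\<alpha>\<in>expos k. a \<alpha> * mon \<alpha> (\<lambda>j. u $ j))) \<le> C * norm u ^ Suc K"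
    and Y: "\<And>j. (\<lambda>t. y t $ j) has_fps_expansion Y j" "\<And>j. fps_nth (Y j) 0 = 0"
    and G: "(\<lambda>t. f (y t)) has_fps_expansion G" and l: "l \<le> K"
  shows "fps_nth G l = (\<Sum>k\<le>K. \<Sum>\<alpha>\<in>expos k. a \<alpha> * fps_nth (mon \<alpha> Y) l)"
proof -
  have "\<exists>C. eventually (\<lambda>t. norm (y t $ j) \<le> C * norm t) (nhds 0)" for j
    by (rule has_fps_expansion_bounded_linear_growth[OF Y])
  then obtain D where D: "\<And>j. eventually (\<lambda>t. norm (y t $ j) \<le> D j * norm t) (nhds 0)" by metis
  define B where "B = (\<Sum>j\<in>UNIV. D j)"
  have "eventually (\<lambda>t. \<forall>j. norm (y t $ j) \<le> D j * norm t) (nhds 0)"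
    using D by (intro eventually_all_finite)
  then have yB: "eventually (\<lambda>t. norm (y t) \<le> B * norm t) (nhds 0)"
  proof eventually_elim
    case (elim t)
    have "norm (y t) \<le> (\<Sum>j\<in>UNIV. norm (y t $ j))"
      unfolding norm_vec_def by (rule L2_set_le_sum) simp
    also have "\<dots> \<le> (\<Sum>j\<in>UNIV. D j * norm t)" using elim by (intro sum_mono) auto
    finally show ?case by (simp add: B_def sum_distrib_right)
  qed
  have "((\<lambda>t :: complex. B * norm t) \<longlongrightarrow> 0) (nhds 0)"
    by (auto intro!: tendsto_eq_intros filterlim_ident)
  then have "eventually (\<lambda>t :: complex. B * norm t < \<rho>) (nhds 0)"
    using rho by (rule order_tendstoD)
  with yB have small: "eventually (\<lambda>t. norm (f (y t) - (\<Sum>k\<le>K. \<Sum>\<alpha>\<in>expos k. a \<alpha> * mon \<alpha> (\<lambda>j. y t $ j)))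
      \<le> \<bar>C\<bar> * B ^ Suc K * norm t ^ Suc K) (nhds 0)"
  proof eventually_elim
    case (elim t)
    then have "norm (y t) < \<rho>" by simp
    then have "norm (f (y t) - (\<Sum>k\<le>K. \<Sum>\<alpha>\<in>expos k. a \<alpha> * mon \<alpha> (\<lambda>j. y t $ j))) \<le> C * norm (y t) ^ Suc K"
      using bnd by blast
    also have "\<dots> \<le> \<bar>C\<bar> * norm (y t) ^ Suc K" by (intro mult_right_mono) auto
    also have "\<dots> \<le> \<bar>C\<bar> * (B * norm t) ^ Suc K"
      using elim(1) by (intro mult_left_mono power_mono) auto
    finally show ?case by (simp only: power_mult_distrib mult.assoc)
  qed
  have "(\<lambda>t. mon \<alpha> (\<lambda>j. y t $ j)) has_fps_expansion mon \<alpha> Y" for \<alpha>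
    unfolding mon_def by (intro has_fps_expansion_prod has_fps_expansion_power Y)
  then have "(\<lambda>t. f (y t) - (\<Sum>k\<le>K. \<Sum>\<alpha>\<in>expos k. a \<alpha> * mon \<alpha> (\<lambda>j. y t $ j)))
     has_fps_expansion (G - (\<Sum>k\<le>K. \<Sum>\<alpha>\<in>expos k. fps_const (a \<alpha>) * mon \<alpha> Y))"
    by (intro has_fps_expansion_diff has_fps_expansion_sum has_fps_expansion_cmult_left G)
  from fps_nth_eq_0_if_bounded[OF this small, of l] l
  show ?thesis by (simp add: fps_sum_nth)
qed

text \<open>The combination f(2 t) - 2^(d+1) f(t) kills the coefficient of order d + 1 and
  multiplies each lower one by a nonzero constant; induction on the degree gives the lower
  coefficients, and subtracting them at t = 1 gives the top one.\<close>

lemma vec_poly_coeff_in_subspace: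
  fixes a :: "nat \<Rightarrow> complex ^ 'm::finite"
  assumes "vec.subspace S" "\<And>t. (\<Sum>k\<le>d. t ^ k *s a k) \<in> S" "k \<le> d"
  shows "a k \<in> S"
  using assms(2,3)
proof (induction d arbitrary: a k)
  case 0
  then show ?case by simp
next
  case (Suc d)
  have step: "a k \<in> S" if "k \<le> d" for k
  proof -
    have "(\<Sum>k\<le>d. t ^ k *s ((2 ^ k - 2 ^ Suc d) *s a k)) \<in> S" for t :: complex
    proof -
      have "(\<Sum>k\<le>Suc d. (2 * t) ^ k *s a k) - 2 ^ Suc d *s (\<Sum>k\<le>Suc d. t ^ k *s a k) \<in> S"
        using Suc.prems(1) assms(1) by (intro vec.subspace_diff vec.subspace_scale)
      also have "(\<Sum>k\<le>Suc d. (2 * t) ^ k *s a k) - 2 ^ Suc d *s (\<Sum>k\<le>Suc d. t ^ k *s a k)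
         = (\<Sum>k\<le>Suc d. t ^ k *s ((2 ^ k - 2 ^ Suc d) *s a k))"
        by (simp only: vec.scale_sum_right sum_subtractf[symmetric])
           (intro sum.cong refl, simp add: vec_eq_iff power_mult_distrib algebra_simps)
      finally show ?thesis by simp
    qed
    from Suc.IH[OF this that] have "(2 ^ k - 2 ^ Suc d) *s a k \<in> S" .
    then have "(1 / (2 ^ k - 2 ^ Suc d)) *s ((2 ^ k - 2 ^ Suc d) *s a k) \<in> S"
      by (rule vec.subspace_scale[OF assms(1)])
    moreover have "(2 :: complex) ^ k \<noteq> 2 ^ Suc d"
    proof -
      have "(2 :: nat) ^ k \<noteq> 2 ^ Suc d" using that power_inject_exp[of "2 :: nat" k "Suc d"] by simp
      then have "of_nat (2 ^ k) \<noteq> (of_nat (2 ^ Suc d) :: complex)" by (metis of_nat_eq_iff)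
      then show ?thesis by (metis of_nat_numeral of_nat_power)
    qed
    ultimately show ?thesis by (simp only: vec.scale_scale) simp
  qed
  show ?case
  proof (cases "k \<le> d")
    case False
    then have "k = Suc d" using Suc.prems(2) by simp
    have "(\<Sum>k\<le>Suc d. 1 ^ k *s a k) - (\<Sum>k\<le>d. a k) \<in> S"
      using assms(1) by (intro vec.subspace_diff Suc.prems(1) vec.subspace_sum step) auto
    then show ?thesis by (simp add: \<open>k = Suc d\<close>)
  qed (rule step)
qed

text \<open>One variable at a time: as a polynomial in z_i, the coefficient of each power collects
  the exponents with that i-th entry. The induction keeps the invariant that the exponents still
  present are distinguished by the remaining variables.\<close>

lemma mon_coeff_in_subspace:
  fixes x :: "('k::finite \<Rightarrow> nat) \<Rightarrow> complex ^ 'm::finite"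
  assumes S: "vec.subspace S" and A: "finite A"
    and "\<And>z. (\<Sum>\<alpha>\<in>A. mon \<alpha> z *s x \<alpha>) \<in> S" and "\<alpha> \<in> A"
  shows "x \<alpha> \<in> S"
proof -
  have *: "x \<alpha> \<in> S" if "finite T" "finite A" "\<And>\<alpha> \<beta>. \<alpha> \<in> A \<Longrightarrow> \<beta> \<in> A \<Longrightarrow> \<forall>j\<in>T. \<alpha> j = \<beta> j \<Longrightarrow> \<alpha> = \<beta>"
    "\<And>z. (\<Sum>\<alpha>\<in>A. (\<Prod>j\<in>T. z j ^ \<alpha> j) *s x \<alpha>) \<in> S" "\<alpha> \<in> A" for T A \<alpha>
    using that
  proof (induction T arbitrary: A \<alpha>)
    case empty
    then have "A = {\<alpha>}" by auto
    then show ?case using empty.prems(3) by simp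
  next
    case (insert i T)
    define D where "D = Max ((\<lambda>\<alpha>. \<alpha> i) ` A)"
    have D: "\<beta> i \<le> D" if "\<beta> \<in> A" for \<beta>
      unfolding D_def using that insert.prems(1) by (intro Max_ge) auto
    show ?case
    proof (rule insert.IH[of "{\<beta>\<in>A. \<beta> i = \<alpha> i}"])
      show "(\<Sum>\<beta>\<in>{\<beta>\<in>A. \<beta> i = \<alpha> i}. (\<Prod>j\<in>T. z j ^ \<beta> j) *s x \<beta>) \<in> S" for z
      proof (rule vec_poly_coeff_in_subspace[OF S, where d = D])
        fix t :: complex
        have "(\<Sum>k\<le>D. t ^ k *s (\<Sum>\<beta>\<in>{\<beta>\<in>A. \<beta> i = k}. (\<Prod>j\<in>T. z j ^ \<beta> j) *s x \<beta>))
           = (\<Sum>k\<le>D. \<Sum>\<beta>\<in>{\<beta>\<in>A. \<beta> i = k}. (t ^ \<beta> i * (\<Prod>j\<in>T. z j ^ \<beta> j)) *s x \<beta>)"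
          by (auto simp: vec.scale_sum_right intro!: sum.cong)
        also have "\<dots> = (\<Sum>\<beta>\<in>A. (t ^ \<beta> i * (\<Prod>j\<in>T. z j ^ \<beta> j)) *s x \<beta>)"
          using D insert.prems(1) by (intro sum.group) auto
        also have "\<dots> = (\<Sum>\<beta>\<in>A. (\<Prod>j\<in>insert i T. (z(i := t)) j ^ \<beta> j) *s x \<beta>)"
        proof (intro sum.cong refl arg_cong2[of _ _ _ _ "(*s)"])
          fix \<beta>
          have "(\<Prod>j\<in>T. z j ^ \<beta> j) = (\<Prod>j\<in>T. (z(i := t)) j ^ \<beta> j)"
            using insert.hyps by (intro prod.cong) auto
          then show "t ^ \<beta> i * (\<Prod>j\<in>T. z j ^ \<beta> j) = (\<Prod>j\<in>insert i T. (z(i := t)) j ^ \<beta> j)"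
            using insert.hyps by simp
        qed
        also have "\<dots> \<in> S" by (rule insert.prems(3))
        finally show "(\<Sum>k\<le>D. t ^ k *s (\<Sum>\<beta>\<in>{\<beta>\<in>A. \<beta> i = k}. (\<Prod>j\<in>T. z j ^ \<beta> j) *s x \<beta>)) \<in> S" .
      qed (use D insert.prems in auto)
    next
      fix \<beta> \<gamma> assume "\<beta> \<in> {\<beta> \<in> A. \<beta> i = \<alpha> i}" "\<gamma> \<in> {\<beta> \<in> A. \<beta> i = \<alpha> i}" "\<forall>j\<in>T. \<beta> j = \<gamma> j"
      then show "\<beta> = \<gamma>" by (intro insert.prems(2)) auto
    qed (use insert.prems in auto)
  qed
  show ?thesis
    by (rule *[of UNIV A \<alpha>]) (use assms in \<open>auto simp: mon_def fun_eq_iff\<close>)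
qed

section \<open>Families of polynomial curves\<close>

text \<open>Bilinear, without conjugation, so that vectors \<open>l\<close> stand for the complex
  linear functionals.\<close>

definition dotp :: "complex ^ 'm::finite \<Rightarrow> complex ^ 'm \<Rightarrow> complex" where
  "dotp l x = (\<Sum>j\<in>UNIV. l $ j * x $ j)"

lemma dotp_simps [simp]:
  "dotp l 0 = 0" "dotp l (x + y) = dotp l x + dotp l y" "dotp l (x - y) = dotp l x - dotp l y"
  "dotp l (c *s x) = c * dotp l x" "dotp (l + l') x = dotp l x + dotp l' x" "dotp (c *s l) x = c * dotp l x"
  "dotp 0 x = 0"
  by (simp_all add: dotp_def algebra_simps sum.distrib sum_subtractf sum_distrib_left)

lemma dotp_sum [simp]: "dotp l (\<Sum>a\<in>A. f a) = (\<Sum>a\<in>A. dotp l (f a))"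
  "dotp (\<Sum>a\<in>A. g a) x = (\<Sum>a\<in>A. dotp (g a) x)"
  by (induction A rule: infinite_finite_induct) auto

text \<open>Converts a lower bound for a dimension, coming from regularity or from the span of a
  polynomial map, into independence of coefficient vectors.\<close>

lemma independent_if_card_le_dim:
  fixes e :: "'a \<Rightarrow> complex ^ 'm::finite"
  assumes "finite A" "S \<subseteq> vec.span (e ` A)" "card A \<le> vec.dim S"
  shows "inj_on e A" "vec.independent (e ` A)"
proof -
  have "vec.dim S \<le> card (e ` A)"
    using assms by (intro vec.dim_le_card) auto
  then have c: "card (e ` A) = card A"
    using assms card_image_le[of A e] by simp
  then show "inj_on e A" using assms(1) by (rule eq_card_imp_inj_on[rotated])
  show "vec.independent (e ` A)"
  proof (rule vec.card_le_dim_spanning[of _ "vec.span (e ` A)"])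
    show "card (e ` A) \<le> vec.dim (vec.span (e ` A))"
      using assms c vec.dim_subset[OF assms(2)] by simp
  qed (use assms in \<open>auto intro: vec.span_base\<close>)
qed

lemma ex_dual_vector:
  fixes e :: "'a \<Rightarrow> complex ^ 'm::finite"
  assumes "inj_on e A" "vec.independent (e ` A)" "\<beta> \<in> A"
  shows "\<exists>l. \<forall>\<alpha>\<in>A. dotp l (e \<alpha>) = (if \<alpha> = \<beta> then 1 else 0)"
proof -
  \<comment> \<open>Scalar values are carried by one coordinate axis; the functional is then row
    \<open>i\<close> of the matrix of the extended map.\<close>
  fix i :: 'm
  obtain g :: "complex ^ 'm \<Rightarrow> complex ^ 'm" where g: "Vector_Spaces.linear (*s) (*s) g"
    "\<forall>x\<in>e ` A. g x = (if x = e \<beta> then axis i 1 else 0)"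
    using vec.linear_independent_extend[OF assms(2), of "\<lambda>x. if x = e \<beta> then axis i 1 else 0"] by blast
  have "dotp (matrix g $ i) x = g x $ i" for x
    using matrix_works[OF g(1), of x, symmetric] by (simp add: dotp_def matrix_vector_mult_def)
  moreover have "g (e \<alpha>) $ i = (if \<alpha> = \<beta> then 1 else 0)" if "\<alpha> \<in> A" for \<alpha>
    using g(2) that assms(1,3) by (auto simp: inj_on_eq_iff axis_def)
  ultimately show ?thesis by metis
qed

section \<open>Counting monomials\<close>

definition expos_le :: "nat \<Rightarrow> ('k::finite \<Rightarrow> nat) set" where
  "expos_le q = {\<alpha>. (\<Sum>i\<in>UNIV. \<alpha> i) \<le> q}"

lemma expos_le_eq_Union: "expos_le q = (\<Union>k\<le>q. expos k)"
  by (auto simp: expos_le_def expos_def)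

lemma finite_expos_le: "finite (expos_le q)"
  by (simp add: expos_le_eq_Union finite_expos)

lemma sum_expos_le: "(\<Sum>k\<le>q. \<Sum>\<alpha>\<in>expos k. f \<alpha>) = (\<Sum>\<alpha>\<in>expos_le q. f \<alpha>)"
  unfolding expos_le_eq_Union
  by (rule sum.UNION_disjoint[symmetric]) (auto simp: finite_expos, auto simp: expos_def)

text \<open>Stars and bars: appending the slack q - |\<alpha>| turns an exponent into a list of
  CARD('k) + 1 natural numbers with sum exactly \<open>q\<close>.\<close>

lemma card_expos_le: "card (expos_le q :: ('k::finite \<Rightarrow> nat) set) \<le> (CARD('k) + q) choose q"
proof -
  obtain xs where xs: "set xs = (UNIV :: 'k set)" "distinct xs"
    using finite_distinct_list[OF finite[of UNIV]] by blast
  then have len: "length xs = CARD('k)" using distinct_card by fastforce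
  have sl: "sum_list (map \<alpha> xs) = (\<Sum>i\<in>UNIV. \<alpha> i)" for \<alpha> :: "'k \<Rightarrow> nat"
    using sum_list_distinct_conv_sum_set[OF xs(2), of \<alpha>] xs(1) by simp
  let ?L = "{l :: nat list. length l = CARD('k) + 1 \<and> sum_list l = q}"
  have "card (expos_le q :: ('k \<Rightarrow> nat) set) \<le> card ?L"
  proof (rule card_inj_on_le)
    show "inj_on (\<lambda>\<alpha>. map \<alpha> xs @ [q - (\<Sum>i\<in>UNIV. \<alpha> i)]) (expos_le q :: ('k \<Rightarrow> nat) set)"
      using xs(1) by (intro inj_onI) (auto simp: fun_eq_iff)
    show "(\<lambda>\<alpha>. map \<alpha> xs @ [q - (\<Sum>i\<in>UNIV. \<alpha> i)]) ` (expos_le q :: ('k \<Rightarrow> nat) set) \<subseteq> ?L"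
      by (auto simp: len sl expos_le_def)
    show "finite ?L"
    proof (rule finite_subset)
      show "?L \<subseteq> {l. set l \<subseteq> {..q} \<and> length l = CARD('k) + 1}"
        using member_le_sum_list by auto
      show "finite {l. set l \<subseteq> {..q} \<and> length l = CARD('k) + 1}"
        by (rule finite_lists_length_eq) simp
    qed
  qed
  also have "card ?L = (CARD('k) + q) choose q"
    by (subst card_length_sum_list) (simp add: add.commute)
  finally show ?thesis .
qed

text \<open>Dehomogenization loses nothing, because the exponent of the coordinate
  \<open>None\<close> is determined by the total degree.\<close>

lemma card_expos_option: "card (expos q :: ('k::finite option \<Rightarrow> nat) set) \<le> card (expos_le q :: ('k \<Rightarrow> nat) set)"
proof (rule card_inj_on_le[of "\<lambda>\<alpha> j. \<alpha> (Some j)"])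
  have split: "(\<Sum>i\<in>UNIV. \<alpha> i) = \<alpha> None + (\<Sum>j\<in>UNIV. \<alpha> (Some j))" for \<alpha> :: "'k option \<Rightarrow> nat"
    by (simp add: UNIV_option_conv sum.reindex)
  show "inj_on (\<lambda>\<alpha> j. \<alpha> (Some j)) (expos q :: ('k option \<Rightarrow> nat) set)"
  proof (rule inj_onI, rule ext)
    fix \<alpha> \<beta> :: "'k option \<Rightarrow> nat" and i
    assume a: "\<alpha> \<in> expos q" "\<beta> \<in> expos q" "(\<lambda>j. \<alpha> (Some j)) = (\<lambda>j. \<beta> (Some j))"
    then have s: "\<alpha> (Some j) = \<beta> (Some j)" for j by meson
    then have "\<alpha> None = \<beta> None" using a(1,2) by (simp add: expos_def split)
    with s show "\<alpha> i = \<beta> i" by (cases i) auto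
  qed
  show "(\<lambda>\<alpha> j. \<alpha> (Some j)) ` (expos q :: ('k option \<Rightarrow> nat) set) \<subseteq> expos_le q"
    by (auto simp: expos_def expos_le_def split)
qed (rule finite_expos_le)

text \<open>Records that the coefficients already treated by the induction, those of order below
  \<open>m\<close>, are forms in the direction \<open>v\<close> of degree \<open>a\<close> plus
  their order. The offset is 0 for \<open>lam\<close>, 1 for \<open>Z\<close> and |\<alpha>| for a
  monomial in \<open>Z\<close>.\<close>

definition graded :: "nat \<Rightarrow> nat \<Rightarrow> (complex ^ 'k::finite \<Rightarrow> complex fps) \<Rightarrow> bool" where
  "graded a m f \<longleftrightarrow> (\<forall>l<m. (\<lambda>v. fps_nth (f v) l) \<in> homf (a + l))"

lemma graded_nth: "graded a m f \<Longrightarrow> l < m \<Longrightarrow> (\<lambda>v. fps_nth (f v) l) \<in> homf (a + l)"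
  by (simp add: graded_def)

lemma graded_mult:
  assumes "graded a m f" "graded b m g"
  shows "graded (a + b) m (\<lambda>v. f v * g v)"
  unfolding graded_def
proof (intro allI impI)
  fix l assume "l < m"
  have "(\<lambda>v. fps_nth (f v) i * fps_nth (g v) (l - i)) \<in> homf (a + b + l)" if "i \<in> {0..l}" for i
  proof -
    have "(\<lambda>v. fps_nth (f v) i * fps_nth (g v) (l - i)) \<in> homf ((a + i) + (b + (l - i)))"
      by (intro homf_mult graded_nth[OF assms(1)] graded_nth[OF assms(2)])
         (use that \<open>l < m\<close> in auto)
    then show ?thesis using that by (simp add: add_ac)
  qed
  then show "(\<lambda>v. fps_nth (f v * g v) l) \<in> homf (a + b + l)"
    unfolding fps_mult_nth by (rule homf_sum)
qed

text \<open>Modulo forms already known, taking the coefficient of order \<open>m\<close> obeys the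
  Leibniz rule, because in all other products both orders are below \<open>m\<close>. The unknown
  top coefficients therefore enter linearly.\<close>

lemma top_coeff_mult:
  assumes "graded a m f" "graded b m g" "m \<ge> 1"
  shows "(\<lambda>v. fps_nth (f v * g v) m - (fps_nth (f v) m * fps_nth (g v) 0 + fps_nth (f v) 0 * fps_nth (g v) m)) \<in> homf (a + b + m)"
proof -
  have "(\<lambda>v. fps_nth (f v) i * fps_nth (g v) (m - i)) \<in> homf (a + b + m)" if "i \<in> {1..<m}" for i
  proof -
    have "(\<lambda>v. fps_nth (f v) i * fps_nth (g v) (m - i)) \<in> homf ((a + i) + (b + (m - i)))"
      by (intro homf_mult graded_nth[OF assms(1)] graded_nth[OF assms(2)]) (use that in auto)
    then show ?thesis using that by (simp add: add_ac)
  qed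
  then have "(\<lambda>v. \<Sum>i\<in>{1..<m}. fps_nth (f v) i * fps_nth (g v) (m - i)) \<in> homf (a + b + m)"
    by (rule homf_sum)
  moreover have "{0..m} = insert 0 (insert m {1..<m})" using assms(3) by auto
  ultimately show ?thesis using assms(3) by (simp add: fps_mult_nth)
qed

lemma graded_1: "graded 0 m (\<lambda>v. 1)"
  unfolding graded_def by (auto intro: homf_const)

lemma graded_power: "graded a m f \<Longrightarrow> graded (k * a) m (\<lambda>v. f v ^ k)"
  by (induction k) (auto intro: graded_1 dest: graded_mult)

lemma graded_prod:
  "(\<And>i. i \<in> A \<Longrightarrow> graded (d i) m (f i)) \<Longrightarrow> graded (\<Sum>i\<in>A. d i) m (\<lambda>v. \<Prod>i\<in>A. f i v)"
  by (induction A rule: infinite_finite_induct) (auto intro: graded_1 graded_mult)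

lemma graded_mon:
  assumes "\<And>j. graded 1 m (\<lambda>v. Z v j)"
  shows "graded (\<Sum>i\<in>UNIV. \<alpha> i) m (\<lambda>v. mon \<alpha> (Z v))"
  unfolding mon_def using graded_power[OF assms] by (intro graded_prod) simp

lemma top_coeff_power:
  assumes f: "graded a m f" and m: "m \<ge> 1"
  shows "(\<lambda>v. fps_nth (f v ^ k) m - of_nat k * fps_nth (f v) 0 ^ (k - 1) * fps_nth (f v) m) \<in> homf (k * a + m)"
proof (induction k)
  case 0
  then show ?case using m by simp
next
  case (Suc k)
  have 0: "(\<lambda>v. fps_nth (f v) 0) \<in> homf a" using f m by (auto simp: graded_def)
  have 1: "(\<lambda>v. fps_nth (f v * f v ^ k) m - (fps_nth (f v) m * fps_nth (f v ^ k) 0 + fps_nth (f v) 0 * fps_nth (f v ^ k) m)) \<in> homf (Suc k * a + m)"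
    using top_coeff_mult[OF f graded_power[OF f, of k] m] by simp
  have 2: "(\<lambda>v. fps_nth (f v) 0 * (fps_nth (f v ^ k) m - of_nat k * fps_nth (f v) 0 ^ (k - 1) * fps_nth (f v) m)) \<in> homf (Suc k * a + m)"
    using homf_mult[OF 0 Suc] by (simp add: add_ac)
  have "fps_nth (f v ^ Suc k) m - of_nat (Suc k) * fps_nth (f v) 0 ^ (Suc k - 1) * fps_nth (f v) m =
     (fps_nth (f v * f v ^ k) m - (fps_nth (f v) m * fps_nth (f v ^ k) 0 + fps_nth (f v) 0 * fps_nth (f v ^ k) m)) +
     fps_nth (f v) 0 * (fps_nth (f v ^ k) m - of_nat k * fps_nth (f v) 0 ^ (k - 1) * fps_nth (f v) m)" for v
    by (cases k) (simp_all add: algebra_simps fps_power_zeroth)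
  then show ?case using homf_add[OF 1 2] by (simp only:)
qed

text \<open>The monomial Z_j^d yields v_j^(d-1) W_j, where W_k denotes the combination in the
  conclusion, and Z_j^(d-1) Z_k yields a mixed expression. Together they show that v_j^d W_k is a
  form for every j, and the power of v_j can be divided out. \<open>zero\<close> supplies the value
  at the origin.\<close>

lemma top_coeff_direction:
  fixes lam :: "complex ^ 'k::finite \<Rightarrow> complex fps" and Z :: "complex ^ 'k \<Rightarrow> 'k \<Rightarrow> complex fps"
  assumes m: "m \<ge> 1" and gl: "graded 0 m lam" and gZ: "\<And>j. graded 1 m (\<lambda>v. Z v j)"
    and l0: "\<And>v. fps_nth (lam v) 0 = 1" and Z0: "\<And>v j. fps_nth (Z v j) 0 = v $ j"
    and zero: "\<And>j. fps_nth (Z 0 j) m = 0"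
    and D: "\<And>\<beta>. \<beta> \<in> expos d \<Longrightarrow> (\<lambda>v. fps_nth (lam v * mon \<beta> (Z v)) m) \<in> homf (d + m)"
  shows "(\<lambda>v. v $ k * fps_nth (lam v) m + of_nat d * fps_nth (Z v k) m) \<in> homf (Suc m)"
proof (cases "d = 0")
  case True
  have "(\<lambda>v. fps_nth (lam v) m) \<in> homf m"
    using D[of "\<lambda>_. 0"] True by (simp add: expos_def)
  then show ?thesis using homf_mult[OF homf_coord] True by force
next
  case False
  let ?W = "\<lambda>k v. v $ k * fps_nth (lam v) m + of_nat d * fps_nth (Z v k) m"
  have top: "(\<lambda>v. v $ j ^ (d - 1) * ?W j v) \<in> homf (d + m)" for j
  proof -
    have "graded d m (\<lambda>v. Z v j ^ d)" using graded_power[OF gZ, of d] by simp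
    from top_coeff_mult[OF gl this m]
    have 1: "(\<lambda>v. fps_nth (lam v * Z v j ^ d) m - (fps_nth (lam v) m * v $ j ^ d + fps_nth (Z v j ^ d) m)) \<in> homf (d + m)"
      by (simp add: l0 Z0 fps_power_zeroth)
    have 2: "(\<lambda>v. fps_nth (Z v j ^ d) m - of_nat d * v $ j ^ (d - 1) * fps_nth (Z v j) m) \<in> homf (d + m)"
      using top_coeff_power[OF gZ m, of j d] by (simp add: Z0)
    have 3: "(\<lambda>v. fps_nth (lam v * Z v j ^ d) m) \<in> homf (d + m)"
      using D[of "\<lambda>i. if i = j then d else 0"] by (simp add: expos_def mon_single)
    have "v $ j ^ (d - 1) * ?W j v = fps_nth (lam v * Z v j ^ d) m
      - (fps_nth (lam v * Z v j ^ d) m - (fps_nth (lam v) m * v $ j ^ d + fps_nth (Z v j ^ d) m))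
      - (fps_nth (Z v j ^ d) m - of_nat d * v $ j ^ (d - 1) * fps_nth (Z v j) m)" for v
      using False by (cases d) (simp_all add: algebra_simps)
    then show ?thesis using homf_diff[OF homf_diff[OF 3 1] 2] by (simp only:)
  qed
  have mixed: "(\<lambda>v. fps_nth (lam v) m * v $ j ^ (d - 1) * v $ k
      + (of_nat (d - 1) * v $ j ^ (d - 1 - 1) * fps_nth (Z v j) m * v $ k + v $ j ^ (d - 1) * fps_nth (Z v k) m)) \<in> homf (d + m)"
    (is "?T \<in> _") if "j \<noteq> k" for j
  proof -
    have gp: "graded (d - 1) m (\<lambda>v. Z v j ^ (d - 1))" using graded_power[OF gZ, of "d - 1"] by simp
    have gm: "graded d m (\<lambda>v. Z v j ^ (d - 1) * Z v k)" using graded_mult[OF gp gZ, of k] False by simp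
    from top_coeff_mult[OF gl gm m]
    have 1: "(\<lambda>v. fps_nth (lam v * (Z v j ^ (d - 1) * Z v k)) m - (fps_nth (lam v) m * (v $ j ^ (d - 1) * v $ k) + fps_nth (Z v j ^ (d - 1) * Z v k) m)) \<in> homf (d + m)"
      by (simp add: l0 Z0 fps_power_zeroth)
    have 2: "(\<lambda>v. fps_nth (Z v j ^ (d - 1) * Z v k) m - (fps_nth (Z v j ^ (d - 1)) m * v $ k + v $ j ^ (d - 1) * fps_nth (Z v k) m)) \<in> homf (d + m)"
      using top_coeff_mult[OF gp gZ m, of k] False by (simp add: Z0 fps_power_zeroth)
    have 3: "(\<lambda>v. v $ k * (fps_nth (Z v j ^ (d - 1)) m - of_nat (d - 1) * v $ j ^ (d - 1 - 1) * fps_nth (Z v j) m)) \<in> homf (d + m)"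
      using homf_mult[OF homf_coord top_coeff_power[OF gZ m, of j "d - 1"], of k] False by (simp add: Z0)
    let ?\<beta> = "\<lambda>i. (if i = j then d - 1 else 0) + (if i = k then 1 else 0)"
    have "?\<beta> \<in> expos d" using False by (simp add: expos_def sum.distrib)
    moreover have "mon ?\<beta> y = y j ^ (d - 1) * y k" for y :: "'k \<Rightarrow> complex fps"
      by (simp add: mon_add mon_single)
    ultimately have 4: "(\<lambda>v. fps_nth (lam v * (Z v j ^ (d - 1) * Z v k)) m) \<in> homf (d + m)"
      using D[of ?\<beta>] by simp
    have "?T v = fps_nth (lam v * (Z v j ^ (d - 1) * Z v k)) m
      - (fps_nth (lam v * (Z v j ^ (d - 1) * Z v k)) m - (fps_nth (lam v) m * (v $ j ^ (d - 1) * v $ k) + fps_nth (Z v j ^ (d - 1) * Z v k) m))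
      - (fps_nth (Z v j ^ (d - 1) * Z v k) m - (fps_nth (Z v j ^ (d - 1)) m * v $ k + v $ j ^ (d - 1) * fps_nth (Z v k) m))
      - v $ k * (fps_nth (Z v j ^ (d - 1)) m - of_nat (d - 1) * v $ j ^ (d - 1 - 1) * fps_nth (Z v j) m)" for v
      by (simp add: algebra_simps)
    then show ?thesis using homf_diff[OF homf_diff[OF homf_diff[OF 4 1] 2] 3] by (simp only:)
  qed
  show ?thesis
  proof (rule homf_if_coord_power_mult)
    fix j
    show "(\<lambda>v. v $ j ^ d * ?W k v) \<in> homf (Suc m + d)"
    proof (cases "j = k")
      case True
      have "v $ j ^ d * ?W k v = v $ j * (v $ j ^ (d - 1) * ?W j v)" for v
        using False True by (cases d) simp_all
      then show ?thesis using homf_mult[OF homf_coord[of j] top[of j]] by (simp add: add_ac)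
    next
      case jk: False
      \<comment> \<open>Subtracting (d - 1) v_k times the pure relation from d v_j times the mixed
        one cancels the top coefficient of Z_j.\<close>
      have "v $ j ^ d * ?W k v = of_nat d * (v $ j * (fps_nth (lam v) m * v $ j ^ (d - 1) * v $ k
         + (of_nat (d - 1) * v $ j ^ (d - 1 - 1) * fps_nth (Z v j) m * v $ k + v $ j ^ (d - 1) * fps_nth (Z v k) m)))
         - of_nat (d - 1) * (v $ k * (v $ j ^ (d - 1) * ?W j v))" for v
      proof -
        obtain d' where d': "d = Suc d'" using False by (cases d) auto
        show ?thesis unfolding d' by (cases d') (simp_all add: algebra_simps)
      qed
      then show ?thesis
        using homf_diff[OF homf_cmult[OF homf_mult[OF homf_coord[of j] mixed[OF jk]]] homf_cmult[OF homf_mult[OF homf_coord[of k] top[of j]]],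
            of "of_nat d" "of_nat (d - 1)"]
        by (simp add: add_ac)
    qed
  qed (use zero in auto)
qed

lemma fps_nth_prod_0: "fps_nth (prod f A) 0 = (\<Prod>a\<in>A. fps_nth (f a :: complex fps) 0)"
  by (induction A rule: infinite_finite_induct) auto

text \<open>The algebraic content of the family of curves: \<open>lam\<close> and \<open>Y\<close>
  are arbitrary functions of \<open>v\<close>, linked only by \<open>vanish\<close>, which says that
  lam(t) \<Phi>(Y(t)) has no coefficient beyond order \<open>q\<close>. Terms with |\<alpha>| > K
  are absent since \<open>Y\<close> has no constant term. The values at v = 0, where there is no
  curve, are conventions that make the homogeneous functions vanish there.\<close>

locale curve_family =
  fixes e :: "('n::finite \<Rightarrow> nat) \<Rightarrow> complex ^ 'm::finite" and q :: nat
    and lam :: "complex ^ 'n \<Rightarrow> complex fps" and Y :: "complex ^ 'n \<Rightarrow> 'n \<Rightarrow> complex fps"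
  assumes q: "q \<ge> 1" and inj_e: "inj_on e (expos_le q)" and indep_e: "vec.independent (e ` expos_le q)"
    and lam0: "fps_nth (lam v) 0 = 1" and lam1: "fps_nth (lam v) 1 = 0"
    and Y0: "fps_nth (Y v j) 0 = 0" and Y1: "fps_nth (Y v j) 1 = v $ j"
    and lam_zero: "lam 0 = 1" and Y_zero: "Y 0 j = 0"
    and vanish: "K > q \<Longrightarrow> (\<Sum>k\<le>K. \<Sum>\<alpha>\<in>expos k. fps_nth (lam v * mon \<alpha> (Y v)) K *s e \<alpha>) = 0"
begin

text \<open>Dividing by t gives constant term \<open>v\<close> and factors t^|\<alpha>| out of the
  monomial of exponent \<alpha> in \<open>Y\<close>, so that orders in t and degrees in
  \<open>v\<close> match.\<close>

definition Z :: "complex ^ 'n \<Rightarrow> 'n \<Rightarrow> complex fps" where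
  "Z v j = fps_shift 1 (Y v j)"

lemma Y_eq: "Y v j = fps_X * Z v j"
  by (rule fps_ext) (auto simp: Z_def Y0)

lemma Z0: "fps_nth (Z v j) 0 = v $ j"
  using Y1[of v j] by (simp add: Z_def)

lemma coeff_mon:
  assumes "\<alpha> \<in> expos k"
  shows "fps_nth (lam v * mon \<alpha> (Y v)) K = (if K < k then 0 else fps_nth (lam v * mon \<alpha> (Z v)) (K - k))"
proof -
  have "Y v = (\<lambda>i. fps_X * Z v i)" by (intro ext Y_eq)
  then have "mon \<alpha> (Y v) = fps_X ^ k * mon \<alpha> (Z v)"
    using assms by (simp only: mon_scale expos_def mem_Collect_eq)
  then have "lam v * mon \<alpha> (Y v) = fps_X ^ k * (lam v * mon \<alpha> (Z v))"
    by (simp only: mult.left_commute)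
  then show ?thesis by (simp only: fps_X_power_mult_nth)
qed

lemma coeff_mon_diag: "\<alpha> \<in> expos k \<Longrightarrow> fps_nth (lam v * mon \<alpha> (Y v)) k = mon \<alpha> (($) v)"
  by (simp add: coeff_mon lam0) (simp add: mon_def Z0 fps_nth_prod_0 fps_power_zeroth)

lemma dual_e:
  assumes "\<beta> \<in> expos_le q"
  obtains l where "\<And>\<alpha>. \<alpha> \<in> expos_le q \<Longrightarrow> dotp l (e \<alpha>) = (if \<alpha> = \<beta> then 1 else 0)"
  using ex_dual_vector[OF inj_e indep_e assms] by blast

text \<open>
  The coefficient of \<open>t\<^sup>d\<^sup>+\<^sup>m\<close> vanishes since \<open>d + m > q\<close>. Among its terms, only the one
  of index \<open>\<beta>\<close> involves the coefficients of order \<open>m\<close> of \<open>lam\<close> and \<open>Z\<close>.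
\<close>

lemma top_coeff_homf:
  assumes gl: "graded 0 m lam" and gZ: "\<And>j. graded 1 m (\<lambda>v. Z v j)"
    and \<beta>: "\<beta> \<in> expos d" and d: "d \<le> q" "d + m > q"
  shows "(\<lambda>v. fps_nth (lam v * mon \<beta> (Z v)) m) \<in> homf (d + m)"
proof -
  have \<beta>': "\<beta> \<in> expos_le q" using \<beta> d by (simp add: expos_def expos_le_def)
  obtain l where l: "\<And>\<alpha>. \<alpha> \<in> expos_le q \<Longrightarrow> dotp l (e \<alpha>) = (if \<alpha> = \<beta> then 1 else 0)"
    using dual_e[OF \<beta>'] by blast
  let ?c = "\<lambda>v \<alpha>. fps_nth (lam v * mon \<alpha> (Y v)) (d + m)"
  have "fps_nth (lam v * mon \<beta> (Z v)) m = - (\<Sum>k\<in>{q<..d+m}. \<Sum>\<alpha>\<in>expos k. ?c v \<alpha> * dotp l (e \<alpha>))" for v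
  proof -
    have "0 = dotp l (\<Sum>k\<le>d+m. \<Sum>\<alpha>\<in>expos k. ?c v \<alpha> *s e \<alpha>)"
      using vanish[OF d(2), of v] by simp
    also have "\<dots> = (\<Sum>k\<le>d+m. \<Sum>\<alpha>\<in>expos k. ?c v \<alpha> * dotp l (e \<alpha>))" by simp
    also have "{..d+m} = {..q} \<union> {q<..d+m}" using d by auto
    also have "(\<Sum>k\<in>{..q} \<union> {q<..d+m}. \<Sum>\<alpha>\<in>expos k. ?c v \<alpha> * dotp l (e \<alpha>)) =
       (\<Sum>k\<le>q. \<Sum>\<alpha>\<in>expos k. ?c v \<alpha> * dotp l (e \<alpha>)) + (\<Sum>k\<in>{q<..d+m}. \<Sum>\<alpha>\<in>expos k. ?c v \<alpha> * dotp l (e \<alpha>))"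
      by (rule sum.union_disjoint) auto
    also have "(\<Sum>k\<le>q. \<Sum>\<alpha>\<in>expos k. ?c v \<alpha> * dotp l (e \<alpha>)) = (\<Sum>\<alpha>\<in>expos_le q. ?c v \<alpha> * (if \<alpha> = \<beta> then 1 else 0))"
      unfolding sum_expos_le by (intro sum.cong refl) (simp add: l)
    also have "\<dots> = ?c v \<beta>" using \<beta>' by (simp add: finite_expos_le if_distrib[of "\<lambda>x. _ * x"] cong: if_cong)
    also have "\<dots> = fps_nth (lam v * mon \<beta> (Z v)) m" using coeff_mon[OF \<beta>] by simp
    finally show ?thesis by (simp add: eq_neg_iff_add_eq_0)
  qed
  \<comment> \<open>Beyond degree \<open>q\<close> nothing is known about
    \<open>dotp l (e \<alpha>)\<close>, but k > q \<ge> d puts these coefficients at order d + m - k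
    < m, where \<open>gl\<close> and \<open>gZ\<close> apply.\<close>
  moreover have "(\<lambda>v. ?c v \<alpha> * dotp l (e \<alpha>)) \<in> homf (d + m)" if "k \<in> {q<..d+m}" "\<alpha> \<in> expos k" for k \<alpha>
  proof -
    have "graded k m (\<lambda>v. lam v * mon \<alpha> (Z v))"
      using graded_mult[OF gl graded_mon[of m Z, OF gZ], of \<alpha>] that(2) by (simp add: expos_def)
    then have "(\<lambda>v. fps_nth (lam v * mon \<alpha> (Z v)) (d + m - k)) \<in> homf (k + (d + m - k))"
      by (rule graded_nth) (use that(1) d in auto)
    then have "(\<lambda>v. dotp l (e \<alpha>) * fps_nth (lam v * mon \<alpha> (Z v)) (d + m - k)) \<in> homf (d + m)"
      using that(1) by (intro homf_cmult) simp
    then show ?thesis using that by (simp add: coeff_mon mult.commute)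
  qed
  ultimately show ?thesis
    by (simp only:) (intro homf_uminus homf_sum, blast)
qed

lemma graded_all: "graded 0 (Suc m) lam \<and> (\<forall>j. graded 1 (Suc m) (\<lambda>v. Z v j))"
proof (induction m)
  case 0
  then show ?case
    by (auto simp: graded_def lam0 Z0 intro: homf_const homf_coord[unfolded One_nat_def])
next
  case (Suc m')
  define m where "m = Suc m'"
  have m: "m \<ge> 1" by (simp add: m_def)
  have gl: "graded 0 m lam" and gZ: "\<And>j. graded 1 m (\<lambda>v. Z v j)"
    using Suc by (auto simp: m_def)
  have zero: "fps_nth (Z 0 j) m = 0" "fps_nth (lam 0) m = 0" for j
    using m by (simp_all add: Z_def Y_zero lam_zero)
  note dir = top_coeff_direction[OF m gl gZ lam0 Z0 zero(1) top_coeff_homf[OF gl gZ]]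
  have Wq: "(\<lambda>v. v $ k * fps_nth (lam v) m + of_nat q * fps_nth (Z v k) m) \<in> homf (Suc m)" for k
    by (rule dir) (use m in auto)
  have "(\<lambda>v. fps_nth (lam v) m) \<in> homf m \<and> (\<forall>k. (\<lambda>v. fps_nth (Z v k) m) \<in> homf (Suc m))"
  \<comment> \<open>For m = 1 the condition d + m > q leaves only d = q; the normalization
    \<open>lam1\<close> then removes one unknown and \<open>q \<ge> 1\<close> allows
    division.\<close>
  proof (cases "m = 1")
    case True
    have "(\<lambda>v. fps_nth (Z v k) m) \<in> homf (Suc m)" for k
      using homf_cmult[OF Wq[of k], of "1 / of_nat q"] lam1 q True by simp
    then show ?thesis using True lam1 by simp
  next
    case False
    \<comment> \<open>For m \<ge> 2 also d = q - 1 is available. The difference of the two relations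
      isolates \<open>Z\<close>, after which v_k lam_m is a form for every k and v_k can be divided
      out.\<close>
    have Wq': "(\<lambda>v. v $ k * fps_nth (lam v) m + of_nat (q - 1) * fps_nth (Z v k) m) \<in> homf (Suc m)" for k
      by (rule dir) (use m False in auto)
    have Zm: "(\<lambda>v. fps_nth (Z v k) m) \<in> homf (Suc m)" for k
    proof -
      have "fps_nth (Z v k) m = (v $ k * fps_nth (lam v) m + of_nat q * fps_nth (Z v k) m)
         - (v $ k * fps_nth (lam v) m + of_nat (q - 1) * fps_nth (Z v k) m)" for v
        using q by (simp add: of_nat_diff algebra_simps)
      then show ?thesis using homf_diff[OF Wq Wq', of k k] by (simp only:)
    qed
    have "(\<lambda>v. v $ k ^ 1 * fps_nth (lam v) m) \<in> homf (m + 1)" for k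
      using homf_diff[OF Wq[of k] homf_cmult[OF Zm[of k]], of "of_nat q"] by simp
    then have "(\<lambda>v. fps_nth (lam v) m) \<in> homf m"
      by (rule homf_if_coord_power_mult) (use m zero in auto)
    then show ?thesis using Zm by blast
  qed
  then show ?case
    using gl gZ unfolding graded_def m_def by (auto simp: less_Suc_eq)
qed

lemma coeff_mon_homf:
  assumes "\<alpha> \<in> expos j"
  shows "(\<lambda>v. fps_nth (lam v * mon \<alpha> (Y v)) k) \<in> homf k"
proof (cases "k < j")
  case True
  then show ?thesis using assms by (simp add: coeff_mon)
next
  case False
  have "graded j (Suc k) (\<lambda>v. lam v * mon \<alpha> (Z v))"
    using graded_mult[OF conjunct1[OF graded_all] graded_mon, of k Z \<alpha>] graded_all[of k] assms
    by (simp add: expos_def)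
  then have "(\<lambda>v. fps_nth (lam v * mon \<alpha> (Z v)) (k - j)) \<in> homf (j + (k - j))"
    unfolding graded_def by simp
  then show ?thesis using assms False by (simp add: coeff_mon)
qed

definition p_coeff :: "nat \<Rightarrow> complex ^ 'n \<Rightarrow> complex ^ 'm" where
  "p_coeff k v = (\<Sum>j\<le>k. \<Sum>\<alpha>\<in>expos j. fps_nth (lam v * mon \<alpha> (Y v)) k *s e \<alpha>)"

text \<open>The homogenization, by the coordinate \<open>None\<close>, of the polynomial map sending
  t v to the point with parameter t on the lifted curve in direction \<open>v\<close>.\<close>

definition p :: "complex ^ 'n option \<Rightarrow> complex ^ 'm" where
  "p z = (\<Sum>k\<le>q. (z $ None ^ (q - k)) *s p_coeff k (\<chi> j. z $ Some j))"

lemma p_coeff_homf: "(\<lambda>v. p_coeff k v $ i) \<in> homf k"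
proof -
  have "(\<lambda>v. \<Sum>j\<le>k. \<Sum>\<alpha>\<in>expos j. fps_nth (lam v * mon \<alpha> (Y v)) k * e \<alpha> $ i) \<in> homf k"
    using homf_cmult[OF coeff_mon_homf] by (intro homf_sum) (simp add: mult.commute)
  then show ?thesis by (simp add: p_coeff_def)
qed

lemma p_homf: "(\<lambda>z. p z $ i) \<in> homf q"
proof -
  have "(\<lambda>z :: complex ^ 'n option. z $ None ^ (q - k) * p_coeff k (\<chi> j. z $ Some j) $ i) \<in> homf q" if "k \<in> {..q}" for k
  proof -
    have "(\<lambda>z :: complex ^ 'n option. p_coeff k (\<chi> j. z $ Some j) $ i) \<in> homf k"
      by (rule homf_subst[OF p_coeff_homf]) (simp add: homf_coord[unfolded One_nat_def])
    from homf_mult[OF homf_coord_power[of None "q - k"] this] show ?thesis using that by simp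
  qed
  then have "(\<lambda>z. \<Sum>k\<le>q. z $ None ^ (q - k) * p_coeff k (\<chi> j. z $ Some j) $ i) \<in> homf q"
    by (rule homf_sum)
  then show ?thesis by (simp add: p_def)
qed

lemma p_coeff_scale: "p_coeff k (t *s v) = t ^ k *s p_coeff k v"
  using homf_homogeneous[OF p_coeff_homf] by (simp add: vec_eq_iff)

lemma p_affine: "p (\<chi> j. case j of None \<Rightarrow> 1 | Some j \<Rightarrow> t * v $ j) = (\<Sum>k\<le>q. t ^ k *s p_coeff k v)"
proof -
  have "(\<chi> j. t * v $ j) = t *s v" by (simp add: vec_eq_iff)
  then show ?thesis by (simp add: p_def p_coeff_scale)
qed

text \<open>In \<open>p_coeff k\<close> the vectors with |\<alpha>| = k enter with coefficient
  exactly the monomial in \<open>v\<close>, by \<open>lam0\<close> and \<open>Z0\<close>, and the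
  others have lower degree. Induction on k removes the lower ones, and the independence of monomials
  extracts each vector.\<close>

lemma e_in_span_p: "\<alpha> \<in> expos_le q \<Longrightarrow> e \<alpha> \<in> vec.span (range p)"
proof -
  have pc: "p_coeff k v \<in> vec.span (range p)" if "k \<le> q" for k v
  proof (rule vec_poly_coeff_in_subspace[OF vec.subspace_span _ that])
    show "(\<Sum>k\<le>q. t ^ k *s p_coeff k v) \<in> vec.span (range p)" for t
      unfolding p_affine[symmetric] by (rule vec.span_base) simp
  qed
  have "e \<alpha> \<in> vec.span (range p)" if "\<alpha> \<in> expos k" "k \<le> q" for k \<alpha>
    using that
  proof (induction k arbitrary: \<alpha> rule: less_induct)
    case (less k)
    show ?case
    proof (rule mon_coeff_in_subspace[OF vec.subspace_span finite_expos _ less.prems(1)])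
      fix z :: "'n \<Rightarrow> complex"
      define v :: "complex ^ 'n" where "v = (\<chi> j. z j)"
      then have vz: "($) v = z" by (simp add: fun_eq_iff)
      have "(\<Sum>j<k. \<Sum>\<alpha>\<in>expos j. fps_nth (lam v * mon \<alpha> (Y v)) k *s e \<alpha>) \<in> vec.span (range p)"
        using less by (intro vec.span_sum vec.span_scale) auto
      then have "p_coeff k v - (\<Sum>j<k. \<Sum>\<alpha>\<in>expos j. fps_nth (lam v * mon \<alpha> (Y v)) k *s e \<alpha>) \<in> vec.span (range p)"
        using pc[OF less.prems(2)] by (intro vec.span_diff)
      also have "p_coeff k v - (\<Sum>j<k. \<Sum>\<alpha>\<in>expos j. fps_nth (lam v * mon \<alpha> (Y v)) k *s e \<alpha>)
         = (\<Sum>\<alpha>\<in>expos k. fps_nth (lam v * mon \<alpha> (Y v)) k *s e \<alpha>)"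
        by (simp add: p_coeff_def lessThan_Suc_atMost[symmetric])
      also have "\<dots> = (\<Sum>\<alpha>\<in>expos k. mon \<alpha> z *s e \<alpha>)"
        by (intro sum.cong refl) (simp add: coeff_mon_diag vz)
      finally show "(\<Sum>\<alpha>\<in>expos k. mon \<alpha> z *s e \<alpha>) \<in> vec.span (range p)" .
    qed
  qed
  then show "\<alpha> \<in> expos_le q \<Longrightarrow> e \<alpha> \<in> vec.span (range p)"
    by (auto simp: expos_le_eq_Union)
qed

lemma card_le_dim_span_p: "card (expos q :: ('n option \<Rightarrow> nat) set) \<le> vec.dim (range p)"
proof -
  have "card (expos q :: ('n option \<Rightarrow> nat) set) \<le> card (e ` expos_le q)"
    using card_expos_option[of q] by (simp add: card_image[OF inj_e])
  also have "\<dots> = vec.dim (e ` expos_le q)"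
    using indep_e by (simp add: vec.dim_eq_card_independent)
  also have "\<dots> \<le> vec.dim (vec.span (range p))"
    using e_in_span_p by (intro vec.dim_subset) auto
  finally show ?thesis by simp
qed

end

section \<open>Veronese maps and rational normal curves\<close>

lemma ex_hpt: obtains z where "z \<noteq> 0" "P = hpt z"
proof -
  have "line_of P \<in> {vec.span {v} |v. v \<noteq> 0}" by (rule line_of)
  then obtain v where "v \<noteq> 0" "line_of P = vec.span {v}" by auto
  then show ?thesis using that[of v] by (metis hpt_def line_of_inverse)
qed

lemma hpt_smult: "c \<noteq> 0 \<Longrightarrow> hpt (c *s v) = hpt v"
proof -
  assume c: "c \<noteq> 0"
  have "range (\<lambda>k. k *s (c *s v)) = range (\<lambda>k. k *s v)"
  proof (intro set_eqI iffI)
    fix w assume "w \<in> range (\<lambda>k. k *s v)"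
    then obtain k where "w = (k / c) *s (c *s v)" using c by auto
    then show "w \<in> range (\<lambda>k. k *s (c *s v))" by blast
  qed auto
  then have "vec.span {c *s v} = vec.span {v}" by (simp add: vec.span_singleton)
  then show ?thesis by (simp add: hpt_def)
qed

lemma hpt_eq_imp:
  assumes "v \<noteq> 0" "w \<noteq> 0" "hpt v = hpt w"
  obtains c where "c \<noteq> 0" "v = c *s w"
proof -
  have "vec.span {v} = vec.span {w}"
    using assms by (metis line_of_hpt)
  then have "v \<in> vec.span {w}" using vec.span_base[of v "{v}"] by simp
  then obtain c where "v = c *s w" by (auto simp: vec.span_singleton)
  then show ?thesis using that assms(1) by (metis vec.scale_zero_left)
qed

lemma in_line_of_hpt: "v \<noteq> 0 \<Longrightarrow> v \<in> line_of (hpt v)"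
  by (simp add: line_of_hpt vec.span_base)

lemma open_hpt_vimage: "open U \<Longrightarrow> open {v. v \<noteq> 0 \<and> hpt v \<in> U}"
  by (simp add: open_cproj_def)

lemma continuous_on_hpt: "continuous_on {v. v \<noteq> 0} hpt"
  unfolding continuous_on_open_vimage[OF open_hpt_vimage[OF open_UNIV, simplified]]
  using open_hpt_vimage by (auto simp: vimage_def Int_def conj_commute)

lemma lin_span_proj_subspace:
  assumes "vec.subspace L"
  shows "lin_span (proj_subspace L) = L"
proof
  show "lin_span (proj_subspace L) \<subseteq> L"
    unfolding lin_span_def proj_subspace_def by (rule vec.span_minimal[OF _ assms]) auto
  show "L \<subseteq> lin_span (proj_subspace L)"
  proof
    fix v assume v: "v \<in> L"
    show "v \<in> lin_span (proj_subspace L)"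
    proof (cases "v = 0")
      case False
      have "line_of (hpt v) \<subseteq> L"
        unfolding line_of_hpt[OF False] by (rule vec.span_minimal[OF _ assms]) (use v in auto)
      then show ?thesis unfolding lin_span_def proj_subspace_def
        using in_line_of_hpt[OF False] by (intro vec.span_base) blast
    qed (simp add: lin_span_def vec.span_zero)
  qed
qed

lemma mon_functions_independent:
  assumes "finite A" "\<And>z. (\<Sum>\<alpha>\<in>A. c \<alpha> * mon \<alpha> (($) (z :: complex ^ 'k::finite))) = 0" "\<alpha> \<in> A"
  shows "c \<alpha> = 0"
proof -
  have "(axis undefined (c \<alpha>) :: complex ^ 1) \<in> {0}"
  proof (rule mon_coeff_in_subspace[OF _ assms(1) _ assms(3), where x = "\<lambda>\<alpha>. axis undefined (c \<alpha>)"])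
    fix z :: "'k \<Rightarrow> complex"
    have "(\<Sum>\<alpha>\<in>A. mon \<alpha> z * c \<alpha>) = 0"
      using assms(2)[of "\<chi> j. z j"] by (simp add: mon_def mult.commute)
    then show "(\<Sum>\<alpha>\<in>A. mon \<alpha> z *s (axis undefined (c \<alpha>) :: complex ^ 1)) \<in> {0}"
      by (simp add: vec_eq_iff axis_def)
  qed (simp add: vec.subspace_def)
  then show ?thesis by (simp add: axis_eq_0_iff)
qed

text \<open>Completeness of the linear system: hyperplane sections of a Veronese variety realize
  every form of degree \<open>q\<close>. This is what makes the embedding invertible by linear
  functionals.\<close>

lemma form_functional:
  fixes c :: "complex ^ 'k::finite \<Rightarrow> complex ^ 'm::finite"
  assumes "inj_on e B" "vec.independent (e ` B)" "\<And>z. c z = (\<Sum>s\<in>B. s z *s e s)"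
    and "f \<in> cfun.span B"
  obtains l where "\<And>z. dotp l (c z) = f z"
proof -
  have finB: "finite B"
    using assms(1,2) vec.finiteI_independent finite_imageD by blast
  from assms(4) have "\<exists>l. \<forall>z. dotp l (c z) = f z"
  proof (induction rule: cfun.span_induct_alt)
    case base
    show ?case by (rule exI[of _ 0]) simp
  next
    case (step k b y)
    then obtain l where l: "\<And>z. dotp l (c z) = y z" by blast
    obtain l' where l': "\<And>s. s \<in> B \<Longrightarrow> dotp l' (e s) = (if s = b then 1 else 0)"
      using ex_dual_vector[OF assms(1,2) step(1)] by blast
    have "dotp l' (c z) = b z" for z
    proof -
      have "dotp l' (c z) = (\<Sum>s\<in>B. s z * (if s = b then 1 else 0))"
        unfolding assms(3) by (simp add: l')
      then show ?thesis using finB step(1) by (simp add: if_distrib[of "\<lambda>x. _ * x"] cong: if_cong)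
    qed
    then show ?case by (intro exI[of _ "k *s l' + l"]) (simp add: l)
  qed
  then show ?thesis using that by blast
qed

text \<open>A map given by forms of degree \<open>q\<close> has one coefficient vector per monomial.
  If its values span at least that many dimensions, these vectors are independent, so the monomials
  serve as the basis \<open>B\<close> of the forms.\<close>

lemma veronese_embedding_if_dim:
  fixes p :: "complex ^ ('n::finite option) \<Rightarrow> complex ^ ('m::finite option)"
  assumes p: "\<And>i. (\<lambda>z. p z $ i) \<in> homf q"
    and dim: "card (expos q :: ('n option \<Rightarrow> nat) set) \<le> vec.dim (range p)"
  shows "\<forall>f\<in>homf q. \<exists>l. \<forall>z. dotp l (p z) = f z" (is ?A)
    and "\<exists>\<nu>. veronese_embedding q \<nu> \<and> (\<forall>z. z \<noteq> 0 \<longrightarrow> p z \<noteq> 0 \<and> \<nu> (hpt z) = hpt (p z))" (is ?B)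
proof -
  have "\<exists>a. \<forall>z. p z $ i = (\<Sum>\<alpha>\<in>expos q. a \<alpha> * mon \<alpha> (($) z))" for i
    using homf_coeffs[OF p[of i]] by metis
  then obtain a where a: "\<And>i z. p z $ i = (\<Sum>\<alpha>\<in>expos q. a i \<alpha> * mon \<alpha> (($) z))" by metis
  define \<epsilon> :: "_ \<Rightarrow> complex ^ ('m option)" where "\<epsilon> \<alpha> = (\<chi> i. a i \<alpha>)" for \<alpha>
  have p_eq: "p z = (\<Sum>\<alpha>\<in>expos q. mon \<alpha> (($) z) *s \<epsilon> \<alpha>)" for z
    by (simp add: vec_eq_iff a \<epsilon>_def mult.commute)
  have sub: "range p \<subseteq> vec.span (\<epsilon> ` expos q)"
    unfolding p_eq by (intro image_subsetI vec.span_sum vec.span_scale vec.span_base imageI)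
  note \<epsilon> = independent_if_card_le_dim[OF finite_expos sub dim]
  define F :: "('n option \<Rightarrow> nat) \<Rightarrow> complex ^ ('n option) \<Rightarrow> complex" where "F \<alpha> z = mon \<alpha> (($) z)" for \<alpha> z
  have injF: "inj_on F (expos q)"
  proof (rule inj_onI, rule ccontr)
    fix \<alpha> \<beta> assume h: "\<alpha> \<in> expos q" "\<beta> \<in> expos q" "F \<alpha> = F \<beta>" "\<alpha> \<noteq> \<beta>"
    have "(\<Sum>\<gamma>\<in>{\<alpha>,\<beta>}. (if \<gamma> = \<alpha> then 1 else -1) * mon \<gamma> (($) z)) = (0 :: complex)" for z :: "complex ^ ('n option)"
      using h(4) fun_cong[OF h(3), of z] by (simp add: F_def)
    from mon_functions_independent[OF _ this, of \<alpha>] show False by simp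
  qed
  define B where "B = F ` expos q"
  define e where "e s = \<epsilon> (inv_into (expos q) F s)" for s
  have eF: "e (F \<alpha>) = \<epsilon> \<alpha>" if "\<alpha> \<in> expos q" for \<alpha>
    using that injF by (simp add: e_def)
  have span: "cfun.span B = homf q"
    by (simp add: homf_eq_span_mon B_def F_def[abs_def])
  have eB: "e ` B = \<epsilon> ` expos q" by (auto simp: B_def eF image_image)
  have inj: "inj_on e B"
    unfolding B_def using \<epsilon>(1) by (auto simp: inj_on_def eF)
  have ind: "vec.independent (e ` B)" using \<epsilon>(2) by (simp add: eB)
  have p_B: "p z = (\<Sum>s\<in>B. s z *s e s)" for z
    unfolding B_def p_eq by (subst sum.reindex[OF injF]) (simp add: eF F_def)
  have indB: "cfun.independent B"
    unfolding cfun.independent_explicit_finite_subsets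
  proof (intro allI impI ballI)
    fix S u v assume h: "S \<subseteq> B" "finite S" "(\<Sum>v\<in>S. (\<lambda>z. u v * v z)) = 0" "v \<in> S"
    obtain T where T: "T \<subseteq> expos q" "S = F ` T" using h(1) unfolding B_def by (meson subset_imageE)
    have injT: "inj_on F T" using injF T(1) by (rule inj_on_subset)
    obtain \<alpha> where \<alpha>: "\<alpha> \<in> T" "v = F \<alpha>" using h(4) T(2) by auto
    have "(\<Sum>\<alpha>\<in>T. u (F \<alpha>) * mon \<alpha> (($) z)) = 0" for z
    proof -
      have "(\<Sum>v\<in>S. (\<lambda>z. u v * v z)) z = (\<Sum>v\<in>S. u v * v z)"
        by (induction S rule: infinite_finite_induct) auto
      then show ?thesis using h(3) unfolding T(2) by (simp add: sum.reindex[OF injT] F_def)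
    qed
    from mon_functions_independent[OF _ this \<alpha>(1)] show "u v = 0"
      using T(1) finite_expos finite_subset \<alpha>(2) by blast
  qed
  show A: ?A
    using form_functional[OF inj ind p_B, unfolded span] by metis
  have nz: "p z \<noteq> 0" if z: "z \<noteq> 0" for z
  proof
    assume "p z = 0"
    obtain j where j: "z $ j \<noteq> 0" using z by (auto simp: vec_eq_iff)
    obtain l where "\<forall>z. dotp l (p z) = z $ j ^ q" using bspec[OF A homf_coord_power[of j q]] by blast
    then show False using \<open>p z = 0\<close> j by (metis dotp_simps(1) power_not_zero)
  qed
  \<comment> \<open>The chosen representative is irrelevant because \<open>p\<close> multiplies by
    c^q when its argument is scaled by c.\<close>
  define \<nu> :: "'n cproj \<Rightarrow> 'm cproj" where "\<nu> P = hpt (p (SOME z. z \<noteq> 0 \<and> P = hpt z))" for P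
  have \<nu>: "\<nu> (hpt z) = hpt (p z)" if "z \<noteq> 0" for z
  proof -
    define w where "w = (SOME w. w \<noteq> 0 \<and> hpt z = hpt w)"
    have "\<exists>w. w \<noteq> 0 \<and> hpt z = hpt w" using that by blast
    from someI_ex[OF this] have w: "w \<noteq> 0" "hpt w = hpt z" unfolding w_def by auto
    obtain c where c: "c \<noteq> 0" "w = c *s z" by (rule hpt_eq_imp[OF w(1) \<open>z \<noteq> 0\<close> w(2)])
    have "p w = c ^ q *s p z" using homf_homogeneous[OF p] by (simp add: c vec_eq_iff)
    then show ?thesis using c(1) by (simp add: \<nu>_def w_def[symmetric] hpt_smult)
  qed
  have lines: "line_of (\<nu> (hpt z)) = vec.span {p z}" if "z \<noteq> 0" for z
    using \<nu>[OF that] nz[OF that] by (simp add: line_of_hpt)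
  have "lin_span (range \<nu>) = vec.span (\<epsilon> ` expos q)"
  proof
    have "line_of (\<nu> P) \<subseteq> vec.span (\<epsilon> ` expos q)" for P
    proof -
      obtain z where z: "z \<noteq> 0" "P = hpt z" by (rule ex_hpt)
      show ?thesis unfolding z(2) lines[OF z(1)] using sub by (intro vec.span_minimal) auto
    qed
    then show "lin_span (range \<nu>) \<subseteq> vec.span (\<epsilon> ` expos q)"
      unfolding lin_span_def by (intro vec.span_minimal) auto
    have pin: "p z \<in> lin_span (range \<nu>)" if "z \<noteq> 0" for z
      unfolding lin_span_def using lines[OF that] vec.span_base[of "p z" "{p z}"]
      by (intro vec.span_base) blast
    have p_in: "p z \<in> lin_span (range \<nu>)" for z
    \<comment> \<open>The points of \<nu> only see z \<noteq> 0, but extracting coefficients needs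
      all z. At 0 the map vanishes for q > 0 and agrees with its other values for q = 0.\<close>
    proof (cases "q = 0 \<or> z \<noteq> 0")
      case True
      show ?thesis
      proof (cases "z = 0")
        case z0: True
        then have q0: "q = 0" using True by simp
        have "p 0 = p (axis None 1)"
          using homf_homogeneous[OF p, of 0 "axis None 1"] q0 by (simp add: vec_eq_iff)
        then have "p z = p (axis None 1)" using z0 by simp
        then show ?thesis using pin[of "axis None 1"] by (simp add: axis_eq_0_iff)
      qed (rule pin)
    next
      case False
      then have "0 ^ q = (0 :: complex)" by simp
      then have "p 0 $ j = 0" for j
        using homf_homogeneous[OF p, of 0 0 j] by (metis mult_zero_left vec.scale_zero_right)
      then have "p 0 = 0" by (simp add: vec_eq_iff)
      then have "p z = 0" using False by simp
      then show ?thesis by (simp add: lin_span_def vec.span_zero)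
    qed
    then have pz: "(\<Sum>\<alpha>\<in>expos q. mon \<alpha> z *s \<epsilon> \<alpha>) \<in> lin_span (range \<nu>)" for z
    proof -
      have "($) (\<chi> j. z j) = z" by (simp add: fun_eq_iff)
      from p_eq[of "\<chi> j. z j", unfolded this] show ?thesis
        using p_in[of "\<chi> j. z j"] by simp
    qed
    have "\<epsilon> \<alpha> \<in> lin_span (range \<nu>)" if "\<alpha> \<in> expos q" for \<alpha>
      by (rule mon_coeff_in_subspace[OF _ finite_expos pz that]) (simp add: lin_span_def)
    then show "vec.span (\<epsilon> ` expos q) \<subseteq> lin_span (range \<nu>)"
      unfolding lin_span_def by (intro vec.span_minimal) auto
  qed
  then have "veronese_embedding q \<nu>"
    unfolding veronese_embedding_def forms_eq_homf
    using indB span inj ind lines by (intro exI[of _ B] exI[of _ e]) (simp add: eB p_B)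
  then show ?B using nz \<nu> by blast
qed

text \<open>By a + t (b + c a) = (1 + c t) (a + (t / (1 + c t)) b), adding a multiple of
  \<open>a\<close> to the direction is a Moebius change of parameter fixing 0 to first order,
  together with multiplication by (1 + c t)^q. The latter contributes q c f(a).\<close>

lemma smult_poly_line_derivative:
  fixes f :: "complex ^ 'k::finite \<Rightarrow> complex"
  assumes f: "f \<in> homf q" and g: "\<And>t. f (a + t *s b) = poly g t"
    and h: "\<And>t. f (a + t *s (b + c *s a)) = poly h t"
  shows "coeff h 1 = coeff g 1 + of_nat q * c * coeff g 0"
proof -
  have ev: "eventually (\<lambda>t. 1 + c * t \<noteq> 0) (nhds 0)"
  proof -
    have "((\<lambda>t. 1 + c * t) \<longlongrightarrow> 1 + c * 0) (nhds 0)" by (intro tendsto_intros filterlim_ident)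
    then show ?thesis by (intro tendsto_imp_eventually_ne) auto
  qed
  have eq: "poly h t = (1 + c * t) ^ q * poly g (t / (1 + c * t))" if "1 + c * t \<noteq> 0" for t
  proof -
    have "a + t *s (b + c *s a) = (1 + c * t) *s (a + (t / (1 + c * t)) *s b)"
    proof -
      have u: "(1 + c * t) * (t / (1 + c * t)) = t" using that by simp
      have "a + t *s (b + c *s a) = (1 + c * t) *s a + ((1 + c * t) * (t / (1 + c * t))) *s b"
        unfolding u by (simp add: vec_eq_iff algebra_simps)
      then show ?thesis by (simp only: vec.scale_right_distrib vec.scale_scale)
    qed
    then have "poly h t = f ((1 + c * t) *s (a + (t / (1 + c * t)) *s b))"
      using h[of t] by (simp only:)
    then show ?thesis by (simp only: homf_homogeneous[OF f] g)
  qed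
  have deriv: "((\<lambda>t. (1 + c * t) ^ q * poly g (t / (1 + c * t))) has_field_derivative
      of_nat q * c * poly g 0 + poly (pderiv g) 0) (at 0)"
  proof -
    have 1: "((\<lambda>t. (1 + c * t) ^ q) has_field_derivative of_nat q * c) (at 0)"
      by (auto intro!: derivative_eq_intros)
    have 2: "((\<lambda>t. t / (1 + c * t)) has_field_derivative 1) (at 0)"
      by (auto intro!: derivative_eq_intros)
    have 3: "((\<lambda>t. poly g (t / (1 + c * t))) has_field_derivative poly (pderiv g) 0 * 1) (at 0)"
      by (rule DERIV_chain2[OF _ 2]) (use poly_DERIV[of g 0] in simp)
    from DERIV_mult[OF 1 3] show ?thesis by (simp add: add.commute mult.commute)
  qed
  have "eventually (\<lambda>t. (1 + c * t) ^ q * poly g (t / (1 + c * t)) = poly h t) (nhds 0)"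
    using ev by eventually_elim (simp add: eq)
  from iffD1[OF DERIV_cong_ev[OF refl this refl] deriv]
  have "(poly h has_field_derivative of_nat q * c * poly g 0 + poly (pderiv g) 0) (at 0)" .
  then have "poly (pderiv h) 0 = of_nat q * c * poly g 0 + poly (pderiv g) 0"
    using poly_DERIV DERIV_unique by blast
  then show ?thesis by (simp add: poly_0_coeff_0 coeff_pderiv)
qed

text \<open>
  Moving the point at infinity of the parameter line, one can make the first-order term of the
  chosen coordinate of the polynomial parametrization vanish.
\<close>

lemma rational_normal_curve_parametrization:
  fixes C :: "'m::finite cproj set"
  assumes C: "rational_normal_curve q C" "x \<in> C" and q: "q \<ge> 1" and x: "x \<in> affine_chart i"
  obtains P :: "complex \<Rightarrow> complex ^ ('m option)" and g :: "'m option \<Rightarrow> complex poly" and l0 l1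
  where "\<And>j. degree (g j) \<le> q" "\<And>t j. P t $ j = poly (g j) t" "\<And>t. P t \<noteq> 0" "\<And>t. hpt (P t) \<in> C"
    "hpt (P 0) = x" "P 0 $ i \<noteq> 0" "coeff (g i) 1 = 0"
    "\<And>t. dotp l0 (P t) = 1" "\<And>t. dotp l1 (P t) = t"
proof -
  from C(1) obtain \<nu> :: "1 cproj \<Rightarrow> 'm cproj" where \<nu>: "veronese_embedding q \<nu>" "C = range \<nu>"
    unfolding rational_normal_curve_def veronese_variety_def by blast
  from \<nu>(1) obtain B :: "(complex ^ (1 option) \<Rightarrow> complex) set" and e where
    B: "cfun.span B = homf q" "inj_on e B" "vec.independent (e ` B)"
      "\<And>z. z \<noteq> 0 \<Longrightarrow> line_of (\<nu> (hpt z)) = vec.span {\<Sum>s\<in>B. s z *s (e s :: complex ^ ('m option))}"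
    unfolding veronese_embedding_def forms_eq_homf by blast
  define c where "c z = (\<Sum>s\<in>B. s z *s e s)" for z
  have c_homf: "(\<lambda>z. c z $ j) \<in> homf q" for j
  proof -
    have "s \<in> homf q" if "s \<in> B" for s using that B(1) cfun.span_base by blast
    then have "(\<lambda>z. \<Sum>s\<in>B. e s $ j * s z) \<in> homf q" by (intro homf_sum homf_cmult)
    then show ?thesis by (simp add: c_def mult.commute)
  qed
  have func: "\<exists>l. \<forall>z. dotp l (c z) = f z" if "f \<in> homf q" for f
    using form_functional[OF B(2,3) c_def, of f] that B(1) by metis
  have cz: "c z \<noteq> 0" "\<nu> (hpt z) = hpt (c z)" if "z \<noteq> 0" for z
  proof -
    obtain w where w: "w \<noteq> 0" "\<nu> (hpt z) = hpt w" by (rule ex_hpt)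
    then have "w \<in> vec.span {c z}" using B(4)[OF that] in_line_of_hpt[of w] by (simp add: c_def)
    then obtain k where k: "w = k *s c z" by (auto simp: vec.span_singleton)
    then show "c z \<noteq> 0" using w(1) by auto
    have "k \<noteq> 0" using k w(1) by auto
    then show "\<nu> (hpt z) = hpt (c z)" using w(2) k by (simp add: hpt_smult)
  qed
  from C(2) \<nu>(2) obtain Q where Q: "x = \<nu> Q" by blast
  obtain z0 where z0: "z0 \<noteq> 0" "Q = hpt z0" by (rule ex_hpt)
  define a where "a = z0 $ None"
  define b where "b = z0 $ Some 1"
  have ab: "a \<noteq> 0 \<or> b \<noteq> 0"
  proof (rule ccontr)
    assume "\<not> ?thesis"
    then have "z0 $ j = 0" for j by (metis a_def b_def num1_eq1 option.exhaust)
    then show False using z0(1) by (simp add: vec_eq_iff)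
  qed
  define D where "D = a * cnj a + b * cnj b"
  have D: "D \<noteq> 0"
  proof -
    have "Re D = norm a ^ 2 + norm b ^ 2"
      unfolding D_def complex_norm_square[symmetric] by simp
    moreover have "norm a ^ 2 + norm b ^ 2 > 0" using ab
      by (metis add_nonneg_pos add_pos_nonneg zero_le_power2 zero_less_norm_iff zero_less_power)
    ultimately show ?thesis by auto
  qed
  \<comment> \<open>A vector orthogonal to \<open>z0\<close>, so that the determinant of the pair is
    D = |a|^2 + |b|^2, which is nonzero.\<close>
  define z1 :: "complex ^ (1 option)" where "z1 = (\<chi> j. case j of None \<Rightarrow> - cnj b | Some _ \<Rightarrow> cnj a)"
  have "\<exists>g. degree g \<le> q \<and> (\<forall>t. c (z0 + t *s z1) $ i = poly g t)"
    using homf_line[OF c_homf] .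
  then obtain g0 where g0: "\<And>t. c (z0 + t *s z1) $ i = poly g0 t" by blast
  have ci: "c z0 $ i \<noteq> 0"
  proof -
    have "x = hpt (c z0)" using Q z0 cz(2) by simp
    then have "line_of x = vec.span {c z0}" using line_of_hpt[OF cz(1)[OF z0(1)]] by simp
    then show ?thesis using x unfolding affine_chart_def by (auto simp: vec.span_singleton)
  qed
  have g00: "coeff g0 0 = c z0 $ i" using g0[of 0] by (simp add: poly_0_coeff_0)
  \<comment> \<open>The solution of the linear equation of \<open>smult_poly_line_derivative\<close>
    that cancels the first-order term of coordinate \<open>i\<close>.\<close>
  define k where "k = - coeff g0 1 / (of_nat q * coeff g0 0)"
  define w where "w = z1 + k *s z0"
  have "\<exists>g. degree g \<le> q \<and> (\<forall>t. c (z0 + t *s w) $ j = poly g t)" for j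
    using homf_line[OF c_homf] .
  then obtain g where g: "\<And>j. degree (g j) \<le> q" "\<And>j t. c (z0 + t *s w) $ j = poly (g j) t" by metis
  \<comment> \<open>\<open>u0\<close> and \<open>u1\<close> are the coordinates dual to
    \<open>z0\<close>, \<open>z1\<close>; with respect to \<open>z0\<close>, \<open>w\<close> they
    become u0 - k u1 and u1, with values 1 and t on the parametrized line.\<close>
  define u0 where "u0 z = (z $ None * cnj a + z $ Some 1 * cnj b) / D" for z :: "complex ^ (1 option)"
  define u1 where "u1 z = (a * z $ Some 1 - b * z $ None) / D" for z :: "complex ^ (1 option)"
  have u1: "u1 \<in> homf 1"
  proof -
    have "(\<lambda>z. (a / D) * z $ Some 1 - (b / D) * z $ None) \<in> homf 1"
      by (intro homf_diff homf_cmult homf_coord)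
    then show ?thesis by (simp add: u1_def[abs_def] diff_divide_distrib)
  qed
  have u0: "(\<lambda>z. u0 z - k * u1 z) \<in> homf 1"
  proof -
    have "(\<lambda>z. ((cnj a / D) * z $ None + (cnj b / D) * z $ Some 1) - k * u1 z) \<in> homf 1"
      by (intro homf_diff homf_add homf_cmult homf_coord u1)
    then show ?thesis by (simp add: u0_def add_divide_distrib mult.commute)
  qed
  have val1: "u1 (z0 + t *s w) = t" for t
  proof -
    have "u1 (z0 + t *s w) = t * D / D"
      unfolding u1_def by (rule arg_cong[of _ _ "\<lambda>x. x / D"])
        (simp add: w_def z1_def a_def[symmetric] b_def[symmetric] D_def algebra_simps)
    then show ?thesis using D by simp
  qed
  have val0: "u0 (z0 + t *s w) - k * u1 (z0 + t *s w) = 1" for t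
  proof -
    have "u0 (z0 + t *s w) = (1 + k * t) * D / D"
      unfolding u0_def by (rule arg_cong[of _ _ "\<lambda>x. x / D"])
        (simp add: w_def z1_def a_def[symmetric] b_def[symmetric] D_def algebra_simps)
    then show ?thesis using D by (simp add: val1)
  qed
  obtain l0 where l0: "\<And>z. dotp l0 (c z) = (u0 z - k * u1 z) ^ q"
    using func[of "\<lambda>z. (u0 z - k * u1 z) ^ q"] homf_power[OF u0, of q] by auto
  have "(\<lambda>z. (u0 z - k * u1 z) ^ (q - 1) * u1 z) \<in> homf q"
    using homf_mult[OF homf_power[OF u0, of "q - 1"] u1] q by simp
  from func[OF this] obtain l1 where l1: "\<And>z. dotp l1 (c z) = (u0 z - k * u1 z) ^ (q - 1) * u1 z"
    by blast
  have nz: "z0 + t *s w \<noteq> 0" for t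
  proof
    assume "z0 + t *s w = 0"
    then show False using val0[of t] by (simp add: u0_def u1_def)
  qed
  show ?thesis
  proof (rule that[of g "\<lambda>t. c (z0 + t *s w)" l0 l1])
    show "hpt (c (z0 + t *s w)) \<in> C" for t
      using cz(2)[OF nz[of t], symmetric] \<nu>(2) by simp
    show "hpt (c (z0 + 0 *s w)) = x" using Q z0 cz(2) by simp
    have "coeff (g i) 1 = coeff g0 1 + of_nat q * k * coeff g0 0"
      by (rule smult_poly_line_derivative[OF c_homf g0]) (use g(2)[of _ i] in \<open>simp add: w_def\<close>)
    then show "coeff (g i) 1 = 0" using q ci g00 by (simp add: k_def)
    show "dotp l0 (c (z0 + t *s w)) = 1" for t by (simp add: l0 val0)
    show "dotp l1 (c (z0 + t *s w)) = t" for t using val0[of t] by (simp add: l1 val1)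
  qed (use g ci cz(1) nz in auto)
qed

section \<open>Charts and lifted curves\<close>

text \<open>Differentiability is lifted through a map whose derivative at the point is the identity,
  without constructing a local inverse: continuity of \<open>w\<close> brings its increments into
  the range where \<open>F\<close> is close to the identity.\<close>

lemma has_derivative_lift:
  fixes F :: "'b::real_normed_vector \<Rightarrow> 'b"
  assumes F: "(F has_derivative (\<lambda>h. h)) (at (w t0))"
    and FW: "((\<lambda>t. F (w t)) has_derivative D) (at t0)" and cont: "isCont w t0"
  shows "(w has_derivative D) (at t0)"
  unfolding has_derivative_at_alt
proof (intro conjI allI impI)
  show bl: "bounded_linear D" using FW by (rule has_derivative_bounded_linear)
  obtain K where K: "K > 0" "\<And>h. norm (D h) \<le> norm h * K"
    using bounded_linear.pos_bounded[OF bl] by blast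
  fix e :: real assume e: "e > 0"
  \<comment> \<open>The bound 1/2 gives |a| \<le> 2 |b| and hence |a| \<le> (2 K + 1) h for the
    increments below; the two errors then add up to at most e' (2 K + 2) h.\<close>
  define e' where "e' = min (1 / 2) (e / (2 * K + 3))"
  have e': "e' > 0" "e' \<le> 1 / 2" "e' * (2 * K + 3) \<le> e"
  proof -
    have K3: "2 * K + 3 > 0" using K(1) by simp
    show "e' > 0" using e K3 by (auto simp: e'_def)
    show "e' \<le> 1 / 2" unfolding e'_def by (rule min.cobounded1)
    have "e' \<le> e / (2 * K + 3)" by (simp add: e'_def)
    then show "e' * (2 * K + 3) \<le> e" by (simp only: pos_le_divide_eq[OF K3])
  qed
  obtain d1 where d1: "d1 > 0" "\<And>y. norm (y - w t0) < d1 \<Longrightarrow> norm (F y - F (w t0) - (y - w t0)) \<le> e' * norm (y - w t0)"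
    using F e'(1) unfolding has_derivative_at_alt by blast
  obtain d2 where d2: "d2 > 0" "\<And>t. norm (t - t0) < d2 \<Longrightarrow> norm (F (w t) - F (w t0) - D (t - t0)) \<le> e' * norm (t - t0)"
    using FW e'(1) unfolding has_derivative_at_alt by blast
  obtain d3 where d3: "d3 > 0" "\<And>t. norm (t - t0) < d3 \<Longrightarrow> norm (w t - w t0) < d1"
    using cont d1(1) unfolding continuous_at_eps_delta dist_norm by blast
  show "\<exists>d>0. \<forall>t. norm (t - t0) < d \<longrightarrow> norm (w t - w t0 - D (t - t0)) \<le> e * norm (t - t0)"
  proof (intro exI[of _ "min d2 d3"] conjI allI impI)
    fix t assume t: "norm (t - t0) < min d2 d3"
    define a where "a = w t - w t0"
    define b where "b = F (w t) - F (w t0)"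
    define h where "h = norm (t - t0)"
    have 1: "norm (b - a) \<le> e' * norm a" using d1(2) d3(2) t by (simp add: a_def b_def)
    have 2: "norm (b - D (t - t0)) \<le> e' * h" using d2(2) t by (simp add: b_def h_def)
    have 3: "norm (D (t - t0)) \<le> h * K" using K(2) by (simp add: h_def)
    have h0: "h \<ge> 0" by (simp add: h_def)
    have "norm a \<le> norm b + norm (b - a)" using norm_triangle_ineq4[of b "b - a"] by simp
    also have "\<dots> \<le> norm b + (1 / 2) * norm a"
      using order_trans[OF 1 mult_right_mono[OF e'(2)]] by simp
    finally have a: "norm a \<le> 2 * norm b" by simp
    have "norm b \<le> norm (D (t - t0)) + norm (b - D (t - t0))"
      using norm_triangle_ineq[of "D (t - t0)" "b - D (t - t0)"] by simp
    also have "\<dots> \<le> h * K + (1 / 2) * h"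
      using 3 order_trans[OF 2 mult_right_mono[OF e'(2) h0]] by simp
    finally have b: "norm a \<le> (2 * K + 1) * h" using a by (simp add: algebra_simps)
    have "norm (a - D (t - t0)) \<le> norm (b - a) + norm (b - D (t - t0))"
      using norm_triangle_ineq4[of "b - D (t - t0)" "b - a"] by (simp add: algebra_simps)
    also have "\<dots> \<le> e' * ((2 * K + 1) * h) + e' * h"
      using 2 order_trans[OF 1 mult_left_mono[OF b]] e'(1) by simp
    also have "\<dots> \<le> e' * (2 * K + 3) * h"
      using e'(1) h0 by (simp add: algebra_simps)
    also have "\<dots> \<le> e * h" using e'(3) h0 by (rule mult_right_mono)
    finally show "norm (w t - w t0 - D (t - t0)) \<le> e * norm (t - t0)"
      by (simp add: a_def h_def)
  qed (use d2(1) d3(1) in auto)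
qed

lemma has_derivative_smult_component:
  fixes w :: "complex \<Rightarrow> complex ^ 'n::finite"
  assumes "(w has_derivative (\<lambda>h. h *s d)) (at t)"
  shows "((\<lambda>t. w t $ j) has_field_derivative d $ j) (at t)"
proof -
  have "((\<lambda>t. w t $ j) has_derivative (\<lambda>h. (h *s d) $ j)) (at t)"
    by (rule bounded_linear.has_derivative[OF bounded_linear_vec_nth assms])
  then show ?thesis by (simp add: has_field_derivative_def mult.commute[of _ "d $ j"])
qed

lemma has_derivative_smult_vec:
  fixes w :: "complex \<Rightarrow> complex ^ 'n::finite"
  assumes "\<And>j. ((\<lambda>t. w t $ j) has_field_derivative d $ j) (at t)"
  shows "(w has_derivative (\<lambda>h. h *s d)) (at t)"
proof -
  have bl: "bounded_linear (\<lambda>c. c *s v)" for v :: "complex ^ 'n"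
    by (rule bounded_linear_intro[where K = "norm v"])
       (simp_all add: norm_vec_smult vec.scale_left_distrib, simp add: vec_eq_iff)
  have "((\<lambda>t. w t $ j) has_derivative (\<lambda>h. (h *s d) $ j)) (at t)" for j
    using assms[of j] by (simp add: has_field_derivative_def mult.commute[of _ "d $ j"])
  then have "((\<lambda>t. \<Sum>j\<in>UNIV. (w t $ j) *s axis j 1) has_derivative
      (\<lambda>h. \<Sum>j\<in>UNIV. ((h *s d) $ j) *s axis j 1)) (at t)"
    by (intro has_derivative_sum bounded_linear.has_derivative[OF bl])
  then show ?thesis by (simp only: basis_expansion)
qed

text \<open>A left inverse of the differential, composed with \<phi>, has identity derivative at the
  point in question, so \<open>has_derivative_lift\<close> applies. The derivative obtained is again
  complex linear.\<close>

lemma holomorphic_lift_through_immersion: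
  fixes \<phi> :: "complex ^ 'n::finite \<Rightarrow> complex ^ 'm::finite" and w :: "complex \<Rightarrow> complex ^ 'n"
  assumes imm: "holomorphic_immersion_on \<phi> W" and T: "open T" and w: "continuous_on T w" "w ` T \<subseteq> W"
    and hol: "\<And>j. (\<lambda>t. \<phi> (w t) $ j) holomorphic_on T"
  shows "(\<lambda>t. w t $ j) holomorphic_on T"
  unfolding holomorphic_on_open[OF T]
proof (intro ballI)
  fix t assume t: "t \<in> T"
  then have "w t \<in> W" using w(2) by auto
  then obtain A :: "complex ^ 'n ^ 'm" where A: "(\<phi> has_derivative (\<lambda>h. A *v h)) (at (w t))" "inj ((*v) A)"
    using imm unfolding holomorphic_immersion_on_def by blast
  obtain B where B: "B ** A = mat 1" using A(2) matrix_left_invertible_injective by blast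
  have "\<exists>d. ((\<lambda>t. \<phi> (w t) $ j) has_field_derivative d) (at t)" for j
    using hol[of j] t unfolding holomorphic_on_open[OF T] by blast
  then obtain d where d: "\<And>j. ((\<lambda>t. \<phi> (w t) $ j) has_field_derivative d j) (at t)" by metis
  have bl: "bounded_linear (\<lambda>x. B *v x)" by (rule matrix_vector_mul_bounded_linear)
  have 1: "((\<lambda>y. B *v \<phi> y) has_derivative (\<lambda>h. B *v (A *v h))) (at (w t))"
    by (rule bounded_linear.has_derivative[OF bl A(1)])
  have 2: "((\<lambda>t. \<phi> (w t)) has_derivative (\<lambda>h. h *s (\<chi> j. d j))) (at t)"
    by (rule has_derivative_smult_vec) (simp add: d)
  have 3: "((\<lambda>t. B *v \<phi> (w t)) has_derivative (\<lambda>h. B *v (h *s (\<chi> j. d j)))) (at t)"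
    by (rule bounded_linear.has_derivative[OF bl 2])
  have "B *v (A *v h) = h" for h by (simp add: matrix_vector_mul_assoc B)
  moreover have "isCont w t" using w(1) T t by (simp add: continuous_on_eq_continuous_at)
  ultimately have "(w has_derivative (\<lambda>h. B *v (h *s (\<chi> j. d j)))) (at t)"
    using has_derivative_lift[of "\<lambda>y. B *v \<phi> y" w t] 1 3 by simp
  moreover have "B *v (h *s (\<chi> j. d j)) = h *s (B *v (\<chi> j. d j))" for h
    by (rule vec.scale)
  ultimately have "(w has_derivative (\<lambda>h. h *s (B *v (\<chi> j. d j)))) (at t)" by simp
  then show "\<exists>f'. ((\<lambda>t. w t $ j) has_field_derivative f') (at t)"
    using has_derivative_smult_component by blast
qed

lemma line_holomorphic_curve:
  assumes "line_holomorphic r f" "r > 0"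
  shows "(\<lambda>t. f (t *s u)) analytic_on {0}"
proof -
  have "(\<lambda>t. f (0 + t *s u)) holomorphic_on {t. 0 + t *s u \<in> ball 0 r}"
    using assms(1) unfolding line_holomorphic_def by blast
  moreover have "0 \<in> {t. 0 + t *s u \<in> ball 0 r}" using assms(2) by simp
  ultimately show ?thesis using open_line_ball[of 0 u r] unfolding analytic_at by auto
qed

text \<open>The given chart is recentred at 0 and divided by its i-th coordinate, since the
  submanifold may be presented in another affine chart \<open>i'\<close> than the one measuring
  tangents. Curves on \<open>X\<close> lift continuously through the inverse homeomorphism and then
  analytically because \<phi> is an immersion.\<close>

lemma submanifold_germ_chart:
  fixes X :: "'m::finite cproj set"
  assumes sub: "submanifold_germ TYPE('n::finite) X x" and xi: "x \<in> affine_chart i"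
  obtains \<Phi> :: "complex ^ 'n \<Rightarrow> complex ^ ('m option)" and r where
    "r > 0" "\<And>j. line_holomorphic r (\<lambda>u. \<Phi> u $ j)" "\<And>u. norm u < r \<Longrightarrow> \<Phi> u $ i = 1" "hpt (\<Phi> 0) = x"
    "\<And>u. norm u < r \<Longrightarrow> hpt (\<Phi> u) \<in> X" "inj_on (\<lambda>u. hpt (\<Phi> u)) (ball 0 r)"
    "\<And>\<rho>. 0 < \<rho> \<Longrightarrow> \<rho> \<le> r \<Longrightarrow> \<exists>V. open V \<and> x \<in> V \<and> X \<inter> V \<subseteq> (\<lambda>u. hpt (\<Phi> u)) ` ball 0 \<rho>"
    "\<And>\<gamma>. curve_germ i X x \<gamma> \<Longrightarrow> \<exists>y. (\<forall>j. (\<lambda>t. y t $ j) analytic_on {0}) \<and> y 0 = 0 \<and>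
        eventually (\<lambda>t. norm (y t) < r \<and> \<Phi> (y t) = \<gamma> t) (nhds 0)"
proof -
  from sub obtain i' U W and \<phi> :: "complex ^ 'n \<Rightarrow> complex ^ ('m option)" and \<psi> where
    xX: "x \<in> X" and U: "open U" "x \<in> U" and W: "open W" and imm: "holomorphic_immersion_on \<phi> W"
    and one: "\<And>w. w \<in> W \<Longrightarrow> \<phi> w $ i' = 1" and homeo: "homeomorphism W (X \<inter> U) (\<lambda>w. hpt (\<phi> w)) \<psi>"
    unfolding submanifold_germ_def by blast
  define w0 where "w0 = \<psi> x"
  have w0: "w0 \<in> W" "hpt (\<phi> w0) = x"
    using homeo xX U(2) unfolding homeomorphism_def w0_def by auto
  have \<psi>\<phi>: "\<psi> (hpt (\<phi> w)) = w" "hpt (\<phi> w) \<in> X \<inter> U" if "w \<in> W" for w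
    using homeo that unfolding homeomorphism_def by auto
  have \<phi>\<psi>: "hpt (\<phi> (\<psi> p)) = p" "\<psi> p \<in> W" if "p \<in> X \<inter> U" for p
    using homeo that unfolding homeomorphism_def by auto
  have nz: "\<phi> w \<noteq> 0" if "w \<in> W" for w using one[OF that] by auto
  have cont\<phi>: "continuous_on W \<phi>"
  proof (rule continuous_at_imp_continuous_on, rule ballI)
    fix w assume "w \<in> W"
    then show "isCont \<phi> w"
      using imm has_derivative_continuous unfolding holomorphic_immersion_on_def by blast
  qed
  have "\<phi> w0 $ i \<noteq> 0"
  proof -
    have "line_of x = vec.span {\<phi> w0}" using line_of_hpt[OF nz[OF w0(1)]] w0(2) by simp
    then show ?thesis using xi unfolding affine_chart_def by (auto simp: vec.span_singleton)
  qed
  then have w0i: "w0 \<in> {w \<in> W. \<phi> w $ i \<noteq> 0}" using w0(1) by simp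
  have "open {w \<in> W. \<phi> w $ i \<noteq> 0}"
  proof -
    have "{w \<in> W. \<phi> w $ i \<noteq> 0} = W \<inter> (\<lambda>w. \<phi> w $ i) -` (- {0})" by auto
    moreover have "open (W \<inter> (\<lambda>w. \<phi> w $ i) -` (- {0}))"
      by (rule continuous_open_preimage[OF _ W]) (auto intro!: continuous_intros cont\<phi>)
    ultimately show ?thesis by simp
  qed
  then obtain r where r: "r > 0" "ball w0 r \<subseteq> {w \<in> W. \<phi> w $ i \<noteq> 0}"
    using w0i unfolding open_contains_ball by blast
  have inW: "w0 + u \<in> W" "\<phi> (w0 + u) $ i \<noteq> 0" if "norm u < r" for u
  proof -
    have "w0 + u \<in> ball w0 r" using that by (simp add: dist_norm)
    then show "w0 + u \<in> W" "\<phi> (w0 + u) $ i \<noteq> 0" using r(2) by auto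
  qed
  define \<Phi> where "\<Phi> u = (1 / \<phi> (w0 + u) $ i) *s \<phi> (w0 + u)" for u
  have hpt\<Phi>: "hpt (\<Phi> u) = hpt (\<phi> (w0 + u))" if "norm u < r" for u
    unfolding \<Phi>_def by (rule hpt_smult) (use inW(2)[OF that] in simp)
  have lh: "line_holomorphic r (\<lambda>u. \<Phi> u $ j)" for j
    unfolding line_holomorphic_def
  proof (intro conjI allI)
    have c: "continuous_on (ball 0 r) (\<lambda>u. \<phi> (w0 + u) $ j)" for j
      by (intro continuous_intros continuous_on_compose2[OF cont\<phi>]) (use r(2) in auto)
    show "continuous_on (ball 0 r) (\<lambda>u. \<Phi> u $ j)"
      unfolding \<Phi>_def vector_smult_component by (intro continuous_intros c) (use inW in auto)
    fix a b :: "complex ^ 'n"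
    let ?S = "{s. a + s *s b \<in> ball 0 r}"
    have h: "(\<lambda>s. \<phi> (w0 + (a + s *s b)) $ j) holomorphic_on ?S" for j
      unfolding holomorphic_on_open[OF open_line_ball]
    proof
      fix s assume "s \<in> ?S"
      then have "w0 + (a + s *s b) \<in> W" using inW by simp
      then obtain A :: "complex ^ 'n ^ ('m option)" where A: "(\<phi> has_derivative (\<lambda>h. A *v h)) (at (w0 + (a + s *s b)))"
        using imm unfolding holomorphic_immersion_on_def by blast
      have "((\<lambda>s. w0 + (a + s *s b)) has_derivative (\<lambda>h. h *s b)) (at s)"
        by (rule has_derivative_smult_vec) (auto intro!: derivative_eq_intros)
      from has_derivative_compose[OF this A]
      have "((\<lambda>s. \<phi> (w0 + (a + s *s b))) has_derivative (\<lambda>h. h *s (A *v b))) (at s)"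
        by (simp add: vec.scale)
      then show "\<exists>f'. ((\<lambda>s. \<phi> (w0 + (a + s *s b)) $ j) has_field_derivative f') (at s)"
        using has_derivative_smult_component by blast
    qed
    show "(\<lambda>s. \<Phi> (a + s *s b) $ j) holomorphic_on ?S"
      unfolding \<Phi>_def vector_smult_component by (intro holomorphic_intros h) (use inW in auto)
  qed
  show ?thesis
  proof (rule that[of r \<Phi>])
    show "r > 0" by (rule r(1))
    show "line_holomorphic r (\<lambda>u. \<Phi> u $ j)" for j by (rule lh)
    show "\<Phi> u $ i = 1" if "norm u < r" for u using inW(2)[OF that] by (simp add: \<Phi>_def)
    show "hpt (\<Phi> 0) = x" using hpt\<Phi>[of 0] r(1) w0(2) by simp
    show "hpt (\<Phi> u) \<in> X" if "norm u < r" for u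
      using hpt\<Phi>[OF that] \<psi>\<phi>(2)[OF inW(1)[OF that]] by simp
    show "inj_on (\<lambda>u. hpt (\<Phi> u)) (ball 0 r)"
    proof (rule inj_onI)
      fix u v assume "u \<in> ball 0 r" "v \<in> ball 0 r" "hpt (\<Phi> u) = hpt (\<Phi> v)"
      then have "norm u < r" "norm v < r" "hpt (\<phi> (w0 + u)) = hpt (\<phi> (w0 + v))" by (auto simp: hpt\<Phi>)
      then have "w0 + u = w0 + v" using \<psi>\<phi>(1)[OF inW(1)] by metis
      then show "u = v" by simp
    qed
    show "\<exists>V. open V \<and> x \<in> V \<and> X \<inter> V \<subseteq> (\<lambda>u. hpt (\<Phi> u)) ` ball 0 \<rho>" if \<rho>: "0 < \<rho>" "\<rho> \<le> r" for \<rho>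
    proof -
      have sW: "ball w0 \<rho> \<subseteq> W" using r(2) subset_ball[OF \<rho>(2), of w0] by blast
      have "openin (top_of_set W) (ball w0 \<rho>)"
        using sW by (simp add: openin_open_eq W)
      then have "openin (top_of_set (X \<inter> U)) ((\<lambda>w. hpt (\<phi> w)) ` ball w0 \<rho>)"
        using homeomorphism_imp_open_map[OF homeo] by blast
      then obtain T where T: "open T" "(\<lambda>w. hpt (\<phi> w)) ` ball w0 \<rho> = X \<inter> U \<inter> T"
        by (auto simp: openin_open)
      have "x \<in> (\<lambda>w. hpt (\<phi> w)) ` ball w0 \<rho>" using w0(2) \<rho>(1) by (intro image_eqI[of _ _ w0]) auto
      then have "x \<in> T" using T(2) by auto
      moreover have "X \<inter> (U \<inter> T) \<subseteq> (\<lambda>u. hpt (\<Phi> u)) ` ball 0 \<rho>"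
      proof
        fix p assume "p \<in> X \<inter> (U \<inter> T)"
        then have "p \<in> (\<lambda>w. hpt (\<phi> w)) ` ball w0 \<rho>" using T(2) by auto
        then obtain w where w: "w \<in> ball w0 \<rho>" "p = hpt (\<phi> w)" by auto
        have "norm (w - w0) < \<rho>" using w(1) by (simp add: dist_norm norm_minus_commute)
        then have "p = hpt (\<Phi> (w - w0))" "w - w0 \<in> ball 0 \<rho>"
          using w(2) hpt\<Phi>[of "w - w0"] \<rho>(2) by auto
        then show "p \<in> (\<lambda>u. hpt (\<Phi> u)) ` ball 0 \<rho>" by blast
      qed
      ultimately show ?thesis using T(1) U by (intro exI[of _ "U \<inter> T"]) auto
    qed
    show "\<exists>y. (\<forall>j. (\<lambda>t. y t $ j) analytic_on {0}) \<and> y 0 = 0 \<and>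
        eventually (\<lambda>t. norm (y t) < r \<and> \<Phi> (y t) = \<gamma> t) (nhds 0)" if \<gamma>: "curve_germ i X x \<gamma>" for \<gamma>
    proof -
      have an: "(\<lambda>t. \<gamma> t $ j) analytic_on {0}" for j using \<gamma> by (simp add: curve_germ_def)
      have "\<exists>S. open S \<and> 0 \<in> S \<and> (\<lambda>t. \<gamma> t $ j) holomorphic_on S" for j
        using an[of j] unfolding analytic_at by blast
      then obtain S where S: "\<And>j. open (S j)" "\<And>j. 0 \<in> S j" "\<And>j. (\<lambda>t. \<gamma> t $ j) holomorphic_on S j" by metis
      obtain S0 where S0: "open S0" "0 \<in> S0" "\<And>t. t \<in> S0 \<Longrightarrow> \<gamma> t $ i = 1 \<and> hpt (\<gamma> t) \<in> X"
        using \<gamma> unfolding curve_germ_def eventually_nhds by blast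
      define T1 where "T1 = S0 \<inter> (\<Inter>j. S j)"
      have T1: "open T1" "0 \<in> T1" unfolding T1_def using S0 S by (auto intro!: open_Int open_INT)
      have hol: "(\<lambda>t. \<gamma> t $ j) holomorphic_on T1" for j
        by (rule holomorphic_on_subset[OF S(3)[of j]]) (auto simp: T1_def)
      have cont\<gamma>: "continuous_on T1 \<gamma>"
      proof -
        have "continuous_on T1 (\<lambda>t. \<chi> j. \<gamma> t $ j)"
          by (intro continuous_on_vec_lambda holomorphic_on_imp_continuous_on hol)
        then show ?thesis by (simp only: vec_lambda_eta)
      qed
      have \<gamma>nz: "\<gamma> t \<noteq> 0" if "t \<in> T1" for t
        using S0(3)[of t] that by (auto simp: T1_def)
      have x0: "hpt (\<gamma> 0) = x" using \<gamma> by (simp add: curve_germ_def)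
      define T2 where "T2 = T1 \<inter> \<gamma> -` {v. v \<noteq> 0 \<and> hpt v \<in> U}"
      have T2: "open T2" unfolding T2_def
        by (rule continuous_open_preimage[OF cont\<gamma> T1(1) open_hpt_vimage[OF U(1)]])
      have "0 \<in> T2" unfolding T2_def using T1(2) \<gamma>nz x0 U(2) by auto
      have inXU: "hpt (\<gamma> t) \<in> X \<inter> U" if "t \<in> T2" for t
        using that S0(3)[of t] by (auto simp: T2_def T1_def)
      define w where "w t = \<psi> (hpt (\<gamma> t))" for t
      have chpt: "continuous_on T2 (\<lambda>t. hpt (\<gamma> t))"
        by (rule continuous_on_compose2[OF continuous_on_hpt continuous_on_subset[OF cont\<gamma>]])
           (auto simp: T2_def)
      have contw: "continuous_on T2 w" unfolding w_def[abs_def]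
      proof (rule continuous_on_compose2[OF _ chpt])
        show "continuous_on (X \<inter> U) \<psi>" using homeo by (simp add: homeomorphism_def)
      qed (use inXU in auto)
      have wW: "w ` T2 \<subseteq> W" using \<phi>\<psi>(2)[OF inXU] by (auto simp: w_def)
      \<comment> \<open>Both vectors represent the same point, and the i'-th coordinate 1 of \<phi>
        fixes the proportionality factor.\<close>
      have w_eq: "\<phi> (w t) = (1 / \<gamma> t $ i') *s \<gamma> t" "\<gamma> t $ i' \<noteq> 0" if t: "t \<in> T2" for t
      proof -
        have wt: "w t \<in> W" using wW t by auto
        have "hpt (\<phi> (w t)) = hpt (\<gamma> t)" using \<phi>\<psi>(1)[OF inXU[OF t]] by (simp add: w_def)
        moreover have "\<gamma> t \<noteq> 0" using t by (simp add: T2_def)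
        ultimately obtain c where c: "c \<noteq> 0" "\<phi> (w t) = c *s \<gamma> t"
          using hpt_eq_imp[OF nz[OF wt], of "\<gamma> t"] by blast
        have "c * \<gamma> t $ i' = 1" using one[OF wt] c(2) by simp
        then have "\<gamma> t $ i' \<noteq> 0" "c = 1 / \<gamma> t $ i'" by (auto simp: eq_divide_eq)
        with c(2) show "\<phi> (w t) = (1 / \<gamma> t $ i') *s \<gamma> t" "\<gamma> t $ i' \<noteq> 0" by auto
      qed
      have holw: "(\<lambda>t. w t $ j) holomorphic_on T2" for j
      proof (rule holomorphic_lift_through_immersion[OF imm T2 contw wW])
        fix j
        have "(\<lambda>t. 1 / \<gamma> t $ i' * \<gamma> t $ j) holomorphic_on T2"
          using w_eq(2) by (intro holomorphic_intros holomorphic_on_subset[OF hol]) (auto simp: T2_def)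
        then show "(\<lambda>t. \<phi> (w t) $ j) holomorphic_on T2"
          by (rule holomorphic_transform) (use w_eq(1) in auto)
      qed
      define y where "y t = w t - w0" for t
      have y0: "y 0 = 0" by (simp add: y_def w_def x0 w0_def)
      have "open (T2 \<inter> w -` ball w0 r)"
        by (rule continuous_open_preimage[OF contw T2]) simp
      moreover have "0 \<in> T2 \<inter> w -` ball w0 r"
        using \<open>0 \<in> T2\<close> r(1) by (simp add: w_def x0 w0_def[symmetric])
      ultimately have "eventually (\<lambda>t. t \<in> T2 \<inter> w -` ball w0 r) (nhds 0)"
        by (rule eventually_nhds_in_open)
      then have "eventually (\<lambda>t. norm (y t) < r \<and> \<Phi> (y t) = \<gamma> t) (nhds 0)"
      proof eventually_elim
        case (elim t)
        then have t: "t \<in> T2" "norm (y t) < r" by (auto simp: y_def dist_norm norm_minus_commute)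
        have gi: "\<gamma> t $ i = 1" using S0(3)[of t] t(1) by (auto simp: T2_def T1_def)
        have "w0 + y t = w t" by (simp add: y_def)
        then have "\<Phi> (y t) = (1 / ((1 / \<gamma> t $ i') * \<gamma> t $ i)) *s ((1 / \<gamma> t $ i') *s \<gamma> t)"
          by (simp add: \<Phi>_def w_eq(1)[OF t(1)])
        also have "\<dots> = \<gamma> t" using w_eq(2)[OF t(1)] by (simp add: gi)
        finally show ?case using t(2) by simp
      qed
      moreover have "(\<lambda>t. y t $ j) analytic_on {0}" for j
      proof -
        have "(\<lambda>t. w t $ j - w0 $ j) holomorphic_on T2" by (intro holomorphic_intros holw)
        then show ?thesis unfolding analytic_at y_def using T2 \<open>0 \<in> T2\<close> by auto
      qed
      ultimately show ?thesis using y0 by blast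
    qed
  qed
qed

section \<open>Taylor coefficients of the chart and tests along curves\<close>

lemma vector_taylor:
  fixes \<Phi> :: "complex ^ 'n::finite \<Rightarrow> complex ^ 'm::finite"
  assumes lh: "\<And>j. line_holomorphic r (\<lambda>u. \<Phi> u $ j)" and r: "r > 0"
  obtains e :: "('n \<Rightarrow> nat) \<Rightarrow> complex ^ 'm" and \<rho> where "\<rho> > 0"
    "\<And>j K. \<exists>C. \<forall>u. norm u < \<rho> \<longrightarrow>
       norm (\<Phi> u $ j - (\<Sum>k\<le>K. \<Sum>\<alpha>\<in>expos k. e \<alpha> $ j * mon \<alpha> (($) u))) \<le> C * norm u ^ Suc K"
proof -
  have "\<exists>a\<rho> :: _ \<times> real. snd a\<rho> > 0 \<and> (\<forall>K. \<exists>C. \<forall>u. norm u < snd a\<rho> \<longrightarrow>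
       norm (\<Phi> u $ j - (\<Sum>k\<le>K. \<Sum>\<alpha>\<in>expos k. fst a\<rho> \<alpha> * mon \<alpha> (($) u))) \<le> C * norm u ^ Suc K)" for j
  proof -
    obtain F \<rho> where F: "\<And>k. F k \<in> homf k" "\<rho> > 0"
      "\<And>K. \<exists>C. \<forall>u. norm u < \<rho> \<longrightarrow> norm (\<Phi> u $ j - (\<Sum>k\<le>K. F k u)) \<le> C * norm u ^ Suc K"
      by (rule line_holomorphic_taylor[OF lh[of j] r]) blast
    have "\<exists>a. \<forall>z. F k z = (\<Sum>\<alpha>\<in>expos k. a \<alpha> * mon \<alpha> (($) z))" for k
      using homf_coeffs[OF F(1)[of k]] by metis
    then obtain a where a: "\<And>k z. F k z = (\<Sum>\<alpha>\<in>expos k. a k \<alpha> * mon \<alpha> (($) z))" by metis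
    have "F k z = (\<Sum>\<alpha>\<in>expos k. a (\<Sum>i\<in>UNIV. \<alpha> i) \<alpha> * mon \<alpha> (($) z))" for k z
      unfolding a by (intro sum.cong refl) (simp add: expos_def)
    then show ?thesis using F(2,3) by (intro exI[of _ "(\<lambda>\<alpha>. a (\<Sum>i\<in>UNIV. \<alpha> i) \<alpha>, \<rho>)"]) simp
  qed
  from choice[OF allI[OF this]] obtain f where f: "\<forall>j. snd (f j) > 0 \<and> (\<forall>K. \<exists>C. \<forall>u. norm u < snd (f j) \<longrightarrow>
       norm (\<Phi> u $ j - (\<Sum>k\<le>K. \<Sum>\<alpha>\<in>expos k. fst (f j) \<alpha> * mon \<alpha> (($) u))) \<le> C * norm u ^ Suc K)" ..
  define a where "a j = fst (f j)" for j
  define \<rho> where "\<rho> j = snd (f j)" for j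
  have a: "\<And>j. \<rho> j > (0::real)" "\<And>j K. \<exists>C. \<forall>u. norm u < \<rho> j \<longrightarrow>
       norm (\<Phi> u $ j - (\<Sum>k\<le>K. \<Sum>\<alpha>\<in>expos k. a j \<alpha> * mon \<alpha> (($) u))) \<le> C * norm u ^ Suc K"
    using f unfolding a_def \<rho>_def by auto
  show ?thesis
  proof (rule that[of "Min (range \<rho>)" "\<lambda>\<alpha>. \<chi> j. a j \<alpha>"])
    show "Min (range \<rho>) > 0" using a(1) by simp
    fix j K
    obtain C where C: "\<And>u. norm u < \<rho> j \<Longrightarrow>
       norm (\<Phi> u $ j - (\<Sum>k\<le>K. \<Sum>\<alpha>\<in>expos k. a j \<alpha> * mon \<alpha> (($) u))) \<le> C * norm u ^ Suc K"
      using a(2) by blast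
    have "Min (range \<rho>) \<le> \<rho> j" by simp
    then show "\<exists>C. \<forall>u. norm u < Min (range \<rho>) \<longrightarrow>
       norm (\<Phi> u $ j - (\<Sum>k\<le>K. \<Sum>\<alpha>\<in>expos k. (\<chi> j. a j \<alpha>) $ j * mon \<alpha> (($) u))) \<le> C * norm u ^ Suc K"
    proof (intro exI[of _ C] allI impI)
      fix u :: "complex ^ 'n" assume "norm u < Min (range \<rho>)"
      also note \<open>Min (range \<rho>) \<le> \<rho> j\<close>
      finally have "norm u < \<rho> j" .
      from C[OF this] show "norm (\<Phi> u $ j - (\<Sum>k\<le>K. \<Sum>\<alpha>\<in>expos k. (\<chi> j. a j \<alpha>) $ j * mon \<alpha> (($) u))) \<le> C * norm u ^ Suc K"
        by (simp only: vec_lambda_beta)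
    qed
  qed
qed

lemma line_holomorphic_homf:
  fixes N :: "complex ^ 'n::finite \<Rightarrow> complex ^ 'm::finite"
  assumes "f \<in> homf d" "\<And>j. line_holomorphic r (\<lambda>u. N u $ j)"
  shows "line_holomorphic r (\<lambda>u. f (N u))"
  using assms(1)
proof (induction rule: homf_induct)
  case (add c \<alpha> g)
  have "line_holomorphic r (\<lambda>u. mon \<alpha> (($) (N u)))"
    unfolding mon_def by (intro line_holomorphic_prod line_holomorphic_power assms(2))
  then show ?case using add by (intro line_holomorphic_add line_holomorphic_mult line_holomorphic_const)
qed (rule line_holomorphic_const)

lemma line_holomorphic_dotp:
  "(\<And>j. line_holomorphic r (\<lambda>u. \<Phi> u $ j)) \<Longrightarrow> line_holomorphic r (\<lambda>u. dotp l (\<Phi> u))"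
  unfolding dotp_def by (intro line_holomorphic_sum line_holomorphic_mult line_holomorphic_const)

lemma mon_fps_nth:
  fixes Y :: "'n::finite \<Rightarrow> complex fps"
  assumes "\<And>j. fps_nth (Y j) 0 = 0" "\<alpha> \<in> expos k" "l \<le> k"
  shows "fps_nth (mon \<alpha> Y) l = (if l = k then mon \<alpha> (\<lambda>j. fps_nth (Y j) 1) else 0)"
proof -
  have "Y j = fps_X * fps_shift 1 (Y j)" for j
    by (rule fps_ext) (auto simp: assms(1))
  then have "Y = (\<lambda>j. fps_X * fps_shift 1 (Y j))" by (rule ext)
  then have "mon \<alpha> Y = mon \<alpha> (\<lambda>j. fps_X * fps_shift 1 (Y j))" by (rule arg_cong)
  also have "\<dots> = fps_X ^ k * mon \<alpha> (\<lambda>j. fps_shift 1 (Y j))"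
    using assms(2) by (simp only: mon_scale expos_def mem_Collect_eq)
  finally have eq: "mon \<alpha> Y = fps_X ^ k * mon \<alpha> (\<lambda>j. fps_shift 1 (Y j))" .
  have "fps_nth (mon \<alpha> (\<lambda>j. fps_shift 1 (Y j))) 0 = mon \<alpha> (\<lambda>j. fps_nth (Y j) 1)"
    by (simp add: mon_def fps_power_zeroth fps_nth_prod_0)
  then show ?thesis using assms(3) by (simp add: eq fps_X_power_mult_nth)
qed

text \<open>
  A nonzero lowest homogeneous part \<open>F k\<close> would survive as the coefficient \<open>F k v * t\<^sup>k\<close> along
  the curve with tangent \<open>v\<close>.
\<close>

lemma line_holomorphic_eq_0_if_curves:
  fixes f :: "complex ^ 'n::finite \<Rightarrow> complex"
  assumes lh: "line_holomorphic r f" "r > 0"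
    and curves: "\<And>v. v \<noteq> 0 \<Longrightarrow> \<exists>y :: complex \<Rightarrow> complex ^ 'n. (\<forall>j. (\<lambda>t. y t $ j) analytic_on {0}) \<and> y 0 = 0 \<and>
      (\<forall>j. deriv (\<lambda>t. y t $ j) 0 = v $ j) \<and> eventually (\<lambda>t. f (y t) = 0) (nhds 0)"
  shows "\<exists>\<rho>>0. \<forall>u. norm u < \<rho> \<longrightarrow> f u = 0"
proof -
  obtain F \<rho> where F: "\<And>k. F k \<in> homf k" "\<rho> > 0"
      "\<And>K. \<exists>C. \<forall>u. norm u < \<rho> \<longrightarrow> norm (f u - (\<Sum>k\<le>K. F k u)) \<le> C * norm u ^ Suc K"
      "\<And>u. norm u < \<rho> \<Longrightarrow> (\<lambda>k. F k u) sums f u"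
    by (rule line_holomorphic_taylor[OF lh]) blast
  have "\<exists>a. \<forall>z. F k z = (\<Sum>\<alpha>\<in>expos k. a \<alpha> * mon \<alpha> (($) z))" for k
    using homf_coeffs[OF F(1)[of k]] by metis
  then obtain a' where a': "\<And>k z. F k z = (\<Sum>\<alpha>\<in>expos k. a' k \<alpha> * mon \<alpha> (($) z))" by metis
  define a where "a \<alpha> = a' (\<Sum>i\<in>UNIV. \<alpha> i) \<alpha>" for \<alpha>
  have a: "F k z = (\<Sum>\<alpha>\<in>expos k. a \<alpha> * mon \<alpha> (($) z))" for k z
    unfolding a' a_def by (intro sum.cong refl) (simp add: expos_def)
  have F0: "\<forall>v. F k v = 0" for k
  proof (induction k rule: less_induct)
    case (less K)
    have a0: "a \<alpha> = 0" if "\<alpha> \<in> expos k" "k < K" for k \<alpha>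
      using mon_functions_independent[OF finite_expos _ that(1), of a] less.IH[OF that(2)] a by metis
    have nz: "F K v = 0" if v: "v \<noteq> 0" for v
    proof -
      obtain y :: "complex \<Rightarrow> complex ^ 'n" where y: "\<And>j. (\<lambda>t. y t $ j) analytic_on {0}" "y 0 = 0"
        "\<And>j. deriv (\<lambda>t. y t $ j) 0 = v $ j" "eventually (\<lambda>t. f (y t) = 0) (nhds 0)"
        using curves[OF v] by blast
      define Y where "Y j = fps_expansion (\<lambda>t. y t $ j) 0" for j
      have Y: "(\<lambda>t. y t $ j) has_fps_expansion Y j" "fps_nth (Y j) 0 = 0" "fps_nth (Y j) 1 = v $ j" for j
        using analytic_at_imp_has_fps_expansion_0[OF y(1)] y(2) y(3)[of j]
        by (auto simp: Y_def fps_expansion_def)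
      have G: "(\<lambda>t. f (y t)) has_fps_expansion 0"
        using y(4) by (simp add: has_fps_expansion_0_iff)
      obtain C where C: "\<forall>u. norm u < \<rho> \<longrightarrow>
        norm (f u - (\<Sum>k\<le>K. \<Sum>\<alpha>\<in>expos k. a \<alpha> * mon \<alpha> (($) u))) \<le> C * norm u ^ Suc K"
        using F(3)[of K] unfolding a by blast
      have "0 = (\<Sum>k\<le>K. \<Sum>\<alpha>\<in>expos k. a \<alpha> * fps_nth (mon \<alpha> Y) K)"
        using fps_expansion_compose_taylor[OF F(2) C Y(1,2) G order_refl] by simp
      also have "\<dots> = (\<Sum>k<K. \<Sum>\<alpha>\<in>expos k. a \<alpha> * fps_nth (mon \<alpha> Y) K) + (\<Sum>\<alpha>\<in>expos K. a \<alpha> * fps_nth (mon \<alpha> Y) K)"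
        by (simp add: lessThan_Suc_atMost[symmetric])
      also have "(\<Sum>k<K. \<Sum>\<alpha>\<in>expos k. a \<alpha> * fps_nth (mon \<alpha> Y) K) = 0"
        by (intro sum.neutral ballI) (simp add: a0)
      also have "(\<Sum>\<alpha>\<in>expos K. a \<alpha> * fps_nth (mon \<alpha> Y) K) = F K v"
        unfolding a by (intro sum.cong refl) (simp add: mon_fps_nth[OF Y(2)] Y(3)[unfolded One_nat_def])
      finally show ?thesis by simp
    qed
    moreover have "F K 0 = 0"
    proof -
      have "axis undefined 1 \<noteq> (0 :: complex ^ 'n)" by (simp add: axis_eq_0_iff)
      from nz[OF this] show ?thesis
        using homf_homogeneous[OF F(1), of K 0 "axis undefined 1"] by simp
    qed
    ultimately show ?case by metis
  qed
  have "f u = 0" if "norm u < \<rho>" for u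
    using F(4)[OF that] sums_unique2[of "\<lambda>k. F k u" "f u" 0] by (simp add: F0)
  then show ?thesis using F(2) by blast
qed

lemma analytic_smult_arg:
  fixes f :: "complex \<Rightarrow> complex"
  assumes "f analytic_on {0}"
  shows "(\<lambda>t. f (c * t)) analytic_on {0}" "deriv (\<lambda>t. f (c * t)) 0 = c * deriv f 0"
proof -
  have "(f \<circ> (\<lambda>t. c * t)) analytic_on {0}"
    by (rule analytic_on_compose) (use assms in \<open>auto intro!: analytic_intros\<close>)
  then show "(\<lambda>t. f (c * t)) analytic_on {0}" by (simp add: o_def)
  have "f field_differentiable (at 0)" using assms by (rule analytic_on_imp_differentiable_at) simp
  then have "(f has_field_derivative deriv f 0) (at (c * 0))"
    using field_differentiable_derivI by simp
  then have "((\<lambda>t. f (c * t)) has_field_derivative deriv f 0 * c) (at 0)"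
    by (rule DERIV_chain2) (auto intro!: derivative_eq_intros)
  then show "deriv (\<lambda>t. f (c * t)) 0 = c * deriv f 0"
    by (simp add: DERIV_imp_deriv mult.commute)
qed

section \<open>The germ covered by rational normal curves\<close>

locale veronese_germ =
  fixes X :: "'m::finite cproj set" and x :: "'m cproj" and i :: "'m option" and q :: nat
    and \<Phi> :: "complex ^ 'n::finite \<Rightarrow> complex ^ ('m option)" and r \<rho> :: real
    and e :: "('n \<Rightarrow> nat) \<Rightarrow> complex ^ ('m option)"
  assumes q: "q \<ge> 1" and xi: "x \<in> affine_chart i" and r: "r > 0"
    and lh: "\<And>j. line_holomorphic r (\<lambda>u. \<Phi> u $ j)" and \<Phi>i: "\<And>u. norm u < r \<Longrightarrow> \<Phi> u $ i = 1"
    and \<Phi>0: "hpt (\<Phi> 0) = x" and \<Phi>X: "\<And>u. norm u < r \<Longrightarrow> hpt (\<Phi> u) \<in> X"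
    and inj\<Phi>: "inj_on (\<lambda>u. hpt (\<Phi> u)) (ball 0 r)"
    and nbhd: "\<And>\<rho>. 0 < \<rho> \<Longrightarrow> \<rho> \<le> r \<Longrightarrow> \<exists>V. open V \<and> x \<in> V \<and> X \<inter> V \<subseteq> (\<lambda>u. hpt (\<Phi> u)) ` ball 0 \<rho>"
    and lift: "\<And>\<gamma>. curve_germ i X x \<gamma> \<Longrightarrow> \<exists>y. (\<forall>j. (\<lambda>t. y t $ j) analytic_on {0}) \<and> y 0 = 0 \<and>
        eventually (\<lambda>t. norm (y t) < r \<and> \<Phi> (y t) = \<gamma> t) (nhds 0)"
    and \<rho>: "\<rho> > 0" and taylor: "\<And>j K. \<exists>C. \<forall>u. norm u < \<rho> \<longrightarrow>
       norm (\<Phi> u $ j - (\<Sum>k\<le>K. \<Sum>\<alpha>\<in>expos k. e \<alpha> $ j * mon \<alpha> (($) u))) \<le> C * norm u ^ Suc K"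
    and qreg: "q_regular i CARD('n) q X x"
    and rnc: "\<forall>v \<in> tangent_space i X x - {0}. \<exists>C. rational_normal_curve q C \<and> x \<in> C \<and>
           tangent_space i C x = vec.span {v} \<and> germ_subset x C X"
begin

lemma coeff_compose:
  fixes y :: "complex \<Rightarrow> complex ^ 'n"
  assumes "\<And>j. (\<lambda>t. y t $ j) analytic_on {0}" "y 0 = 0" "(\<lambda>t. \<Phi> (y t) $ j) has_fps_expansion G" "l \<le> K"
  shows "fps_nth G l = (\<Sum>k\<le>K. \<Sum>\<alpha>\<in>expos k. fps_nth (mon \<alpha> (\<lambda>j. fps_expansion (\<lambda>t. y t $ j) 0)) l * e \<alpha> $ j)"
proof -
  obtain C where C: "\<forall>u. norm u < \<rho> \<longrightarrow>
       norm (\<Phi> u $ j - (\<Sum>k\<le>K. \<Sum>\<alpha>\<in>expos k. e \<alpha> $ j * mon \<alpha> (($) u))) \<le> C * norm u ^ Suc K"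
    using taylor by blast
  have "(\<lambda>t. y t $ j) has_fps_expansion fps_expansion (\<lambda>t. y t $ j) 0"
    "fps_nth (fps_expansion (\<lambda>t. y t $ j) 0) 0 = 0" for j
    using analytic_at_imp_has_fps_expansion_0[OF assms(1)] assms(2) by (auto simp: fps_expansion_def)
  from fps_expansion_compose_taylor[OF \<rho> C this assms(3,4)] show ?thesis
    by (simp add: mult.commute)
qed

text \<open>Only exponents with |\<alpha>| \<le> l contribute since the lifted curve starts at 0;
  this confines the osculating directions to the span of finitely many Taylor coefficients.\<close>

lemma curve_deriv_eq:
  fixes y :: "complex \<Rightarrow> complex ^ 'n" and \<gamma> :: "complex \<Rightarrow> complex ^ ('m option)"
  assumes y: "\<And>j. (\<lambda>t. y t $ j) analytic_on {0}" "y 0 = 0"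
    and \<gamma>: "\<And>j. (\<lambda>t. \<gamma> t $ j) analytic_on {0}" "eventually (\<lambda>t. \<Phi> (y t) = \<gamma> t) (nhds 0)"
  shows "curve_deriv l \<gamma> = fact l *s (\<Sum>k\<le>l. \<Sum>\<alpha>\<in>expos k. fps_nth (mon \<alpha> (\<lambda>j. fps_expansion (\<lambda>t. y t $ j) 0)) l *s e \<alpha>)"
proof -
  have "curve_deriv l \<gamma> $ j = fact l * (\<Sum>k\<le>l. \<Sum>\<alpha>\<in>expos k. fps_nth (mon \<alpha> (\<lambda>j. fps_expansion (\<lambda>t. y t $ j) 0)) l * e \<alpha> $ j)" for j
  proof -
    have \<gamma>_exp: "(\<lambda>t. \<gamma> t $ j) has_fps_expansion fps_expansion (\<lambda>t. \<gamma> t $ j) 0"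
      using analytic_at_imp_has_fps_expansion_0[OF \<gamma>(1)] .
    have ev: "eventually (\<lambda>t. \<gamma> t $ j = \<Phi> (y t) $ j) (nhds 0)"
      using \<gamma>(2) by eventually_elim simp
    have "(\<lambda>t. \<Phi> (y t) $ j) has_fps_expansion fps_expansion (\<lambda>t. \<gamma> t $ j) 0"
      by (rule iffD1[OF has_fps_expansion_cong[OF ev refl] \<gamma>_exp])
    from coeff_compose[OF y this order_refl, of l] show ?thesis
      by (simp add: curve_deriv_def fps_expansion_def field_simps)
  qed
  then show ?thesis by (simp add: vec_eq_iff)
qed

text \<open>The differential of \<Phi> at 0, written through its first-order Taylor
  coefficients.\<close>

definition linear_part :: "complex ^ 'n \<Rightarrow> complex ^ ('m option)" where
  "linear_part v = (\<Sum>\<alpha>\<in>expos 1. mon \<alpha> (($) v) *s e \<alpha>)"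

lemma linear_part_scale: "linear_part (c *s v) = c *s linear_part v"
  unfolding linear_part_def vec.scale_sum_right
  by (intro sum.cong refl) (simp add: expos_def mon_vec_scale)

lemma curve_deriv_1:
  fixes y :: "complex \<Rightarrow> complex ^ 'n" and \<gamma> :: "complex \<Rightarrow> complex ^ ('m option)"
  assumes y: "\<And>j. (\<lambda>t. y t $ j) analytic_on {0}" "y 0 = 0"
    and \<gamma>: "\<And>j. (\<lambda>t. \<gamma> t $ j) analytic_on {0}" "eventually (\<lambda>t. \<Phi> (y t) = \<gamma> t) (nhds 0)"
  shows "curve_deriv 1 \<gamma> = linear_part (\<chi> j. deriv (\<lambda>t. y t $ j) 0)"
proof -
  let ?Y = "\<lambda>j. fps_expansion (\<lambda>t. y t $ j) 0"
  have Y0: "fps_nth (?Y j) 0 = 0" "fps_nth (?Y j) 1 = deriv (\<lambda>t. y t $ j) 0" for j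
    using y(2) by (auto simp: fps_expansion_def)
  have "(\<Sum>\<alpha>\<in>expos 0. fps_nth (mon \<alpha> ?Y) 1 *s e \<alpha>) = 0"
  proof (intro sum.neutral ballI)
    fix \<alpha> :: "'n \<Rightarrow> nat" assume "\<alpha> \<in> expos 0"
    then have "\<alpha> = (\<lambda>_. 0)" by (auto simp: expos_def)
    then show "fps_nth (mon \<alpha> ?Y) 1 *s e \<alpha> = 0" by simp
  qed
  moreover have "(\<Sum>\<alpha>\<in>expos 1. fps_nth (mon \<alpha> ?Y) 1 *s e \<alpha>) = linear_part (\<chi> j. deriv (\<lambda>t. y t $ j) 0)"
  proof -
    have "mon \<alpha> (\<lambda>j. fps_nth (?Y j) 1) = mon \<alpha> (($) (\<chi> j. deriv (\<lambda>t. y t $ j) 0))" for \<alpha>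
      by (simp add: mon_def Y0(2)[unfolded One_nat_def])
    then show ?thesis unfolding linear_part_def
      by (intro sum.cong refl) (simp add: mon_fps_nth[OF Y0(1)])
  qed
  ultimately show ?thesis
    using curve_deriv_eq[OF y \<gamma>, of 1] by (simp add: atMost_Suc)
qed

text \<open>The Taylor coefficients up to order \<open>q\<close> span a space containing the
  osculating one, which by regularity has dimension at least their number.\<close>

lemma e_independent: "inj_on e (expos_le q)" "vec.independent (e ` expos_le q)"
proof -
  define L where "L = vec.span (line_of x \<union> osculating_direction i q X x)"
  have "\<Phi> 0 = e (\<lambda>_. 0)"
  proof (simp only: vec_eq_iff, rule allI)
    fix j
    obtain C where "\<forall>u. norm u < \<rho> \<longrightarrow>
       norm (\<Phi> u $ j - (\<Sum>k\<le>0. \<Sum>\<alpha>\<in>expos k. e \<alpha> $ j * mon \<alpha> (($) u))) \<le> C * norm u ^ Suc 0"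
      using taylor by blast
    from this[rule_format, of 0] have "\<Phi> 0 $ j = (\<Sum>\<alpha>\<in>expos 0. e \<alpha> $ j * mon \<alpha> (($) 0))"
      using \<rho> by simp
    moreover have "expos 0 = {\<lambda>_ :: 'n. 0 :: nat}" by (auto simp: expos_def)
    ultimately show "\<Phi> 0 $ j = e (\<lambda>_. 0) $ j" by simp
  qed
  moreover have "(\<lambda>_. 0) \<in> (expos_le q :: ('n \<Rightarrow> nat) set)" by (simp add: expos_le_def)
  ultimately have e0: "\<Phi> 0 \<in> vec.span (e ` expos_le q)" by (metis imageI vec.span_base)
  have nz: "\<Phi> 0 \<noteq> 0" using \<Phi>i[of 0] r by auto
  have "line_of x \<subseteq> vec.span (e ` expos_le q)"
    using e0 line_of_hpt[OF nz] \<Phi>0 by (simp add: vec.span_minimal)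
  moreover have "osculating_direction i q X x \<subseteq> vec.span (e ` expos_le q)"
    unfolding osculating_direction_def
  proof (rule vec.span_minimal, safe)
    fix k \<gamma> assume k: "k \<in> {1..q}" and \<gamma>: "curve_germ i X x \<gamma>"
    obtain y :: "complex \<Rightarrow> complex ^ 'n" where y: "\<And>j. (\<lambda>t. y t $ j) analytic_on {0}" "y 0 = 0"
        "eventually (\<lambda>t. norm (y t) < r \<and> \<Phi> (y t) = \<gamma> t) (nhds 0)"
      using lift[OF \<gamma>] by blast
    have ev: "eventually (\<lambda>t. \<Phi> (y t) = \<gamma> t) (nhds 0)" using y(3) by eventually_elim simp
    have an: "(\<lambda>t. \<gamma> t $ j) analytic_on {0}" for j using \<gamma> by (simp add: curve_germ_def)
    show "curve_deriv k \<gamma> \<in> vec.span (e ` expos_le q)"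
      unfolding curve_deriv_eq[OF y(1,2) an ev]
      by (intro vec.span_scale vec.span_sum vec.span_base imageI) (use k in \<open>auto simp: expos_def expos_le_def\<close>)
  qed
  ultimately have sub: "L \<subseteq> vec.span (e ` expos_le q)"
    unfolding L_def by (intro vec.span_minimal) auto
  have "osculating_space i q X x = proj_subspace L" by (simp add: osculating_space_def L_def)
  then have "vec.dim L = (CARD('n) + q) choose q"
    using qreg lin_span_proj_subspace[of L] by (simp add: q_regular_def proj_dim_def L_def)
  then have card: "card (expos_le q :: ('n \<Rightarrow> nat) set) \<le> vec.dim L"
    using card_expos_le by simp
  show "inj_on e (expos_le q)" "vec.independent (e ` expos_le q)"
    by (rule independent_if_card_le_dim[OF finite_expos_le sub card])+
qed

lemma linear_part_inj: "linear_part v = linear_part w \<Longrightarrow> v = w"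
proof (simp only: vec_eq_iff[of v w], rule allI)
  fix j assume eq: "linear_part v = linear_part w"
  let ?\<beta> = "\<lambda>i :: 'n. if i = j then 1 else (0 :: nat)"
  have \<beta>: "?\<beta> \<in> expos 1" by (simp add: expos_def)
  have sub: "expos 1 \<subseteq> (expos_le q :: ('n \<Rightarrow> nat) set)" using q by (auto simp: expos_def expos_le_def)
  obtain l where l: "\<forall>\<alpha>\<in>expos_le q. dotp l (e \<alpha>) = (if \<alpha> = ?\<beta> then 1 else 0)"
    using ex_dual_vector[OF e_independent] \<beta> sub by blast
  have "dotp l (linear_part u) = u $ j" for u
  proof -
    have "dotp l (linear_part u) = (\<Sum>\<alpha>\<in>expos 1. mon \<alpha> (($) u) * (if \<alpha> = ?\<beta> then 1 else 0))"
      unfolding linear_part_def dotp_sum dotp_simps using l sub by (intro sum.cong refl) auto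
    also have "\<dots> = mon ?\<beta> (($) u)"
      using \<beta> by (simp add: finite_expos if_distrib[of "\<lambda>x. _ * x"] cong: if_cong)
    finally show ?thesis by (simp add: mon_single)
  qed
  then show "v $ j = w $ j" using eq by metis
qed

lemma linear_part_tangent: "linear_part v \<in> tangent_space i X x"
proof -
  have an: "(\<lambda>t. \<Phi> (t *s v) $ j) analytic_on {0}" for j
    by (rule line_holomorphic_curve[OF lh r])
  have "open {t. 0 + t *s v \<in> ball 0 r}" by (rule open_line_ball)
  then have "eventually (\<lambda>t. t \<in> {t. 0 + t *s v \<in> ball 0 r}) (nhds 0)"
    by (rule eventually_nhds_in_open) (use r in simp)
  then have ev: "eventually (\<lambda>t. \<Phi> (t *s v) $ i = 1 \<and> hpt (\<Phi> (t *s v)) \<in> X) (nhds 0)"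
    by eventually_elim (use \<Phi>i \<Phi>X in simp)
  have "curve_germ i X x (\<lambda>t. \<Phi> (t *s v))"
    unfolding curve_germ_def using an ev \<Phi>0 by simp
  moreover have "curve_deriv 1 (\<lambda>t. \<Phi> (t *s v)) = linear_part v"
  proof -
    have "deriv (\<lambda>t. (t *s v) $ j) 0 = v $ j" for j
      by (intro DERIV_imp_deriv) (auto intro!: derivative_eq_intros)
    then have "(\<chi> j. deriv (\<lambda>t. (t *s v) $ j) 0) = v" by (simp add: vec_eq_iff)
    moreover have "(\<lambda>t. (t *s v) $ j) analytic_on {0}" for j
      by (auto intro!: analytic_intros)
    ultimately show ?thesis
      using curve_deriv_1[of "\<lambda>t. t *s v" "\<lambda>t. \<Phi> (t *s v)"] an by simp
  qed
  ultimately show ?thesis unfolding tangent_space_def by force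
qed

text \<open>Dividing the parametrized rational normal curve by its i-th coordinate gives a curve on
  \<open>X\<close> in the affine chart, which lifts to the parameter space. Its tangent is a nonzero
  multiple of \<open>v\<close>, corrected by rescaling the parameter.\<close>

lemma curve_in_direction:
  assumes v: "v \<noteq> 0"
  obtains g :: "'m option \<Rightarrow> complex poly" and y :: "complex \<Rightarrow> complex ^ 'n" where
    "\<And>j. degree (g j) \<le> q" "coeff (g i) 0 = 1" "coeff (g i) 1 = 0"
    "\<And>j. (\<lambda>t. y t $ j) analytic_on {0}" "y 0 = 0" "\<And>j. deriv (\<lambda>t. y t $ j) 0 = v $ j"
    "eventually (\<lambda>t. \<forall>j. poly (g j) t = poly (g i) t * \<Phi> (y t) $ j) (nhds 0)"
proof -
  have T10: "linear_part 0 = 0" using linear_part_scale[of 0 0] by simp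
  have "linear_part v \<noteq> 0" using linear_part_inj[of v 0] v T10 by auto
  then obtain C where C: "rational_normal_curve q C" "x \<in> C"
    "tangent_space i C x = vec.span {linear_part v}" "germ_subset x C X"
    using rnc linear_part_tangent by blast
  obtain P :: "complex \<Rightarrow> complex ^ ('m option)" and g l0 l1 where
    P: "\<And>j. degree (g j) \<le> q" "\<And>t j. P t $ j = poly (g j) t" "\<And>t. P t \<noteq> 0" "\<And>t. hpt (P t) \<in> C"
    "hpt (P 0) = x" "P 0 $ i \<noteq> 0" "coeff (g i) 1 = 0" "\<And>t. dotp l0 (P t) = 1" "\<And>t. dotp l1 (P t) = t"
    by (rule rational_normal_curve_parametrization[OF C(1,2) q xi]) blast
  define \<gamma> where "\<gamma> t = (1 / P t $ i) *s P t" for t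
  have poly_an: "(\<lambda>t. poly p t) analytic_on {0}" for p :: "complex poly"
    by (rule analytic_on_subset[OF iffD2[OF analytic_on_open[OF open_UNIV]]]) (auto intro!: holomorphic_intros)
  have an: "(\<lambda>t. \<gamma> t $ j) analytic_on {0}" for j
  proof -
    have "(\<lambda>t. 1 / poly (g i) t * poly (g j) t) analytic_on {0}"
      using P(6) by (intro analytic_intros poly_an) (auto simp: P(2))
    then show ?thesis by (simp add: \<gamma>_def P(2))
  qed
  have gi0: "poly (g i) 0 \<noteq> 0" using P(2,6) by metis
  have "((\<lambda>t. poly (g i) t) \<longlongrightarrow> poly (g i) 0) (nhds 0)"
    by (intro tendsto_poly filterlim_ident)
  then have evi: "eventually (\<lambda>t. P t $ i \<noteq> 0) (nhds 0)"
    unfolding P(2) using gi0 by (rule tendsto_imp_eventually_ne)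
  have h\<gamma>: "hpt (\<gamma> t) = hpt (P t)" if "P t $ i \<noteq> 0" for t
    unfolding \<gamma>_def by (rule hpt_smult) (use that in simp)
  have \<gamma>0: "hpt (\<gamma> 0) = x" using h\<gamma>[of 0] P(5,6) by simp
  have "eventually (\<lambda>t. \<gamma> t $ i = 1 \<and> hpt (\<gamma> t) \<in> C) (nhds 0)"
    using evi by eventually_elim (simp add: h\<gamma> P(4), simp add: \<gamma>_def)
  then have cgC: "curve_germ i C x \<gamma>" unfolding curve_germ_def using an \<gamma>0 by blast
  obtain U where U: "open U" "x \<in> U" "C \<inter> U \<subseteq> X \<inter> U" using C(4) unfolding germ_subset_def by blast
  have "continuous_on UNIV P"
  proof -
    have "continuous_on UNIV (\<lambda>t. \<chi> j. P t $ j)"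
      unfolding P(2) by (intro continuous_on_vec_lambda continuous_intros)
    then show ?thesis by (simp only: vec_lambda_eta)
  qed
  then have "open (P -` {v. v \<noteq> 0 \<and> hpt v \<in> U})"
    using open_hpt_vimage[OF U(1)] open_vimage by blast
  then have "eventually (\<lambda>t. t \<in> P -` {v. v \<noteq> 0 \<and> hpt v \<in> U}) (nhds 0)"
    by (rule eventually_nhds_in_open) (use P(3,5) U(2) in auto)
  with evi have "eventually (\<lambda>t. \<gamma> t $ i = 1 \<and> hpt (\<gamma> t) \<in> X) (nhds 0)"
  proof eventually_elim
    case (elim t)
    then have "hpt (P t) \<in> X" using P(4)[of t] U(3) by auto
    then show ?case using h\<gamma>[OF elim(1)] elim(1) by (simp add: \<gamma>_def)
  qed
  then have cgX: "curve_germ i X x \<gamma>" unfolding curve_germ_def using an \<gamma>0 by blast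
  obtain y :: "complex \<Rightarrow> complex ^ 'n" where y: "\<And>j. (\<lambda>t. y t $ j) analytic_on {0}" "y 0 = 0"
        "eventually (\<lambda>t. norm (y t) < r \<and> \<Phi> (y t) = \<gamma> t) (nhds 0)"
    using lift[OF cgX] by blast
  have ev\<Phi>: "eventually (\<lambda>t. \<Phi> (y t) = \<gamma> t) (nhds 0)" using y(3) by eventually_elim simp
  define y' where "y' = (\<chi> j. deriv (\<lambda>t. y t $ j) 0)"
  have cd: "curve_deriv 1 \<gamma> = linear_part y'" unfolding y'_def by (rule curve_deriv_1[OF y(1,2) an ev\<Phi>])
  have "curve_deriv 1 \<gamma> \<in> tangent_space i C x" unfolding tangent_space_def using cgC by blast
  then obtain \<kappa> where \<kappa>: "curve_deriv 1 \<gamma> = \<kappa> *s linear_part v"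
    unfolding C(3) by (auto simp: vec.span_singleton)
  then have "linear_part y' = linear_part (\<kappa> *s v)" using cd by (simp only: linear_part_scale)
  then have y'v: "y' = \<kappa> *s v" by (rule linear_part_inj)
  \<comment> \<open>Otherwise the product of \<open>poly (g i)\<close>, whose first-order term
    vanishes, and \<open>dotp l1\<close> of \<gamma> would have derivative 0 at 0; near 0 this
    product is the identity.\<close>
  have "curve_deriv 1 \<gamma> \<noteq> 0"
  proof
    assume z: "curve_deriv 1 \<gamma> = 0"
    have d\<gamma>: "((\<lambda>t. \<gamma> t $ j) has_field_derivative 0) (at 0)" for j
    proof -
      have "(\<lambda>t. \<gamma> t $ j) field_differentiable (at 0)"
        by (rule analytic_on_imp_differentiable_at[OF an]) simp
      moreover have "deriv (\<lambda>t. \<gamma> t $ j) 0 = 0"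
        using z by (simp add: curve_deriv_def vec_eq_iff)
      ultimately show ?thesis using field_differentiable_derivI by force
    qed
    have "((\<lambda>t. dotp l1 (\<gamma> t)) has_field_derivative (\<Sum>j\<in>UNIV. l1 $ j * 0)) (at 0)"
      unfolding dotp_def by (intro DERIV_sum DERIV_cmult d\<gamma>)
    moreover have "((\<lambda>t. poly (g i) t) has_field_derivative 0) (at 0)"
      using poly_DERIV[of "g i" 0] P(7) by (simp add: poly_0_coeff_0 coeff_pderiv)
    ultimately have "((\<lambda>t. poly (g i) t * dotp l1 (\<gamma> t)) has_field_derivative 0 * dotp l1 (\<gamma> 0) + (\<Sum>j\<in>UNIV. l1 $ j * 0) * poly (g i) 0) (at 0)"
      by (intro DERIV_mult)
    moreover have "eventually (\<lambda>t. poly (g i) t * dotp l1 (\<gamma> t) = t) (nhds 0)"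
      using evi
    proof eventually_elim
      case (elim t)
      then show ?case using P(9)[of t] by (simp add: \<gamma>_def P(2))
    qed
    ultimately have "((\<lambda>t. t) has_field_derivative (0 :: complex)) (at (0 :: complex))"
      using DERIV_cong_ev[OF refl _ refl, of "\<lambda>t. poly (g i) t * dotp l1 (\<gamma> t)" "\<lambda>t. t" "0 :: complex" "0 :: complex"] by simp
    then show False using DERIV_unique[OF DERIV_ident] by fastforce
  qed
  then have \<kappa>0: "\<kappa> \<noteq> 0" using \<kappa> by auto
  \<comment> \<open>Substituting t / \<kappa> makes the tangent exactly \<open>v\<close>, and
    dividing by the constant term makes \<lambda>(0) = 1. Both preserve the vanishing first-order
    term.\<close>
  define c where "c = 1 / \<kappa>"
  define h where "h j = smult (1 / coeff (g i) 0) (pcompose (g j) [:0, c:])" for j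
  have ph: "poly (h j) t = poly (g j) (c * t) / coeff (g i) 0" for j t
    by (simp add: h_def poly_pcompose mult.commute)
  show ?thesis
  proof (rule that[of h "\<lambda>t. y (c * t)"])
    show "degree (h j) \<le> q" for j
    proof -
      have "degree (h j) \<le> degree (g j)" unfolding h_def
        by (rule order_trans[OF degree_smult_le])
           (use degree_pcompose_le[of "g j" "[:0, c:]"] in \<open>auto split: if_splits\<close>)
      then show ?thesis using P(1) order_trans by blast
    qed
    have g0: "coeff (g i) 0 \<noteq> 0" using gi0 by (simp add: poly_0_coeff_0)
    show "coeff (h i) 0 = 1" using ph[of i 0] g0 by (simp add: poly_0_coeff_0)
    show "coeff (h i) 1 = 0"
    proof -
      have "coeff (h i) 1 = poly (pderiv (h i)) 0" by (simp add: poly_0_coeff_0 coeff_pderiv)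
      also have "\<dots> = (1 / coeff (g i) 0) * (poly (pderiv (g i)) 0 * poly (pderiv [:0, c:]) 0)"
        by (simp add: h_def pderiv_smult pderiv_pcompose poly_pcompose)
      also have "poly (pderiv (g i)) 0 = 0" using P(7) by (simp add: poly_0_coeff_0 coeff_pderiv)
      finally show ?thesis by simp
    qed
    show "(\<lambda>t. y (c * t) $ j) analytic_on {0}" for j
      using analytic_smult_arg(1)[OF y(1)[of j]] .
    show "y (c * 0) = 0" using y(2) by simp
    show "deriv (\<lambda>t. y (c * t) $ j) 0 = v $ j" for j
    proof -
      have "deriv (\<lambda>t. y t $ j) 0 = \<kappa> * v $ j" using y'v by (simp add: y'_def vec_eq_iff)
      then show ?thesis using analytic_smult_arg(2)[OF y(1)[of j], of c] \<kappa>0 by (simp add: c_def)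
    qed
    have "eventually (\<lambda>t. \<Phi> (y t) = \<gamma> t \<and> P t $ i \<noteq> 0) (nhds 0)"
      using ev\<Phi> evi by eventually_elim simp
    moreover have "filterlim (\<lambda>t. c * t) (nhds 0) (nhds 0)"
      by (auto intro!: tendsto_eq_intros filterlim_ident)
    ultimately have "eventually (\<lambda>t. \<Phi> (y (c * t)) = \<gamma> (c * t) \<and> P (c * t) $ i \<noteq> 0) (nhds 0)"
      by (rule eventually_compose_filterlim)
    then show "eventually (\<lambda>t. \<forall>j. poly (h j) t = poly (h i) t * \<Phi> (y (c * t)) $ j) (nhds 0)"
      by eventually_elim (simp add: ph \<gamma>_def P(2))
  qed
qed

section \<open>One chosen curve in every direction\<close>

definition good_curve :: "complex ^ 'n \<Rightarrow> ('m option \<Rightarrow> complex poly) \<Rightarrow> (complex \<Rightarrow> complex ^ 'n) \<Rightarrow> bool" where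
  "good_curve v g y \<longleftrightarrow> (\<forall>j. degree (g j) \<le> q) \<and> coeff (g i) 0 = 1 \<and> coeff (g i) 1 = 0 \<and>
    (\<forall>j. (\<lambda>t. y t $ j) analytic_on {0}) \<and> y 0 = 0 \<and> (\<forall>j. deriv (\<lambda>t. y t $ j) 0 = v $ j) \<and>
    eventually (\<lambda>t. \<forall>j. poly (g j) t = poly (g i) t * \<Phi> (y t) $ j) (nhds 0)"

text \<open>Nothing relates the choices for different directions, not even for proportional ones;
  homogeneity and polynomiality in \<open>v\<close> are consequences of
  \<open>curve_family\<close>.\<close>

definition curve_choice where
  "curve_choice v = (SOME gy. good_curve v (fst gy) (snd gy))"

lemma good_curve_choice:
  assumes "v \<noteq> 0"
  shows "good_curve v (fst (curve_choice v)) (snd (curve_choice v))"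
proof -
  obtain g y where "good_curve v g y"
    by (rule curve_in_direction[OF assms]) (unfold good_curve_def, blast)
  then have "\<exists>gy. good_curve v (fst gy) (snd gy)" by (intro exI[of _ "(g, y)"]) simp
  then show ?thesis unfolding curve_choice_def by (rule someI_ex)
qed

definition lam :: "complex ^ 'n \<Rightarrow> complex fps" where
  "lam v = (if v = 0 then 1 else fps_of_poly (fst (curve_choice v) i))"

definition Y :: "complex ^ 'n \<Rightarrow> 'n \<Rightarrow> complex fps" where
  "Y v j = (if v = 0 then 0 else fps_expansion (\<lambda>t. snd (curve_choice v) t $ j) 0)"

lemma poly_has_fps_expansion: "(\<lambda>t. poly p t) has_fps_expansion fps_of_poly (p :: complex poly)"
proof (induction p)
  case (pCons a p)
  have "(\<lambda>t. a + poly p t * t) has_fps_expansion (fps_const a + fps_of_poly p * fps_X)"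
    by (intro has_fps_expansion_add has_fps_expansion_mult has_fps_expansion_const has_fps_expansion_fps_X pCons.IH)
  then show ?case by (simp add: fps_of_poly_pCons mult.commute)
qed simp

lemma poly_curve_coeff:
  assumes v: "v \<noteq> 0"
  shows "coeff (fst (curve_choice v) j) K = (\<Sum>k\<le>K. \<Sum>\<alpha>\<in>expos k. fps_nth (lam v * mon \<alpha> (Y v)) K * e \<alpha> $ j)"
proof -
  define g where "g = fst (curve_choice v)"
  define y where "y = snd (curve_choice v)"
  have gy: "\<And>j. degree (g j) \<le> q" "coeff (g i) 0 = 1" "coeff (g i) 1 = 0"
    "\<And>j. (\<lambda>t. y t $ j) analytic_on {0}" "y 0 = 0" "\<And>j. deriv (\<lambda>t. y t $ j) 0 = v $ j"
    "eventually (\<lambda>t. \<forall>j. poly (g j) t = poly (g i) t * \<Phi> (y t) $ j) (nhds 0)"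
    using good_curve_choice[OF v] by (simp_all add: good_curve_def g_def y_def)
  have "((\<lambda>t. poly (g i) t) \<longlongrightarrow> poly (g i) 0) (nhds 0)"
    by (intro tendsto_poly filterlim_ident)
  moreover have "poly (g i) 0 \<noteq> 0" using gy(2) by (simp add: poly_0_coeff_0)
  ultimately have evi: "eventually (\<lambda>t. poly (g i) t \<noteq> 0) (nhds 0)"
    by (rule tendsto_imp_eventually_ne)
  \<comment> \<open>Near 0 the j-th coordinate of \<Phi>(y(t)) is this quotient of polynomials,
    which provides its expansion; \<open>coeff_compose\<close> then expresses it by the Taylor
    coefficients.\<close>
  define G where "G = fps_of_poly (g j) / fps_of_poly (g i)"
  have q1: "(\<lambda>t. poly (g j) t / poly (g i) t) has_fps_expansion G"
    unfolding G_def by (rule has_fps_expansion_divide'[OF poly_has_fps_expansion poly_has_fps_expansion])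
      (simp add: gy(2))
  have ev: "eventually (\<lambda>t. poly (g j) t / poly (g i) t = \<Phi> (y t) $ j) (nhds 0)"
    using evi gy(7)
  proof eventually_elim
    case (elim t)
    then have "poly (g j) t = poly (g i) t * \<Phi> (y t) $ j" by blast
    then show ?case using elim(1) by simp
  qed
  have G: "(\<lambda>t. \<Phi> (y t) $ j) has_fps_expansion G"
    by (rule iffD1[OF has_fps_expansion_cong[OF ev refl] q1])
  have "(\<lambda>t. poly (g j) t - poly (g i) t * \<Phi> (y t) $ j) has_fps_expansion (fps_of_poly (g j) - fps_of_poly (g i) * G)"
    by (intro has_fps_expansion_diff has_fps_expansion_mult poly_has_fps_expansion G)
  moreover have "eventually (\<lambda>t. norm (poly (g j) t - poly (g i) t * \<Phi> (y t) $ j) \<le> 0 * norm t ^ Suc K) (nhds 0)"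
    using gy(7)
  proof eventually_elim
    case (elim t)
    then have "poly (g j) t = poly (g i) t * \<Phi> (y t) $ j" by blast
    then show ?case by simp
  qed
  ultimately have "fps_nth (fps_of_poly (g j) - fps_of_poly (g i) * G) K = 0"
    by (rule fps_nth_eq_0_if_bounded) simp
  then have "coeff (g j) K = fps_nth (fps_of_poly (g i) * G) K" by simp
  also have "\<dots> = (\<Sum>l=0..K. fps_nth (lam v) l * fps_nth G (K - l))"
    using v by (simp add: fps_mult_nth lam_def g_def)
  also have "\<dots> = (\<Sum>l=0..K. \<Sum>k\<le>K. \<Sum>\<alpha>\<in>expos k. fps_nth (lam v) l * (fps_nth (mon \<alpha> (Y v)) (K - l) * e \<alpha> $ j))"
  proof (intro sum.cong refl)
    fix l
    have "Y v = (\<lambda>j. fps_expansion (\<lambda>t. y t $ j) 0)" using v by (intro ext) (simp add: Y_def y_def)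
    then show "fps_nth (lam v) l * fps_nth G (K - l) =
        (\<Sum>k\<le>K. \<Sum>\<alpha>\<in>expos k. fps_nth (lam v) l * (fps_nth (mon \<alpha> (Y v)) (K - l) * e \<alpha> $ j))"
      using coeff_compose[OF gy(4,5) G, of "K - l" K] by (simp add: sum_distrib_left)
  qed
  also have "\<dots> = (\<Sum>k\<le>K. \<Sum>\<alpha>\<in>expos k. \<Sum>l=0..K. fps_nth (lam v) l * (fps_nth (mon \<alpha> (Y v)) (K - l) * e \<alpha> $ j))"
    by (subst sum.swap) (intro sum.cong refl sum.swap)
  also have "\<dots> = (\<Sum>k\<le>K. \<Sum>\<alpha>\<in>expos k. fps_nth (lam v * mon \<alpha> (Y v)) K * e \<alpha> $ j)"
    by (simp add: fps_mult_nth sum_distrib_right mult.assoc)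
  finally show ?thesis by (simp add: g_def)
qed

lemma curve_family: "curve_family e q lam Y"
proof
  fix v :: "complex ^ 'n" and j
  show "fps_nth (lam v) 0 = 1" "fps_nth (lam v) 1 = 0"
    using good_curve_choice[of v] by (auto simp: lam_def good_curve_def)
  show "fps_nth (Y v j) 0 = 0" "fps_nth (Y v j) 1 = v $ j"
    using good_curve_choice[of v] by (auto simp: Y_def good_curve_def fps_expansion_def)
next
  fix K and v :: "complex ^ 'n"
  assume K: "K > q"
  show "(\<Sum>k\<le>K. \<Sum>\<alpha>\<in>expos k. fps_nth (lam v * mon \<alpha> (Y v)) K *s e \<alpha>) = 0"
  proof (cases "v = 0")
    case True
    have "fps_nth (lam 0 * mon \<alpha> (Y 0)) K = 0" if "\<alpha> \<in> expos k" for k and \<alpha> :: "'n \<Rightarrow> nat"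
    proof -
      \<comment> \<open>For |\<alpha>| = 0 this is 1, not 0; that term contributes only in order 0,
        which is below K.\<close>
      have "mon \<alpha> (Y 0) = 0 ^ (\<Sum>i\<in>UNIV. \<alpha> i)"
        by (simp add: Y_def mon_def power_sum)
      then have "mon \<alpha> (Y 0) = 0 ^ k" using that by (simp add: expos_def)
      then show ?thesis using K by (cases k) (simp_all add: lam_def)
    qed
    then show ?thesis using True by (intro sum.neutral ballI) simp
  next
    case False
    have "degree (fst (curve_choice v) j) < K" for j
      using good_curve_choice[OF False] K unfolding good_curve_def by (metis le_less_trans)
    then have "coeff (fst (curve_choice v) j) K = 0" for j by (rule coeff_eq_0)
    then show ?thesis using poly_curve_coeff[OF False, of _ K] by (simp add: vec_eq_iff)
  qed
qed (use q e_independent in \<open>auto simp: lam_def Y_def\<close>)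

interpretation cf: curve_family e q lam Y
  by (rule curve_family)

section \<open>Comparison of the germ with the Veronese variety\<close>

definition affine_vec :: "complex ^ 'n \<Rightarrow> complex ^ ('n option)" where
  "affine_vec v = (\<chi> j. case j of None \<Rightarrow> 1 | Some j \<Rightarrow> v $ j)"

lemma p_curve:
  assumes v: "v \<noteq> 0"
  shows "eventually (\<lambda>t. cf.p (affine_vec (t *s v)) =
    poly (fst (curve_choice v) i) t *s \<Phi> (snd (curve_choice v) t)) (nhds 0)"
proof -
  have val: "cf.p (affine_vec (t *s v)) $ j = poly (fst (curve_choice v) j) t" for t j
  proof -
    have deg: "degree (fst (curve_choice v) j) \<le> q"
      using good_curve_choice[OF v] by (simp add: good_curve_def)
    have "affine_vec (t *s v) = (\<chi> j. case j of None \<Rightarrow> 1 | Some j \<Rightarrow> t * v $ j)"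
      by (simp add: affine_vec_def vec_eq_iff split: option.split)
    then have "cf.p (affine_vec (t *s v)) $ j = (\<Sum>k\<le>q. t ^ k * cf.p_coeff k v $ j)"
      by (simp add: cf.p_affine)
    also have "\<dots> = (\<Sum>k\<le>q. coeff (fst (curve_choice v) j) k * t ^ k)"
      by (simp add: cf.p_coeff_def poly_curve_coeff[OF v] mult.commute)
    also have "\<dots> = poly (fst (curve_choice v) j) t"
      unfolding poly_altdef by (rule sum.mono_neutral_right) (use deg in \<open>auto simp: coeff_eq_0\<close>)
    finally show ?thesis .
  qed
  have "eventually (\<lambda>t. \<forall>j. poly (fst (curve_choice v) j) t =
      poly (fst (curve_choice v) i) t * \<Phi> (snd (curve_choice v) t) $ j) (nhds 0)"
    using good_curve_choice[OF v] unfolding good_curve_def by blast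
  then show ?thesis
    unfolding vec_eq_iff[of "cf.p _"] val vector_smult_component .
qed

lemma germ_eq_veronese: "\<exists>V. veronese_variety TYPE('n) q V \<and> germ_eq x X V"
proof -
  note ver = veronese_embedding_if_dim[of cf.p q, OF cf.p_homf cf.card_le_dim_span_p]
  obtain \<nu> :: "'n cproj \<Rightarrow> 'm cproj" where \<nu>: "veronese_embedding q \<nu>"
    "\<And>z. z \<noteq> 0 \<Longrightarrow> cf.p z \<noteq> 0" "\<And>z. z \<noteq> 0 \<Longrightarrow> \<nu> (hpt z) = hpt (cf.p z)"
    using ver(2) by blast
  have func: "\<exists>l. \<forall>z. dotp l (cf.p z) = z $ None ^ (q - 1) * z $ j" for j
  proof -
    have "(\<lambda>z :: complex ^ ('n option). z $ None ^ (q - 1) * z $ j) \<in> homf q"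
      using homf_mult[OF homf_coord_power[of None "q - 1"] homf_coord[of j]] q by simp
    from bspec[OF ver(1) this] show ?thesis .
  qed
  from choice[OF allI[OF func]] obtain l where
    l: "\<forall>j. \<forall>z. dotp (l j) (cf.p z) = z $ None ^ (q - 1) * z $ j" ..
  \<comment> \<open>A linear map inverting the Veronese map where z_0 \<noteq> 0: it returns z up to
    the factor z_0^(q-1).\<close>
  define N where "N \<xi> = (\<chi> j. dotp (l j) \<xi>)" for \<xi> :: "complex ^ ('m option)"
  have Np: "N (cf.p z) = (z $ None ^ (q - 1)) *s z" for z
    using l by (simp add: N_def vec_eq_iff)
  have N_scale: "N (c *s \<xi>) = c *s N \<xi>" for c \<xi> by (simp add: N_def vec_eq_iff)
  have qS: "c ^ q = c ^ (q - 1) * c" for c :: complex using q by (cases q) simp_all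
  \<comment> \<open>For \<xi> = p(z), both p(N \<xi>) and N(\<xi>)_0^(q-1) \<xi> equal z_0^(q(q-1))
    p(z). \<open>E\<close> pulls this equation back to the germ; both sides being homogeneous of
    degree \<open>q\<close> in \<xi>, it can be tested on \<Phi> without the factor
    \<lambda>.\<close>
  define E where "E j u = (N (\<Phi> u) $ None) ^ (q - 1) * \<Phi> u $ j - cf.p (N (\<Phi> u)) $ j" for j u
  have lhN: "line_holomorphic r (\<lambda>u. N (\<Phi> u) $ j)" for j
    unfolding N_def vec_lambda_beta by (rule line_holomorphic_dotp[OF lh])
  have lhE: "line_holomorphic r (E j)" for j
    unfolding E_def[abs_def]
    by (intro line_holomorphic_diff line_holomorphic_mult line_holomorphic_power lhN lh
        line_holomorphic_homf[OF cf.p_homf])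
  have on_curve: "eventually (\<lambda>t. E j (snd (curve_choice v) t) = 0) (nhds 0)"
    and base: "N (\<Phi> 0) = affine_vec 0" if v: "v \<noteq> 0" for j v
  proof -
    define lm where "lm t = poly (fst (curve_choice v) i) t" for t
    define y where "y = snd (curve_choice v)"
    have ev: "eventually (\<lambda>t. cf.p (affine_vec (t *s v)) = lm t *s \<Phi> (y t)) (nhds 0)"
      using p_curve[OF v] by (simp add: lm_def y_def)
    have N1: "lm t *s N (\<Phi> (y t)) = affine_vec (t *s v)"
      if "cf.p (affine_vec (t *s v)) = lm t *s \<Phi> (y t)" for t
    proof -
      have "N (cf.p (affine_vec (t *s v))) = affine_vec (t *s v)"
        unfolding Np by (simp add: affine_vec_def)
      then show ?thesis by (simp only: that N_scale)
    qed
    show "N (\<Phi> 0) = affine_vec 0"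
    proof -
      have "lm 0 = 1" "y 0 = 0"
        using good_curve_choice[OF v] by (auto simp: lm_def y_def good_curve_def poly_0_coeff_0)
      then show ?thesis using N1[OF eventually_nhds_x_imp_x[OF ev]] by simp
    qed
    show "eventually (\<lambda>t. E j (snd (curve_choice v) t) = 0) (nhds 0)"
      using ev
    proof eventually_elim
      case (elim t)
      note N2 = N1[OF elim]
      have lN: "lm t * N (\<Phi> (y t)) $ None = 1"
      proof -
        have "(lm t *s N (\<Phi> (y t))) $ None = 1" unfolding N2 by (simp add: affine_vec_def)
        then show ?thesis by simp
      qed
      define c where "c = N (\<Phi> (y t)) $ None"
      have c: "c * lm t = 1" using lN by (simp add: c_def mult.commute)
      have "N (\<Phi> (y t)) = c *s affine_vec (t *s v)"
        unfolding N2[symmetric] by (simp add: c)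
      then have "cf.p (N (\<Phi> (y t))) $ j = c ^ q * cf.p (affine_vec (t *s v)) $ j"
        by (simp only: homf_homogeneous[OF cf.p_homf])
      also have "\<dots> = c ^ (q - 1) * (c * lm t) * \<Phi> (y t) $ j"
        by (simp add: elim qS)
      also have "\<dots> = c ^ (q - 1) * \<Phi> (y t) $ j" by (simp add: c)
      finally show ?case by (simp add: E_def y_def[symmetric] c_def)
    qed
  qed
  have "\<exists>\<rho>>0. \<forall>u. norm u < \<rho> \<longrightarrow> E j u = 0" for j
  proof (rule line_holomorphic_eq_0_if_curves[OF lhE r])
    fix v :: "complex ^ 'n" assume v: "v \<noteq> 0"
    show "\<exists>y :: complex \<Rightarrow> complex ^ 'n. (\<forall>j. (\<lambda>t. y t $ j) analytic_on {0}) \<and> y 0 = 0 \<and>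
      (\<forall>j. deriv (\<lambda>t. y t $ j) 0 = v $ j) \<and> eventually (\<lambda>t. E j (y t) = 0) (nhds 0)"
      using on_curve[OF v] good_curve_choice[OF v] unfolding good_curve_def
      by (intro exI[of _ "snd (curve_choice v)"]) blast
  qed
  from choice[OF allI[OF this]] obtain R where R: "\<forall>j. R j > 0 \<and> (\<forall>u. norm u < R j \<longrightarrow> E j u = 0)" ..
  have av0: "affine_vec v $ None = 1" "affine_vec v \<noteq> 0" for v
    by (auto simp: affine_vec_def vec_eq_iff intro: exI[of _ None])
  have base0: "N (\<Phi> 0) $ None = 1"
    using base[of "axis undefined 1"] av0 by (simp add: axis_eq_0_iff)
  have cN: "continuous_on (ball 0 r) (\<lambda>u. N (\<Phi> u) $ j)" for j
    using lhN by (simp add: line_holomorphic_def)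
  have "open (ball 0 r \<inter> (\<lambda>u. N (\<Phi> u) $ None) -` (- {0}))"
    by (rule continuous_open_preimage[OF cN]) auto
  moreover have "0 \<in> ball 0 r \<inter> (\<lambda>u. N (\<Phi> u) $ None) -` (- {0})" using r base0 by simp
  ultimately obtain R0 where R0: "R0 > 0" "ball 0 R0 \<subseteq> ball 0 r \<inter> (\<lambda>u. N (\<Phi> u) $ None) -` (- {0})"
    unfolding open_contains_ball by blast
  define \<sigma> where "\<sigma> = Min (insert r (insert R0 (range R)))"
  have \<sigma>: "\<sigma> > 0" "\<sigma> \<le> r" "\<sigma> \<le> R0"
    using r R0 R by (auto simp: \<sigma>_def)
  have \<sigma>R: "\<sigma> \<le> R j" for j
    unfolding \<sigma>_def by (rule Min_le) auto
  have N0: "N (\<Phi> u) $ None \<noteq> 0" if "norm u < \<sigma>" for u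
    using R0(2) that \<sigma>(3) by (auto simp: subset_iff)
  have pN: "cf.p (N (\<Phi> u)) = (N (\<Phi> u) $ None) ^ (q - 1) *s \<Phi> u" if "norm u < \<sigma>" for u
  proof -
    have "E j u = 0" for j using R that \<sigma>R[of j] by (meson less_le_trans)
    then show ?thesis by (simp add: vec_eq_iff E_def)
  qed
  have hptN: "N (\<Phi> u) \<noteq> 0" "\<nu> (hpt (N (\<Phi> u))) = hpt (\<Phi> u)" if u: "norm u < \<sigma>" for u
  proof -
    show nz: "N (\<Phi> u) \<noteq> 0" using N0[OF u] by auto
    show "\<nu> (hpt (N (\<Phi> u))) = hpt (\<Phi> u)"
      unfolding \<nu>(3)[OF nz] pN[OF u] using N0[OF u] by (intro hpt_smult) simp
  qed
  define W where "W z = (\<chi> k. z $ Some k / z $ None)" for z :: "complex ^ ('n option)"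
  have W_eq: "z = (z $ None) *s affine_vec (W z)" if "z $ None \<noteq> 0" for z
  proof (simp only: vec_eq_iff, rule allI)
    fix j show "z $ j = ((z $ None) *s affine_vec (W z)) $ j"
      using that by (cases j) (auto simp: affine_vec_def W_def)
  qed
  have W_scale: "W (c *s z) = W z" if "c \<noteq> 0" for c z
    using that by (simp add: W_def vec_eq_iff)
  have hptW: "hpt z = hpt z'" if "z $ None \<noteq> 0" "z' $ None \<noteq> 0" "W z = W z'" for z z'
    using W_eq[OF that(1)] W_eq[OF that(2)] hpt_smult that by metis
  \<comment> \<open>The parameters of the Veronese map that the germ reaches. The map is injective
    because \<nu> takes the class of N(\<Phi> u) back to that of \<Phi> u, and source and target
    have the same dimension, so the image is open.\<close>
  define \<Omega> where "\<Omega> = (\<lambda>u. W (N (\<Phi> u))) ` ball 0 \<sigma>"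
  have "open \<Omega>" unfolding \<Omega>_def
  proof (rule invariance_of_domain)
    show "continuous_on (ball 0 \<sigma>) (\<lambda>u. W (N (\<Phi> u)))"
      unfolding W_def
      by (intro continuous_on_vec_lambda continuous_intros continuous_on_subset[OF cN])
         (use \<sigma>(2) N0 in auto)
    show "inj_on (\<lambda>u. W (N (\<Phi> u))) (ball 0 \<sigma>)"
    proof (rule inj_onI)
      fix u v assume u: "u \<in> ball 0 \<sigma>" and v: "v \<in> ball 0 \<sigma>" and eq: "W (N (\<Phi> u)) = W (N (\<Phi> v))"
      then have uv: "norm u < \<sigma>" "norm v < \<sigma>" by auto
      have "hpt (N (\<Phi> u)) = hpt (N (\<Phi> v))" using N0[OF uv(1)] N0[OF uv(2)] eq by (rule hptW)
      then have "hpt (\<Phi> u) = hpt (\<Phi> v)" using hptN(2)[OF uv(1)] hptN(2)[OF uv(2)] by simp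
      then show "u = v" using uv \<sigma>(2) by (intro inj_onD[OF inj\<Phi>]) auto
    qed
  qed simp
  \<comment> \<open>The neighbourhood in which a Veronese point has its parameter in \<Omega> and
    hence lies on the germ. The conditions are invariant under scaling, so openness can be checked
    on homogeneous coordinates.\<close>
  define U1 where "U1 = {P. \<exists>\<xi>. P = hpt \<xi> \<and> N \<xi> $ None \<noteq> 0 \<and> W (N \<xi>) \<in> \<Omega>}"
  have U1_iff: "hpt \<xi> \<in> U1 \<longleftrightarrow> N \<xi> $ None \<noteq> 0 \<and> W (N \<xi>) \<in> \<Omega>" if \<xi>: "\<xi> \<noteq> 0" for \<xi>
  proof
    assume "hpt \<xi> \<in> U1"
    then obtain \<eta> where \<eta>: "hpt \<xi> = hpt \<eta>" "N \<eta> $ None \<noteq> 0" "W (N \<eta>) \<in> \<Omega>" by (auto simp: U1_def)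
    have "\<eta> \<noteq> 0" using \<eta>(2) by (auto simp: N_def)
    then obtain c where "c \<noteq> 0" "\<xi> = c *s \<eta>" using hpt_eq_imp[OF \<xi> _ \<eta>(1)] by blast
    then show "N \<xi> $ None \<noteq> 0 \<and> W (N \<xi>) \<in> \<Omega>" using \<eta> by (simp add: N_scale W_scale)
  qed (auto simp: U1_def)
  have "open U1"
  proof -
    have cNN: "continuous_on A (\<lambda>\<xi>. N \<xi> $ j)" for A j
      unfolding N_def dotp_def vec_lambda_beta by (intro continuous_intros)
    have o: "open {\<xi>. N \<xi> $ None \<noteq> 0}" by (intro open_Collect_neq cNN continuous_intros)
    have "continuous_on {\<xi>. N \<xi> $ None \<noteq> 0} (\<lambda>\<xi>. W (N \<xi>))"
      unfolding W_def by (intro continuous_on_vec_lambda continuous_intros cNN) auto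
    then have "open ({\<xi>. N \<xi> $ None \<noteq> 0} \<inter> (\<lambda>\<xi>. W (N \<xi>)) -` \<Omega>)"
      using o \<open>open \<Omega>\<close> by (rule continuous_open_preimage)
    also have "{\<xi>. N \<xi> $ None \<noteq> 0} \<inter> (\<lambda>\<xi>. W (N \<xi>)) -` \<Omega> = {\<xi>. \<xi> \<noteq> 0 \<and> hpt \<xi> \<in> U1}"
    proof (intro set_eqI iffI)
      fix \<xi> assume h: "\<xi> \<in> {\<xi>. N \<xi> $ None \<noteq> 0} \<inter> (\<lambda>\<xi>. W (N \<xi>)) -` \<Omega>"
      then have "\<xi> \<noteq> 0" by (auto simp: N_def)
      then show "\<xi> \<in> {\<xi>. \<xi> \<noteq> 0 \<and> hpt \<xi> \<in> U1}" using h U1_iff by simp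
    next
      fix \<xi> assume "\<xi> \<in> {\<xi>. \<xi> \<noteq> 0 \<and> hpt \<xi> \<in> U1}"
      then show "\<xi> \<in> {\<xi>. N \<xi> $ None \<noteq> 0} \<inter> (\<lambda>\<xi>. W (N \<xi>)) -` \<Omega>" using U1_iff[of \<xi>] by auto
    qed
    finally show ?thesis by (simp add: open_cproj_def)
  qed
  have xU1: "x \<in> U1"
    unfolding U1_def \<Omega>_def using \<Phi>0 base0 \<sigma>(1) by (auto intro!: exI[of _ "\<Phi> 0"])
  obtain U2 where U2: "open U2" "x \<in> U2" "X \<inter> U2 \<subseteq> (\<lambda>u. hpt (\<Phi> u)) ` ball 0 \<sigma>"
    using nbhd[OF \<sigma>(1,2)] by blast
  have "X \<inter> (U1 \<inter> U2) = range \<nu> \<inter> (U1 \<inter> U2)"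
  proof (intro set_eqI iffI)
    fix P assume P: "P \<in> X \<inter> (U1 \<inter> U2)"
    then have "P \<in> (\<lambda>u. hpt (\<Phi> u)) ` ball 0 \<sigma>" using U2(3) by auto
    then obtain u where u: "norm u < \<sigma>" "P = hpt (\<Phi> u)" by auto
    have "P = \<nu> (hpt (N (\<Phi> u)))" using hptN(2)[OF u(1)] u(2) by simp
    then show "P \<in> range \<nu> \<inter> (U1 \<inter> U2)" using P by blast
  next
    fix P assume P: "P \<in> range \<nu> \<inter> (U1 \<inter> U2)"
    then obtain Q where Q: "P = \<nu> Q" by blast
    obtain z where z: "z \<noteq> 0" "Q = hpt z" by (rule ex_hpt)
    have Pz: "P = hpt (cf.p z)" using Q z \<nu>(3) by simp
    then have h: "N (cf.p z) $ None \<noteq> 0" "W (N (cf.p z)) \<in> \<Omega>"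
      using P U1_iff[OF \<nu>(2)[OF z(1)]] by auto
    have zq: "z $ None ^ (q - 1) \<noteq> 0" "z $ None \<noteq> 0" using h(1) by (auto simp: Np)
    obtain u where u: "norm u < \<sigma>" "W z = W (N (\<Phi> u))"
      using h(2) W_scale[OF zq(1)] unfolding \<Omega>_def Np by auto
    have "hpt z = hpt (N (\<Phi> u))" using zq(2) N0[OF u(1)] u(2) by (rule hptW)
    then have "P = hpt (\<Phi> u)" using Q z(2) hptN(2)[OF u(1)] by simp
    then show "P \<in> X \<inter> (U1 \<inter> U2)" using P \<Phi>X[of u] u(1) \<sigma>(2) by auto
  qed
  then have "germ_eq x X (range \<nu>)"
    unfolding germ_eq_def using \<open>open U1\<close> U2(1,2) xU1 by (intro exI[of _ "U1 \<inter> U2"]) auto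
  moreover have "veronese_variety TYPE('n) q (range \<nu>)"
    unfolding veronese_variety_def using \<nu>(1) by blast
  ultimately show ?thesis by blast
qed

end

theorem mainTheorem1:
  fixes X :: "'N::finite cproj set" and x :: "'N cproj" and i :: "'N option" and q :: nat
  assumes "q \<ge> 1"
    and "x \<in> affine_chart i"
    and "submanifold_germ TYPE('n::finite) X x"
    and "q_regular i CARD('n) q X x"
    and "\<forall>v \<in> tangent_space i X x - {0}. \<exists>C. rational_normal_curve q C \<and> x \<in> C \<and>
           tangent_space i C x = vec.span {v} \<and> germ_subset x C X"
  shows "\<exists>V. veronese_variety TYPE('n) q V \<and> germ_eq x X V"
proof -
  obtain \<Phi> :: "complex ^ 'n \<Rightarrow> complex ^ ('N option)" and r where chart:
    "r > 0" "\<And>j. line_holomorphic r (\<lambda>u. \<Phi> u $ j)" "\<And>u. norm u < r \<Longrightarrow> \<Phi> u $ i = 1" "hpt (\<Phi> 0) = x"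
    "\<And>u. norm u < r \<Longrightarrow> hpt (\<Phi> u) \<in> X" "inj_on (\<lambda>u. hpt (\<Phi> u)) (ball 0 r)"
    "\<And>\<rho>. 0 < \<rho> \<Longrightarrow> \<rho> \<le> r \<Longrightarrow> \<exists>V. open V \<and> x \<in> V \<and> X \<inter> V \<subseteq> (\<lambda>u. hpt (\<Phi> u)) ` ball 0 \<rho>"
    "\<And>\<gamma>. curve_germ i X x \<gamma> \<Longrightarrow> \<exists>y. (\<forall>j. (\<lambda>t. y t $ j) analytic_on {0}) \<and> y 0 = 0 \<and>
        eventually (\<lambda>t. norm (y t) < r \<and> \<Phi> (y t) = \<gamma> t) (nhds 0)"
    by (rule submanifold_germ_chart[OF assms(3,2)]) blast
  obtain e \<rho> where taylor: "\<rho> > 0"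
    "\<And>j K. \<exists>C. \<forall>u. norm u < \<rho> \<longrightarrow>
       norm (\<Phi> u $ j - (\<Sum>k\<le>K. \<Sum>\<alpha>\<in>expos k. e \<alpha> $ j * mon \<alpha> (($) u))) \<le> C * norm u ^ Suc K"
    by (rule vector_taylor[OF chart(2,1)]) blast
  interpret veronese_germ X x i q \<Phi> r \<rho> e
    by (rule veronese_germ.intro[OF assms(1,2) chart taylor assms(4,5)])
  show ?thesis by (rule germ_eq_veronese)
qed

end
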